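(* (1) Let $G$ be a chordal graph having a dominating shortest path. Let $u$ be the last vertex visited by a LexBFS of $G$ started at an arbitrary vertex, and let $v$ be the last vertex visited by $LexBFS(u)$ (so $v$ is the vertex output by the 3-sweep LexBFS, whose eccentricity $e(v)$ is computed by the third sweep $LexBFS(v)$). If $e(v)\geq 3$ then $e(v)=diam(G)$. In particular, there is a linear-time algorithm deciding whether a chordal graph with a dominating shortest path has diameter at least four. (2) Assuming the Strong Exponential-Time Hypothesis, there is no truly subquadratic algorithm (i.e., no algorithm running in ${\cal O}(m^{2-\varepsilon})$ time for some $\varepsilon>0$ on $m$-edge inputs) deciding, for split graphs having a dominating edge, whether the diameter is two or three.
   Context: All graphs are finite, simple and connected on $n$ vertices and $m$ edges. A set $D$ of vertices is dominating if every vertex is in $D$ or adjacent to a vertex of $D$; a dominating shortest path (resp. dominating edge) is a shortest path (resp. edge) whose vertex set is dominating. A split graph is one whose vertex set can be partitioned into a clique and an independent set. LexBFS started at a vertex $s$: every vertex keeps a label (a sequence of integers, initially empty); for $j=1,\dots,n$, choose an unvisited vertex whose label is lexicographically largest (ties broken arbitrarily; the first choice is $s$), assign it the number $n-j+1$, and append $n-j+1$ to the labels of its unvisited neighbours. The output $\sigma$ = $LexBFS(s)$ is this numbering ($\sigma(i)$ is the vertex numbered $i$; $\sigma(n)=s$ and $\sigma(1)$ is the last visited vertex). The $c$-sweep LexBFS consists of $c$ consecutive LexBFS executions, the $i$-th ($i\geq 2$) starting at the last vertex visited by the $(i-1)$-th. SETH states that for every $\varepsilon>0$ there is $k$ such that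 $k$-SAT on $n$ variables cannot be solved in ${\cal O}((2-\varepsilon)^n)$ time. *)

theory Defs
  imports Complex_Main
begin

record 'a ugraph =
  verts :: "'a set"
  edges :: "'a set set"

definition adj :: "'a ugraph \<Rightarrow> 'a \<Rightarrow> 'a \<Rightarrow> bool" where
  "adj G u v \<longleftrightarrow> {u, v} \<in> edges G"

definition simple_graph :: "'a ugraph \<Rightarrow> bool" where
  "simple_graph G \<longleftrightarrow> finite (verts G) \<and>
     edges G \<subseteq> {{u, v} | u v. u \<in> verts G \<and> v \<in> verts G \<and> u \<noteq> v}"

definition walk :: "'a ugraph \<Rightarrow> 'a list \<Rightarrow> bool" where
  "walk G xs \<longleftrightarrow> xs \<noteq> [] \<and> set xs \<subseteq> verts G \<and> successively (adj G) xs"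

definition connected_graph :: "'a ugraph \<Rightarrow> bool" where
  "connected_graph G \<longleftrightarrow> simple_graph G \<and> verts G \<noteq> {} \<and>
     (\<forall>u\<in>verts G. \<forall>v\<in>verts G. \<exists>xs. walk G xs \<and> hd xs = u \<and> last xs = v)"

definition gdist :: "'a ugraph \<Rightarrow> 'a \<Rightarrow> 'a \<Rightarrow> nat" where
  "gdist G u v = (LEAST k. \<exists>xs. walk G xs \<and> hd xs = u \<and> last xs = v \<and> length xs = Suc k)"

definition ecc :: "'a ugraph \<Rightarrow> 'a \<Rightarrow> nat" where
  "ecc G u = Max (gdist G u ` verts G)"

definition diam :: "'a ugraph \<Rightarrow> nat" where
  "diam G = Max (ecc G ` verts G)"

definition shortest_path :: "'a ugraph \<Rightarrow> 'a list \<Rightarrow> bool" where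
  "shortest_path G xs \<longleftrightarrow>
     walk G xs \<and> distinct xs \<and> length xs = Suc (gdist G (hd xs) (last xs))"

definition dominating :: "'a ugraph \<Rightarrow> 'a set \<Rightarrow> bool" where
  "dominating G D \<longleftrightarrow> D \<subseteq> verts G \<and> (\<forall>v\<in>verts G. v \<in> D \<or> (\<exists>d\<in>D. adj G v d))"

definition has_dominating_shortest_path :: "'a ugraph \<Rightarrow> bool" where
  "has_dominating_shortest_path G \<longleftrightarrow> (\<exists>xs. shortest_path G xs \<and> dominating G (set xs))"

definition has_dominating_edge :: "'a ugraph \<Rightarrow> bool" where
  "has_dominating_edge G \<longleftrightarrow> (\<exists>e\<in>edges G. dominating G e)"

definition cycle :: "'a ugraph \<Rightarrow> 'a list \<Rightarrow> bool" where
  "cycle G xs \<longleftrightarrow> walk G xs \<and> distinct xs \<and> length xs \<ge> 3 \<and> adj G (last xs) (hd xs)"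

definition has_chord :: "'a ugraph \<Rightarrow> 'a list \<Rightarrow> bool" where
  "has_chord G xs \<longleftrightarrow> (\<exists>i j. i < j \<and> j < length xs \<and> adj G (xs ! i) (xs ! j) \<and>
     j \<noteq> Suc i \<and> \<not> (i = 0 \<and> j = length xs - 1))"

definition chordal :: "'a ugraph \<Rightarrow> bool" where
  "chordal G \<longleftrightarrow> (\<forall>xs. cycle G xs \<and> length xs \<ge> 4 \<longrightarrow> has_chord G xs)"

definition clique :: "'a ugraph \<Rightarrow> 'a set \<Rightarrow> bool" where
  "clique G K \<longleftrightarrow> K \<subseteq> verts G \<and> (\<forall>u\<in>K. \<forall>v\<in>K. u \<noteq> v \<longrightarrow> adj G u v)"

definition independent :: "'a ugraph \<Rightarrow> 'a set \<Rightarrow> bool" where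
  "independent G I \<longleftrightarrow> I \<subseteq> verts G \<and> (\<forall>u\<in>I. \<forall>v\<in>I. \<not> adj G u v)"

definition split_graph :: "'a ugraph \<Rightarrow> bool" where
  "split_graph G \<longleftrightarrow>
     (\<exists>K I. K \<union> I = verts G \<and> K \<inter> I = {} \<and> clique G K \<and> independent G I)"

text \<open>
  In \<open>lexbfs_run G s xs lab\<close> the list \<open>xs\<close> holds the vertices visited so far, in order of
  visit, and \<open>lab\<close> the current labels.  The vertex visited in round \<open>j = length xs + 1\<close> gets
  the number \<open>n - j + 1 = n - length xs\<close>, where \<open>n = card (verts G)\<close>.  In \<open>lexord\<close> a proper
  prefix is smaller than its extensions.  Ties are broken arbitrarily, so this is a relation.
\<close>

inductive lexbfs_run ::
  "'a ugraph \<Rightarrow> 'a \<Rightarrow> 'a list \<Rightarrow> ('a \<Rightarrow> nat list) \<Rightarrow> bool" for G s where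
  start: "lexbfs_run G s [] (\<lambda>_. [])"
| visit: "\<lbrakk> lexbfs_run G s xs lab; v \<in> verts G - set xs; xs = [] \<Longrightarrow> v = s;
            \<forall>w\<in>verts G - set xs. (lab v, lab w) \<notin> lexord {(a, b). a < b} \<rbrakk>
   \<Longrightarrow> lexbfs_run G s (xs @ [v])
         (\<lambda>w. if w \<in> verts G - set (xs @ [v]) \<and> adj G v w
              then lab w @ [card (verts G) - length xs] else lab w)"

text \<open>
  A complete execution.  The vertex numbered \<open>i\<close> is \<open>\<sigma>(i) = xs ! (n - i)\<close>; in particular
  \<open>\<sigma>(n) = hd xs = s\<close>, and the last visited vertex is \<open>\<sigma>(1) = last xs\<close>.
\<close>

definition lexbfs :: "'a ugraph \<Rightarrow> 'a \<Rightarrow> 'a list \<Rightarrow> bool" where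
  "lexbfs G s xs \<longleftrightarrow> (\<exists>lab. lexbfs_run G s xs lab) \<and> length xs = card (verts G)"

text \<open>
  A structured form of the word RAM.  The memory consists of arrays of natural numbers; a
  program mentions only finitely many arrays (which a RAM with a single memory would interleave),
  and a scalar variable is cell \<open>0\<close> of an array.  \<open>Load a e\<close> reads the cell of array \<open>a\<close> whose
  address is the value of \<open>e\<close> (indirect addressing).  The size of an expression is fixed by the
  program, so evaluating one is charged as a single step.

  Executions are relative to a bound \<open>W\<close>, the largest number that fits into a machine word: an
  execution in which some computed value, intermediate values included, exceeds \<open>W\<close> is stuck.
\<close>

type_synonym memory = "nat \<Rightarrow> nat \<Rightarrow> nat"

datatype binop = Add | Sub | Mul | Div | Mod | Less

datatype exp = Const nat | Load nat exp | Op binop exp exp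

datatype com =
    Skip
  | Store nat exp exp
  | Seq com com
  | If exp com com
  | While exp com

fun binop_val :: "binop \<Rightarrow> nat \<Rightarrow> nat \<Rightarrow> nat" where
  "binop_val Add x y = x + y"
| "binop_val Sub x y = x - y"
| "binop_val Mul x y = x * y"
| "binop_val Div x y = x div y"
| "binop_val Mod x y = x mod y"
| "binop_val Less x y = (if x < y then 1 else 0)"

fun exp_val :: "memory \<Rightarrow> exp \<Rightarrow> nat" where
  "exp_val s (Const n) = n"
| "exp_val s (Load a e) = s a (exp_val s e)"
| "exp_val s (Op f e1 e2) = binop_val f (exp_val s e1) (exp_val s e2)"

fun exp_fits :: "nat \<Rightarrow> memory \<Rightarrow> exp \<Rightarrow> bool" where
  "exp_fits W s (Const n) \<longleftrightarrow> n \<le> W"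
| "exp_fits W s (Load a e) \<longleftrightarrow> exp_fits W s e \<and> s a (exp_val s e) \<le> W"
| "exp_fits W s (Op f e1 e2) \<longleftrightarrow>
     exp_fits W s e1 \<and> exp_fits W s e2 \<and> exp_val s (Op f e1 e2) \<le> W"

text \<open>
  \<open>exec W c s t s'\<close>: started in memory \<open>s\<close>, the program \<open>c\<close> halts after exactly \<open>t\<close> steps in
  memory \<open>s'\<close>.
\<close>

inductive exec :: "nat \<Rightarrow> com \<Rightarrow> memory \<Rightarrow> nat \<Rightarrow> memory \<Rightarrow> bool" for W where
  Skip: "exec W Skip s 1 s"
| Store: "\<lbrakk> exp_fits W s e1; exp_fits W s e2 \<rbrakk>
   \<Longrightarrow> exec W (Store a e1 e2) s 1 (s(a := (s a)(exp_val s e1 := exp_val s e2)))"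
| Seq: "\<lbrakk> exec W c1 s t1 s1; exec W c2 s1 t2 s2 \<rbrakk> \<Longrightarrow> exec W (Seq c1 c2) s (t1 + t2) s2"
| IfTrue: "\<lbrakk> exp_fits W s e; exp_val s e \<noteq> 0; exec W c1 s t s1 \<rbrakk>
   \<Longrightarrow> exec W (If e c1 c2) s (Suc t) s1"
| IfFalse: "\<lbrakk> exp_fits W s e; exp_val s e = 0; exec W c2 s t s1 \<rbrakk>
   \<Longrightarrow> exec W (If e c1 c2) s (Suc t) s1"
| WhileTrue: "\<lbrakk> exp_fits W s e; exp_val s e \<noteq> 0;
     exec W c s t1 s1; exec W (While e c) s1 t2 s2 \<rbrakk>
   \<Longrightarrow> exec W (While e c) s (Suc (t1 + t2)) s2"
| WhileFalse: "\<lbrakk> exp_fits W s e; exp_val s e = 0 \<rbrakk> \<Longrightarrow> exec W (While e c) s 1 s"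

text \<open>The input is placed at the beginning of array \<open>0\<close>; every other cell is \<open>0\<close>.\<close>

definition init_memory :: "nat list \<Rightarrow> memory" where
  "init_memory xs = (\<lambda>a i. if a = 0 \<and> i < length xs then xs ! i else 0)"

text \<open>
  Program \<open>p\<close> decides, on the instances in \<open>I\<close> (given to it through the encoding \<open>enc\<close>), the
  property \<open>P\<close> in time \<open>O(T)\<close>.  The answer is read off cell \<open>0\<close> of array \<open>0\<close>.  The words have
  a number of bits that is logarithmic in the input (its length and the numbers in it) and the
  running time: the word bound is a fixed power \<open>d\<close> of these.  The constants \<open>d\<close> and \<open>C\<close> do not
  depend on the instance, and nothing is required outside \<open>I\<close>.
\<close>

definition decides_in_time ::
  "com \<Rightarrow> 'i set \<Rightarrow> ('i \<Rightarrow> nat list) \<Rightarrow> ('i \<Rightarrow> bool) \<Rightarrow> ('i \<Rightarrow> real) \<Rightarrow> bool" where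
  "decides_in_time p I enc P T \<longleftrightarrow>
     (\<exists>(d :: nat) (C :: real). \<forall>x\<in>I. \<exists>t s.
        exec ((2 + length (enc x) + sum_list (enc x) + t) ^ d) p (init_memory (enc x)) t s \<and>
        real t \<le> C * T x \<and>
        (s 0 0 \<noteq> 0 \<longleftrightarrow> P x))"

definition enc_lists :: "nat list list \<Rightarrow> nat list" where
  "enc_lists ls = length ls # concat (map (\<lambda>l. length l # l) ls)"

text \<open>
  \<open>adj_lists G L\<close>: \<open>L\<close> is an adjacency list representation of the graph \<open>G\<close> with vertex set
  \<open>{0..<n}\<close>; the neighbours of a vertex may be listed in any order.
\<close>

definition adj_lists :: "nat ugraph \<Rightarrow> nat list list \<Rightarrow> bool" where
  "adj_lists G L \<longleftrightarrow> verts G = {0..<length L} \<and>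
     (\<forall>u<length L. distinct (L ! u) \<and> set (L ! u) = {v. adj G u v})"

definition graph_instances :: "(nat ugraph \<Rightarrow> bool) \<Rightarrow> (nat ugraph \<times> nat list list) set" where
  "graph_instances Q = {(G, L). connected_graph G \<and> adj_lists G L \<and> Q G}"

definition enc_graph :: "nat ugraph \<times> nat list list \<Rightarrow> nat list" where
  "enc_graph = (\<lambda>(G, L). enc_lists L)"

text \<open>The literal \<open>(x, True)\<close> is the variable \<open>x\<close>, and \<open>(x, False)\<close> is its negation.\<close>

type_synonym clause = "(nat \<times> bool) list"

text \<open>
  \<open>k\<close>-CNF formulas over the variables \<open>0, \<dots>, n - 1\<close>.  No clause is repeated, so for fixed \<open>k\<close>
  the size of a formula is polynomial in \<open>n\<close>, and a time bound may be expressed in \<open>n\<close> alone.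
\<close>

definition k_cnf :: "nat \<Rightarrow> nat \<Rightarrow> clause list \<Rightarrow> bool" where
  "k_cnf k n F \<longleftrightarrow> distinct F \<and>
     (\<forall>c\<in>set F. length c \<le> k \<and> (\<forall>(x, b)\<in>set c. x < n))"

definition satisfiable :: "clause list \<Rightarrow> bool" where
  "satisfiable F \<longleftrightarrow> (\<exists>\<alpha> :: nat \<Rightarrow> bool. \<forall>c\<in>set F. \<exists>(x, b)\<in>set c. \<alpha> x = b)"

definition enc_cnf :: "nat \<times> clause list \<Rightarrow> nat list" where
  "enc_cnf = (\<lambda>(n, F). n # enc_lists (map (map (\<lambda>(x, b). 2 * x + of_bool b)) F))"

definition SETH :: bool where
  "SETH \<longleftrightarrow> (\<forall>\<epsilon>::real. \<epsilon> > 0 \<longrightarrow> (\<exists>k. \<not> (\<exists>p.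
     decides_in_time p {(n, F). k_cnf k n F} enc_cnf
       (\<lambda>(n, F). satisfiable F) (\<lambda>(n, F). (2 - \<epsilon>) ^ n))))"

end

theory Submission
  imports Defs
begin

text \<open>
  Order the vertices by LexBFS and consider the balls of radius \<open>k\<close> around the vertices. In any
  breadth-first order, an earlier centre gives a ball whose earliest vertex is earlier; in a chordal
  graph, two vertices joined by a walk through later vertices only are adjacent. Hence, if the balls
  of radius \<open>k\<close> around \<open>x\<close> and \<open>y\<close> both touch the one around the last vertex \<open>v\<close>, then they touch
  each other: \<open>v\<close> is simplicial in all odd powers of the graph. So \<open>e(v) = diam\<close> or \<open>e(v)\<close> is even and
  \<open>diam = e(v) + 1\<close>. If \<open>e(v) = 2k \<ge> 4\<close> and \<open>diam = 2k + 1\<close>, attained by \<open>x\<close> and \<open>y\<close>, then \<open>u\<close>, \<open>v\<close>, \<open>x\<close>, \<open>y\<close> are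
  pairwise at distance at least \<open>2k\<close>, and a dominating shortest path is too short to dominate all
  four. It also follows that the diameter of a chordal graph is at least 4 if and only if the
  eccentricity of the last vertex of a single LexBFS is.

  For the lower bound, the clauses of a CNF formula together with two hubs form a clique, the
  partial assignments to either half of the variables are independent, and an assignment is
  adjacent to the clauses that it does not satisfy and to the hub of its half. Two assignments to
  different halves are at distance 3 if and only if together they satisfy the formula.
\<close>


section \<open>Balls and LexBFS orders of chordal graphs\<close>

text \<open>Parity decides where the argument works: the balls of radius k around two vertices
  touch, in a common vertex or along an edge, exactly when their distance is at most 2k + 1. Even
  distances have no such description, and this is the case in which e(v) can miss the diameter by
  one. There the second sweep enters: u and v are both last in a LexBFS order, and v is moreover
  farthest from u. The feet of the four vertices on the dominating path are pairwise 2k - 2 apart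
  among at most 2k + 2 places, so 3(2k - 2) <= 2k + 1; this fails from k = 2 on and explains why
  e(v) = 2 is excluded. In the reduction every edge has an end among polynomially many vertices, so
  m is 2^(n/2) up to a polynomial in n, and m^(2 - e) falls exponentially below 2^n. An arbitrary
  program for the graph problem must run after the construction: it has to find its arrays fresh,
  and its word bound, stated for an exponentially large graph, must be polynomial in the formula and
  the total time. This is why stored numbers are made to grow by at most a constant per
  step.\<close>

lemma adj_sym: "adj G u v \<longleftrightarrow> adj G v u"
  by (simp add: adj_def insert_commute)

lemma adj_verts:
  assumes "simple_graph G" "adj G u v"
  shows "u \<in> verts G" "v \<in> verts G" "u \<noteq> v"
  using assms by (auto simp: simple_graph_def adj_def doubleton_eq_iff)

section \<open>Balls, walks and distances\<close>

primrec nball :: "'a ugraph \<Rightarrow> nat \<Rightarrow> 'a \<Rightarrow> 'a set" where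
  "nball G 0 u = {u}"
| "nball G (Suc k) u = nball G k u \<union> {w. \<exists>z\<in>nball G k u. adj G z w}"

lemma nball_self [simp]: "u \<in> nball G k u"
  by (induction k) auto

lemma nball_1: "w \<in> nball G (Suc 0) u \<longleftrightarrow> w = u \<or> adj G u w"
  by auto

lemma nball_verts: "simple_graph G \<Longrightarrow> u \<in> verts G \<Longrightarrow> nball G k u \<subseteq> verts G"
  by (induction k) (auto dest: adj_verts)

lemma nball_mono: "j \<le> k \<Longrightarrow> nball G j u \<subseteq> nball G k u"
  by (rule lift_Suc_mono_le[of "\<lambda>k. nball G k u"]) auto

lemma nball_trans: "w \<in> nball G j u \<Longrightarrow> x \<in> nball G k w \<Longrightarrow> x \<in> nball G (j + k) u"
  by (induction k arbitrary: x) auto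

lemma nball_sym: "w \<in> nball G k u \<Longrightarrow> u \<in> nball G k w"
proof (induction k arbitrary: w)
  case (Suc k)
  show ?case
  proof (cases "w \<in> nball G k u")
    case True
    then show ?thesis using Suc.IH by auto
  next
    case False
    then obtain z where "z \<in> nball G k u" "adj G z w" using Suc.prems by auto
    then have "u \<in> nball G k z" "z \<in> nball G 1 w" using Suc.IH adj_sym[of G] by auto
    then show ?thesis using nball_trans by fastforce
  qed
qed simp

lemma nball_split: "w \<in> nball G (j + k) u \<Longrightarrow> \<exists>z\<in>nball G j u. w \<in> nball G k z"
proof (induction k arbitrary: w)
  case (Suc k)
  show ?case
  proof (cases "w \<in> nball G (j + k) u")
    case True
    then show ?thesis using Suc.IH by auto
  next
    case False
    then obtain z where "z \<in> nball G (j + k) u" "adj G z w" using Suc.prems by auto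
    then show ?thesis using Suc.IH[of z] by auto
  qed
qed simp

lemma walk_Cons: "walk G (x # xs) \<longleftrightarrow> x \<in> verts G \<and> (xs = [] \<or> adj G x (hd xs) \<and> walk G xs)"
  by (cases xs) (auto simp: walk_def)

lemma walk_append:
  "xs \<noteq> [] \<Longrightarrow> ys \<noteq> [] \<Longrightarrow> walk G (xs @ ys) \<longleftrightarrow> walk G xs \<and> walk G ys \<and> adj G (last xs) (hd ys)"
  by (auto simp: walk_def successively_append_iff)

lemma walk_rev: "walk G (rev xs) \<longleftrightarrow> walk G xs"
proof -
  have "successively (\<lambda>x y. adj G y x) xs = successively (adj G) xs"
    by (rule arg_cong[where f = "\<lambda>R. successively R xs"]) (intro ext adj_sym)
  then show ?thesis by (simp add: walk_def)
qed

lemma walk_adj_nth: "walk G xs \<Longrightarrow> Suc i < length xs \<Longrightarrow> adj G (xs ! i) (xs ! Suc i)"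
  by (simp add: walk_def successively_conv_nth)

lemma walk_nball:
  assumes "walk G xs" "length xs \<le> Suc k"
  shows "last xs \<in> nball G k (hd xs)"
  using assms
proof (induction xs arbitrary: k)
  case (Cons x xs)
  show ?case
  proof (cases "xs = []")
    case False
    then obtain j where j: "k = Suc j" "length xs \<le> Suc j" using Cons.prems by (cases k) auto
    have "last xs \<in> nball G j (hd xs)" "adj G x (hd xs)"
      using Cons.IH[of j] j Cons.prems False by (auto simp: walk_Cons)
    then have "last xs \<in> nball G (1 + j) x" by (intro nball_trans[of "hd xs"]) auto
    then show ?thesis using j False by simp
  qed simp
qed (simp add: walk_def)

lemma nball_walk:
  assumes "simple_graph G" "u \<in> verts G" "w \<in> nball G k u"
  shows "\<exists>xs. walk G xs \<and> hd xs = u \<and> last xs = w \<and> length xs \<le> Suc k \<and> set xs \<subseteq> nball G k u"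
  using assms(3)
proof (induction k arbitrary: w)
  case 0
  then show ?case using assms(2) by (intro exI[of _ "[u]"]) (auto simp: walk_Cons)
next
  case (Suc k)
  show ?case
  proof (cases "w \<in> nball G k u")
    case True
    then show ?thesis using Suc.IH[of w] by (force intro: le_SucI)
  next
    case False
    then obtain z where z: "z \<in> nball G k u" "adj G z w" using Suc.prems by auto
    then obtain xs where xs: "walk G xs" "hd xs = u" "last xs = z" "length xs \<le> Suc k"
      "set xs \<subseteq> nball G k u" using Suc.IH by blast
    have "xs \<noteq> []" using xs by (auto simp: walk_def)
    then show ?thesis using xs z assms Suc.prems
      by (intro exI[of _ "xs @ [w]"]) (auto simp: walk_append walk_Cons dest: adj_verts)
  qed
qed

text \<open>Trades the least walk length for membership in a ball, where induction on the radius
  applies. Connectedness makes the set under \<open>LEAST\<close> nonempty.\<close>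

lemma gdist_le_iff:
  assumes G: "connected_graph G" and uv: "u \<in> verts G" "v \<in> verts G"
  shows "gdist G u v \<le> k \<longleftrightarrow> v \<in> nball G k u"
proof -
  have sg: "simple_graph G" using G by (simp add: connected_graph_def)
  let ?P = "\<lambda>k. \<exists>xs. walk G xs \<and> hd xs = u \<and> last xs = v \<and> length xs = Suc k"
  obtain xs where xs: "walk G xs" "hd xs = u" "last xs = v"
    using G uv by (auto simp: connected_graph_def)
  have "?P (length xs - 1)" using xs by (intro exI[of _ xs]) (cases xs; simp add: walk_def)
  then have P: "?P (gdist G u v)" unfolding gdist_def by (rule LeastI)
  show ?thesis
  proof
    assume "gdist G u v \<le> k"
    then show "v \<in> nball G k u" using P walk_nball[of G _ k] by force
  next
    assume "v \<in> nball G k u"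
    then obtain ys where ys: "walk G ys" "hd ys = u" "last ys = v" "length ys \<le> Suc k"
      using nball_walk[OF sg uv(1)] by blast
    then have "?P (length ys - 1)" by (intro exI[of _ ys]) (cases ys; simp add: walk_def)
    then have "gdist G u v \<le> length ys - 1" unfolding gdist_def by (rule Least_le)
    then show "gdist G u v \<le> k" using ys by simp
  qed
qed

lemma ecc_le_iff:
  assumes G: "connected_graph G" and u: "u \<in> verts G"
  shows "ecc G u \<le> k \<longleftrightarrow> verts G \<subseteq> nball G k u"
proof -
  have "finite (verts G)" "verts G \<noteq> {}" using G by (auto simp: connected_graph_def simple_graph_def)
  then show ?thesis using gdist_le_iff[OF G u] by (auto simp: ecc_def)
qed

lemma diam_le_iff:
  assumes G: "connected_graph G"
  shows "diam G \<le> k \<longleftrightarrow> (\<forall>u\<in>verts G. verts G \<subseteq> nball G k u)"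
proof -
  have "finite (verts G)" "verts G \<noteq> {}" using G by (auto simp: connected_graph_def simple_graph_def)
  then show ?thesis using ecc_le_iff[OF G] by (auto simp: diam_def)
qed

text \<open>The four-point property of LexBFS orders. A small rank means an early visit, opposite to
  the numbering sigma. As a property of a rank function it can be provided both by an execution
  \<open>lexbfs\<close> and by the arrays of a program.\<close>

definition lex_rank :: "'a ugraph \<Rightarrow> ('a \<Rightarrow> nat) \<Rightarrow> bool" where
  "lex_rank G r \<longleftrightarrow> inj_on r (verts G) \<and>
     (\<forall>a\<in>verts G. \<forall>b\<in>verts G. \<forall>c\<in>verts G.
        r c < r b \<longrightarrow> r b < r a \<longrightarrow> adj G c a \<longrightarrow> \<not> adj G c b \<longrightarrow>
        (\<exists>d\<in>verts G. r d < r c \<and> adj G d b \<and> \<not> adj G d a))"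

lemma lex_rankD:
  assumes "lex_rank G r" "a \<in> verts G" "b \<in> verts G" "c \<in> verts G"
    "r c < r b" "r b < r a" "adj G c a" "\<not> adj G c b"
  obtains d where "d \<in> verts G" "r d < r c" "adj G d b" "\<not> adj G d a"
  using assms unfolding lex_rank_def by blast

lemma lex_rank_nball:
  assumes G: "simple_graph G" and r: "lex_rank G r" and x: "x \<in> verts G" and v: "v \<in> verts G"
    and le: "r x \<le> r v" and w: "w \<in> nball G k v"
  shows "\<exists>w'\<in>nball G k x. r w' \<le> r w"
  using w
proof (induction k arbitrary: w)
  case 0
  then show ?case using le by auto
next
  case (Suc k)
  show ?case
  proof (cases "w \<in> nball G k v")
    case True
    then show ?thesis using Suc.IH by force
  next
    case False
    then obtain z where z: "z \<in> nball G k v" "adj G z w" using Suc.prems by auto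
    then obtain z' where z': "z' \<in> nball G k x" "r z' \<le> r z" using Suc.IH by blast
    have V: "z \<in> verts G" "w \<in> verts G" "z' \<in> verts G"
      using adj_verts[OF G z(2)] nball_verts[OF G x] z' by auto
    show ?thesis
    proof (cases "r z' \<le> r w \<or> adj G z' w")
      case True
      then show ?thesis using z' by (auto intro: bexI[of _ w] bexI[of _ z'])
    next
      case F: False
      have "r z' \<noteq> r z" using F r V z by (auto simp: lex_rank_def inj_on_def)
      \<comment> \<open>Now \<open>w\<close> precedes \<open>z'\<close> and \<open>z'\<close>
        precedes \<open>z\<close>, while \<open>w\<close> sees \<open>z\<close> but not
        \<open>z'\<close>: the four-point property gives \<open>z'\<close> a neighbour earlier than
        \<open>w\<close>.\<close>
      then obtain d where "d \<in> verts G" "r d < r w" "adj G d z'"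
        using lex_rankD[OF r V(1) V(3) V(2)] F z z' adj_sym[of G] by (metis linorder_not_le order_le_less)
      then have "adj G z' d" "r d \<le> r w" using adj_sym[of G] by auto
      then show ?thesis using z' by (intro bexI[of _ d]) auto
    qed
  qed
qed

text \<open>Closing the induced path through \<open>d\<close> gives a cycle of length at least four,
  and a chord of it must end in \<open>d\<close>.\<close>

lemma cycle_chord_of_path:
  assumes G: "simple_graph G" and ch: "chordal G" and xs: "walk G xs" "distinct xs" "3 \<le> length xs"
    and d: "d \<notin> set xs" "adj G d (hd xs)" "adj G d (last xs)"
    and ind: "\<And>i j. i < j \<Longrightarrow> j < length xs \<Longrightarrow> adj G (xs ! i) (xs ! j) \<Longrightarrow> j = Suc i"
  shows "\<exists>i. 0 < i \<and> i < length xs - 1 \<and> adj G d (xs ! i)"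
proof -
  have ne: "xs \<noteq> []" using xs by auto
  have "cycle G (d # xs)"
    using xs d ne adj_verts[OF G d(2)] adj_sym[of G] by (auto simp: cycle_def walk_Cons)
  then have "has_chord G (d # xs)" using ch xs by (auto simp: chordal_def)
  then obtain i j where ij: "i < j" "j < Suc (length xs)" "adj G ((d # xs) ! i) ((d # xs) ! j)"
    "j \<noteq> Suc i" "\<not> (i = 0 \<and> j = length xs)" by (auto simp: has_chord_def)
  show ?thesis
  proof (cases i)
    case 0
    then show ?thesis using ij by (intro exI[of _ "j - 1"]) auto
  next
    case (Suc i')
    then obtain j' where "j = Suc j'" using ij by (cases j) auto
    then show ?thesis using Suc ij ind[of i' j'] by auto
  qed
qed

lemma walk_take: "walk G xs \<Longrightarrow> 0 < n \<Longrightarrow> walk G (take n xs)"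
  by (cases "n < length xs")
     (metis append_take_drop_id drop_eq_Nil linorder_not_le take_eq_Nil walk_append walk_def less_numeral_extra(3), simp)

lemma walk_drop: "walk G xs \<Longrightarrow> n < length xs \<Longrightarrow> walk G (drop n xs)"
  by (cases "n = 0")
     (simp, metis append_take_drop_id drop_eq_Nil linorder_not_le take_eq_Nil walk_append walk_def)

lemma hd_take_pos: "0 < n \<Longrightarrow> hd (take n xs) = hd xs"
  by (cases xs; cases n) auto

text \<open>
  A walk of minimal length between the two ends is an induced path; the four-point property of
  the order yields an earlier vertex \<open>d\<close> adjacent to the later end, and shortcutting towards \<open>d\<close>
  gives a counterexample whose later end is earlier.
\<close>

lemma lex_rank_peo:
  assumes G: "simple_graph G" and ch: "chordal G" and r: "lex_rank G r"
  shows "walk G xs \<Longrightarrow> (\<And>i. 0 < i \<Longrightarrow> i < length xs - 1 \<Longrightarrow> r (hd xs) < r (xs ! i) \<and> r (last xs) < r (xs ! i))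
     \<Longrightarrow> hd xs = last xs \<or> adj G (hd xs) (last xs)"
proof (induction "max (r (hd xs)) (r (last xs))" arbitrary: xs rule: less_induct)
  case less
  define later where "later p q z \<longleftrightarrow> r p < r z \<and> r q < r z" for p q z
  define W where "W ys p q \<longleftrightarrow> walk G ys \<and> hd ys = p \<and> last ys = q \<and>
     (\<forall>z\<in>set ys. z = p \<or> z = q \<or> later p q z)" for ys p q
  have W0: "W xs (hd xs) (last xs)"
    unfolding W_def
  proof (intro conjI ballI refl less.prems(1))
    fix z assume "z \<in> set xs"
    then obtain i where i: "i < length xs" "xs ! i = z" by (auto simp: in_set_conv_nth)
    then have ne: "xs \<noteq> []" by auto
    show "z = hd xs \<or> z = last xs \<or> later (hd xs) (last xs) z"
      using less.prems(2)[of i] i ne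
      by (cases "i = 0"; cases "i = length xs - 1") (auto simp: hd_conv_nth last_conv_nth later_def)
  qed
  have main: False
    if pq: "r p < r q" "\<not> adj G p q" and P: "W ys p q" "{p, q} = {hd xs, last xs}" for p q ys
  proof -
    define ws where "ws = (ARG_MIN length zs. W zs p q)"
    have ws: "W ws p q" and wmin: "\<And>zs. W zs p q \<Longrightarrow> length ws \<le> length zs"
      using arg_min_natI[of "\<lambda>zs. W zs p q" ys length] arg_min_nat_le[of "\<lambda>zs. W zs p q" _ length] P(1)
      by (auto simp: ws_def)
    have ww: "walk G ws" and hl: "hd ws = p" "last ws = q" and
      lat: "\<And>z. z \<in> set ws \<Longrightarrow> z = p \<or> z = q \<or> later p q z" using ws by (auto simp: W_def)
    have ne: "ws \<noteq> []" using ww by (auto simp: walk_def)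
    have nthe: "ws ! 0 = p" "ws ! (length ws - 1) = q" using hl ne by (auto simp: hd_conv_nth last_conv_nth)
    have Vw: "set ws \<subseteq> verts G" using ww by (auto simp: walk_def)
    have neq: "p \<noteq> q" using pq by auto
    \<comment> \<open>Minimality of \<open>ws\<close> is used through this cut: removing a segment
      keeps the ends and the admissible vertices. It excludes chords, and repetitions that do not
      involve the first vertex.\<close>
    have short: False if ij: "i < j" "j < length ws" "0 < i' " "i' \<le> j" "i' < j"
       "adj G (ws ! (i' - 1)) (ws ! j)" for i j i'
    proof -
      let ?z = "take i' ws @ drop j ws"
      have t: "walk G (take i' ws)" "walk G (drop j ws)" using ww ij walk_take walk_drop by auto
      have "last (take i' ws) = ws ! (i' - 1)" using ij ne by (subst last_conv_nth) auto
      moreover have "hd (drop j ws) = ws ! j" using ij by (simp add: hd_drop_conv_nth)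
      ultimately have "walk G ?z" using t ij ne by (subst walk_append) auto
      moreover have "hd ?z = p" "last ?z = q" using ij ne hl by (auto simp: hd_take_pos)
      moreover have "set ?z \<subseteq> set ws" using set_take_subset[of i' ws] set_drop_subset[of j ws] by auto
      ultimately have "W ?z p q" using lat by (auto simp: W_def)
      then show False using wmin[of ?z] ij by auto
    qed
    have ind: "j = Suc i" if "i < j" "j < length ws" "adj G (ws ! i) (ws ! j)" for i j
      using short[of i j "Suc i"] that by (cases "j = Suc i") auto
    have dist: "distinct ws"
    proof (rule ccontr)
      assume "\<not> distinct ws"
      then obtain i j where ij: "i < j" "j < length ws" "ws ! i = ws ! j"
        by (metis distinct_conv_nth linorder_neqE_nat)
      show False
      proof (cases "i = 0")
        case True
        have "W (drop j ws) p q"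
          using walk_drop[OF ww ij(2)] hl ij True nthe lat set_drop_subset[of j ws]
          by (auto simp: W_def hd_drop_conv_nth)
        then show False using wmin[of "drop j ws"] ij by auto
      next
        case False
        have "adj G (ws ! (i - 1)) (ws ! j)" using walk_adj_nth[OF ww, of "i - 1"] ij False by simp
        then show False using short[of i j i] ij False by auto
      qed
    qed
    have len: "3 \<le> length ws"
    proof (rule ccontr)
      assume "\<not> 3 \<le> length ws"
      moreover have "length ws \<noteq> 0" using ne by simp
      ultimately have "length ws = 1 \<or> length ws = 2" by linarith
      then show False using nthe neq pq walk_adj_nth[OF ww, of 0] by auto
    qed
    have inter: "later p q (ws ! i)" if "0 < i" "i < length ws - 1" for i
    proof -
      have "i < length ws" using that by linarith
      then have "ws ! i \<noteq> ws ! 0" "ws ! i \<noteq> ws ! (length ws - 1)"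
        using that len ne nth_eq_iff_index_eq[OF dist, of i 0] nth_eq_iff_index_eq[OF dist, of i "length ws - 1"]
        by auto
      then show ?thesis using lat[of "ws ! i"] that nthe by auto
    qed
    have a1: "adj G p (ws ! 1)" using walk_adj_nth[OF ww, of 0] len nthe by simp
    have l1: "later p q (ws ! 1)" using inter[of 1] len by auto
    have "ws ! 1 \<in> set ws" "p \<in> set ws" "q \<in> set ws" using len nthe ne hl by (auto simp: hd_in_set last_in_set)
    \<comment> \<open>The four-point property for \<open>p\<close>, \<open>q\<close>,
      \<open>ws ! 1\<close>, in increasing order of rank: \<open>p\<close> sees
      \<open>ws ! 1\<close> but not \<open>q\<close>.\<close>
    then obtain d where d: "d \<in> verts G" "r d < r p" "adj G d q" "\<not> adj G d (ws ! 1)"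
      using lex_rankD[OF r, of "ws ! 1" q p] pq a1 l1 Vw by (auto simp: later_def)
    \<comment> \<open>The first neighbour of \<open>d\<close> on the path after \<open>p\<close>.
      Index 1 is ruled out by the choice of \<open>d\<close>, and the last vertex \<open>q\<close>
      qualifies.\<close>
    define Q where "Q j \<longleftrightarrow> 2 \<le> j \<and> j < length ws \<and> adj G d (ws ! j)" for j
    have "Q (length ws - 1)" using d nthe len by (auto simp: Q_def)
    then have Qj: "Q (LEAST j. Q j)" and Qm: "\<And>i. i < (LEAST j. Q j) \<Longrightarrow> \<not> Q i"
      by (auto intro: LeastI dest: not_less_Least)
    define j where "j = (LEAST j. Q j)"
    have j: "2 \<le> j" "j < length ws" "adj G d (ws ! j)" using Qj by (auto simp: Q_def j_def)
    have jm: "\<not> adj G d (ws ! i)" if "0 < i" "i < j" for i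
    proof (cases "i = 1")
      case False
      have "\<not> Q i" using Qm[of i] that by (simp add: j_def)
      then show ?thesis using that j False by (simp add: Q_def)
    qed (use d in simp)
    let ?t = "take (Suc j) ws"
    have tl: "last ?t = ws ! j" "hd ?t = p" "length ?t = Suc j" "?t \<noteq> []" "walk G ?t"
      using j ne hl ww by (auto simp: last_conv_nth hd_take_pos intro: walk_take)
    have after: "r p < r (ws ! i)" if "0 < i" "i < length ws" for i
      using inter[of i] that pq nthe by (cases "i = length ws - 1") (auto simp: later_def)
    \<comment> \<open>The inner vertices are later than \<open>p\<close>, hence than
      \<open>d\<close>, and the larger rank of the two ends drops from that of \<open>q\<close> to
      that of \<open>p\<close>. So the induction hypothesis makes \<open>d\<close> adjacent to
      \<open>p\<close>, which closes a cycle without a chord at \<open>d\<close>.\<close>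
    let ?y = "?t @ [d]"
    have wy: "walk G ?y" using tl j d adj_sym[of G] by (auto simp: walk_append walk_Cons)
    have hy: "hd ?y = p" "last ?y = d" using tl by auto
    have "hd ?y = last ?y \<or> adj G (hd ?y) (last ?y)"
    proof (rule less.hyps)
      have "max (r (hd xs)) (r (last xs)) = max (r p) (r q)" using P(2) by (auto simp: doubleton_eq_iff)
      then show "max (r (hd ?y)) (r (last ?y)) < max (r (hd xs)) (r (last xs))"
        using hy d pq by auto
      fix i assume i: "0 < i" "i < length ?y - 1"
      then have "?y ! i = ws ! i" "i < length ws" using j by (auto simp: nth_append)
      then show "r (hd ?y) < r (?y ! i) \<and> r (last ?y) < r (?y ! i)" using hy after[of i] i d by auto
    qed (rule wy)
    then have dp: "adj G d p" using hy d adj_sym[of G] by auto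
    have "d \<notin> set ?t"
    proof
      assume "d \<in> set ?t"
      then obtain i where "i < length ws" "d = ws ! i" by (auto simp: in_set_conv_nth)
      then show False using after[of i] d nthe by (cases "i = 0") auto
    qed
    then have "\<exists>i. 0 < i \<and> i < length ?t - 1 \<and> adj G d (?t ! i)"
      using tl j dp dist ind by (intro cycle_chord_of_path[OF G ch]) auto
    then show False using jm tl by auto
  qed
  show ?case
  proof (rule ccontr)
    assume neg: "\<not> (hd xs = last xs \<or> adj G (hd xs) (last xs))"
    have V: "hd xs \<in> verts G" "last xs \<in> verts G" using less.prems(1) by (auto simp: walk_def)
    then have "r (hd xs) \<noteq> r (last xs)" using r neg by (auto simp: lex_rank_def inj_on_def)
    moreover have "W (rev xs) (last xs) (hd xs)"
      using W0 by (auto simp: W_def walk_rev hd_rev last_rev later_def)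
    ultimately show False
      using main[of "hd xs" "last xs" xs] main[of "last xs" "hd xs" "rev xs"] W0 neg adj_sym[of G]
      by (metis insert_commute linorder_neqE_nat)
  qed
qed


section \<open>Odd powers of a chordal graph\<close>

definition joined :: "'a ugraph \<Rightarrow> 'a set \<Rightarrow> 'a \<Rightarrow> 'a \<Rightarrow> bool" where
  "joined G S a b \<longleftrightarrow> (\<exists>xs. walk G xs \<and> hd xs = a \<and> last xs = b \<and> set xs \<subseteq> S)"

lemma joined_sym: "joined G S a b \<Longrightarrow> joined G S b a"
  unfolding joined_def
proof (elim exE conjE)
  fix xs assume "walk G xs" "hd xs = a" "last xs = b" "set xs \<subseteq> S"
  then show "\<exists>xs. walk G xs \<and> hd xs = b \<and> last xs = a \<and> set xs \<subseteq> S"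
    by (intro exI[of _ "rev xs"]) (simp add: walk_rev hd_rev last_rev)
qed

lemma joined_mono: "joined G S a b \<Longrightarrow> S \<subseteq> T \<Longrightarrow> joined G T a b"
  unfolding joined_def by blast

lemma joined_trans:
  assumes "joined G S a b" "joined G S b c"
  shows "joined G S a c"
proof -
  obtain xs ys where xs: "walk G xs" "hd xs = a" "last xs = b" "set xs \<subseteq> S"
    and ys: "walk G ys" "hd ys = b" "last ys = c" "set ys \<subseteq> S"
    using assms by (auto simp: joined_def)
  show ?thesis
  proof (cases "tl ys = []")
    case True
    then have "b = c" using ys by (cases ys) (auto simp: walk_def)
    then show ?thesis using xs by (auto simp: joined_def)
  next
    case False
    then obtain zs where zs: "ys = b # zs" "zs \<noteq> []" using ys by (cases ys) auto
    have "xs \<noteq> []" using xs by (auto simp: walk_def)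
    then have "walk G (xs @ zs)" using xs ys zs by (auto simp: walk_append walk_Cons)
    then show ?thesis using xs ys zs \<open>xs \<noteq> []\<close>
      by (auto simp: joined_def intro!: exI[of _ "xs @ zs"])
  qed
qed

lemma joined_nball:
  assumes "simple_graph G" "u \<in> verts G" "a \<in> nball G k u" "b \<in> nball G k u"
  shows "joined G (nball G k u) a b"
proof -
  have "joined G (nball G k u) u z" if "z \<in> nball G k u" for z
    using nball_walk[OF assms(1,2) that] unfolding joined_def by blast
  from this[OF assms(3)] this[OF assms(4)] show ?thesis by (rule joined_trans[OF joined_sym])
qed

text \<open>A connection of length 2k + 1 consists of two parts of length k and a middle edge; this
  is where the odd radii come from.\<close>

lemma joined_nball_nball:
  assumes G: "simple_graph G" and u: "u \<in> verts G" and v: "v \<in> verts G"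
    and uv: "v \<in> nball G (2 * k + 1) u"
  shows "joined G (nball G k u \<union> nball G k v) u v"
proof -
  have "v \<in> nball G (k + 1 + k) u" using uv by (simp add: mult_2)
  then obtain b where b: "b \<in> nball G (k + 1) u" "v \<in> nball G k b" using nball_split by metis
  obtain a where a: "a \<in> nball G k u" "b \<in> nball G 1 a" using nball_split[OF b(1)] by auto
  have bv: "b \<in> nball G k v" using b nball_sym[of v G k b] by auto
  have "joined G (nball G k u \<union> nball G k v) a b"
  proof (cases "a = b")
    case True
    have "b \<in> verts G" using bv nball_verts[OF G v] by auto
    then show ?thesis using True bv by (auto simp: joined_def walk_Cons intro!: exI[of _ "[a]"])
  next
    case False
    then have "adj G a b" using a by auto
    then show ?thesis using a bv adj_verts[OF G, of a b]
      by (auto simp: joined_def walk_Cons intro!: exI[of _ "[a, b]"])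
  qed
  moreover have "joined G (nball G k u) u a" "joined G (nball G k v) b v"
    using joined_nball[OF G u] joined_nball[OF G v] a bv by auto
  ultimately show ?thesis by (meson joined_mono joined_trans sup_ge1 sup_ge2)
qed

declare nball.simps(2) [simp del]

text \<open>Let \<open>b z\<close> be the earliest vertex of the ball around \<open>z\<close>, and
  let \<open>b x\<close> be no later than \<open>b y\<close>. On a walk from \<open>b x\<close> to
  \<open>b y\<close> through the three balls, take the last vertex \<open>p\<close> in the ball of
  \<open>x\<close> that is no later than \<open>b y\<close>. Nothing after it is earlier than
  \<open>b y\<close>, so \<open>p\<close> and \<open>b y\<close> coincide or are adjacent by
  \<open>lex_rank_peo\<close>, and \<open>y\<close> is within k + 1 + k of \<open>x\<close>.\<close>

lemma lex_rank_odd_ball: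
  assumes G: "simple_graph G" and ch: "chordal G" and r: "lex_rank G r"
    and V: "v \<in> verts G" "x \<in> verts G" "y \<in> verts G"
    and last: "\<forall>z\<in>verts G. r z \<le> r v"
    and x: "x \<in> nball G (2 * k + 1) v" and y: "y \<in> nball G (2 * k + 1) v"
  shows "y \<in> nball G (2 * k + 1) x"
proof -
  define b where "b z = (ARG_MIN r w. w \<in> nball G k z)" for z
  have b: "b z \<in> nball G k z" "\<And>w. w \<in> nball G k z \<Longrightarrow> r (b z) \<le> r w" for z
    using arg_min_natI[of "\<lambda>w. w \<in> nball G k z" z r] arg_min_nat_le[of "\<lambda>w. w \<in> nball G k z" _ r]
    by (auto simp: b_def)
  have early: "r (b z) \<le> r w" if "z \<in> verts G" "w \<in> nball G k v" for z w
    using lex_rank_nball[OF G r that(1) V(1) bspec[OF last that(1)] that(2)] b(2) by (meson le_trans)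
  have inj: "inj_on r (verts G)" using r by (simp add: lex_rank_def)
  have main: "y \<in> nball G (2 * k + 1) x"
    if V': "x \<in> verts G" "y \<in> verts G" and x: "x \<in> nball G (2 * k + 1) v"
      and y: "y \<in> nball G (2 * k + 1) v" and le: "r (b x) \<le> r (b y)" for x y
  proof -
    let ?S = "nball G k x \<union> nball G k v \<union> nball G k y"
    have "joined G (nball G k v \<union> nball G k x) v x" "joined G (nball G k v \<union> nball G k y) v y"
      using joined_nball_nball[OF G V(1)] x y V' by auto
    then have "joined G ?S x v" "joined G ?S v y"
      by (auto intro: joined_mono dest: joined_sym)
    moreover have "joined G ?S (b x) x" "joined G ?S y (b y)"
      using joined_nball[OF G V'(1) b(1), of x] joined_nball[OF G V'(2) _ b(1), of y]
      by (auto intro: joined_mono)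
    ultimately have "joined G ?S (b x) (b y)" by (meson joined_trans)
    then obtain zs where zs: "walk G zs" "hd zs = b x" "last zs = b y" "set zs \<subseteq> ?S"
      by (auto simp: joined_def)
    have Vz: "set zs \<subseteq> verts G" "zs \<noteq> []" using zs by (auto simp: walk_def)
    let ?P = "\<lambda>z. z \<in> nball G k x \<and> r z \<le> r (b y)"
    have "\<exists>z\<in>set zs. ?P z" using zs(2) Vz(2) b(1)[of x] le by (metis hd_in_set)
    then obtain A p B where AB: "zs = A @ p # B" "?P p" "\<forall>z\<in>set B. \<not> ?P z"
      using split_list_last_prop[of zs ?P] by blast
    \<comment> \<open>In the ball of \<open>v\<close> by \<open>early\<close>, in the ball of
      \<open>y\<close> by minimality of \<open>b y\<close>, and in the ball of \<open>x\<close> by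
      the choice of \<open>p\<close>.\<close>
    have later: "r (b y) \<le> r z" if "z \<in> set B" for z
      using that AB zs(4) early[OF V'(2)] b(2)[of z y] by force
    have "p = b y \<or> adj G p (b y)"
    proof (cases "p = b y")
      case False
      then have "b y \<in> set B" using AB zs by (metis last.simps last_appendR last_in_set list.discI)
      then obtain B1 B2 where B: "B = B1 @ b y # B2" "b y \<notin> set B1" by (metis split_list_first)
      let ?w = "p # B1 @ [b y]"
      have "walk G (p # B)" using zs AB by (cases "A = []") (auto simp: walk_append)
      then have w: "walk G ?w" using walk_take[of G "p # B" "length ?w"] B by simp
      have rp: "r p < r (b y)"
      proof -
        have "p \<in> verts G" "b y \<in> verts G" using AB(1) Vz \<open>b y \<in> set B\<close> by auto
        then have "r p \<noteq> r (b y)" using False inj by (metis inj_onD)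
        then show ?thesis using AB(2) by simp
      qed
      have "r (b y) < r z" if "z \<in> set B1" for z
      proof -
        have "z \<in> verts G" "b y \<in> verts G" "z \<noteq> b y" using AB(1) B Vz that by auto
        then have "r z \<noteq> r (b y)" using inj by (metis inj_onD)
        moreover have "r (b y) \<le> r z" using that B by (intro later) simp
        ultimately show ?thesis by simp
      qed
      then have "r (b y) < r (?w ! i)" if "0 < i" "i < length ?w - 1" for i
        using that by (cases i) (simp_all add: nth_append)
      then have "hd ?w = last ?w \<or> adj G (hd ?w) (last ?w)"
        using rp by (intro lex_rank_peo[OF G ch r w]) (simp, meson less_trans)
      then show ?thesis by simp
    qed simp
    then have "b y \<in> nball G 1 p" by (metis nball_1 One_nat_def)
    then have "b y \<in> nball G (k + 1) x" using AB(2) nball_trans[of p G k x "b y" 1] by blast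
    moreover have "y \<in> nball G k (b y)" using b(1) by (rule nball_sym)
    ultimately have "y \<in> nball G (k + 1 + k) x" by (rule nball_trans)
    then show ?thesis by (simp add: mult_2)
  qed
  show ?thesis
  proof (cases "r (b x) \<le> r (b y)")
    case True
    then show ?thesis by (rule main[OF V(2,3) x y])
  next
    case False
    then have "x \<in> nball G (2 * k + 1) y" by (intro main[OF V(3,2) y x]) simp
    then show ?thesis by (rule nball_sym)
  qed
qed

text \<open>The visited prefix \<open>xs\<close> determines the labels, also those of the earlier rounds.\<close>

definition label :: "'a ugraph \<Rightarrow> 'a list \<Rightarrow> nat \<Rightarrow> 'a \<Rightarrow> nat list" where
  "label G xs j w = map (\<lambda>i. card (verts G) - i) (filter (\<lambda>i. adj G (xs ! i) w) [0..<j])"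

text \<open>The last conjunct restates every past choice through the visited prefix alone, so that
  all rounds can be examined at the end of the execution.\<close>

lemma lexbfs_run_invariant:
  assumes "lexbfs_run G s xs lab"
  shows "distinct xs \<and> set xs \<subseteq> verts G \<and> (xs \<noteq> [] \<longrightarrow> hd xs = s) \<and>
    (\<forall>w\<in>verts G - set xs. lab w = label G xs (length xs) w) \<and>
    (\<forall>j<length xs. \<forall>w\<in>verts G - set (take j xs).
        (label G xs j (xs ! j), label G xs j w) \<notin> lexord {(a, b). a < b})"
  using assms
proof (induction rule: lexbfs_run.induct)
  case start
  then show ?case by (simp add: label_def)
next
  case (visit xs lab v)
  have lab: "label G (xs @ [v]) j w = label G xs j w" if "j \<le> length xs" for j w
    using that by (auto simp: label_def nth_append intro!: arg_cong[where f = "map _"] filter_cong)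
  have lab_Suc: "label G (xs @ [v]) (Suc (length xs)) w =
    (if adj G v w then label G xs (length xs) w @ [card (verts G) - length xs] else label G xs (length xs) w)" for w
    using lab[of "length xs" w] by (auto simp: label_def)
  have "(label G (xs @ [v]) j ((xs @ [v]) ! j), label G (xs @ [v]) j w) \<notin> lexord {(a, b). a < b}"
    if "j < length (xs @ [v])" "w \<in> verts G - set (take j (xs @ [v]))" for j w
    using that visit by (cases "j = length xs") (auto simp: lab nth_append)
  then show ?case using visit by (auto simp: lab_Suc hd_append)
qed

text \<open>The assigned numbers decrease over the rounds, so the first round that distinguishes
  \<open>a\<close> from \<open>b\<close> appends an entry larger than all that the other label can
  still receive.\<close>

lemma label_lexord:
  assumes n: "j \<le> card (verts G)" and i: "i < j" "adj G (xs ! i) a" "\<not> adj G (xs ! i) b"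
    and eq: "\<And>h. h < i \<Longrightarrow> adj G (xs ! h) a \<longleftrightarrow> adj G (xs ! h) b"
  shows "(label G xs j b, label G xs j a) \<in> lexord {(a, b). a < b}"
proof -
  have split: "[0..<j] = [0..<i] @ i # [Suc i..<j]"
    using i(1) upt_add_eq_append[of 0 i "j - i"] upt_conv_Cons[of i j] by simp
  define pre rest where "pre = label G xs i a" and
    "rest = (\<lambda>z. map (\<lambda>i. card (verts G) - i) (filter (\<lambda>i. adj G (xs ! i) z) [Suc i..<j]))"
  have pb: "label G xs i b = pre" using eq by (auto simp: pre_def label_def intro!: arg_cong[where f = "map _"] filter_cong)
  have "label G xs j a = pre @ (card (verts G) - i) # rest a" "label G xs j b = pre @ rest b"
    using i pb by (auto simp: label_def split rest_def pre_def)
  moreover have "(rest b, (card (verts G) - i) # rest a) \<in> lexord {(a, b). a < b}"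
  proof (cases "rest b")
    case (Cons y ys)
    then have "y \<in> set (rest b)" by simp
    then have "y < card (verts G) - i" using n by (auto simp: rest_def)
    then show ?thesis using Cons by simp
  qed simp
  ultimately show ?thesis by (simp add: lexord_append_leftI)
qed

lemma lexbfs_rank:
  assumes G: "simple_graph G" and lex: "lexbfs G s xs" and ne: "verts G \<noteq> {}"
  obtains r where "lex_rank G r" "hd xs = s" "xs \<noteq> []" "set xs = verts G"
    "\<forall>z\<in>verts G. r s \<le> r z" "\<forall>z\<in>verts G. r z \<le> r (last xs)"
proof -
  obtain lab where run: "lexbfs_run G s xs lab" and len: "length xs = card (verts G)"
    using lex by (auto simp: lexbfs_def)
  note inv = lexbfs_run_invariant[OF run]
  have fin: "finite (verts G)" using G by (simp add: simple_graph_def)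
  have dist: "distinct xs" using inv by blast
  have set: "set xs = verts G"
    using inv len distinct_card[of xs] fin by (metis card_subset_eq)
  have xne: "xs \<noteq> []" using set ne by auto
  then have hd: "hd xs = s" using inv by blast
  define r where "r = inv_into {..<length xs} ((!) xs)"
  have inj: "inj_on ((!) xs) {..<length xs}" using dist by (auto simp: inj_on_def nth_eq_iff_index_eq)
  have im: "(!) xs ` {..<length xs} = verts G" using set by (auto simp: in_set_conv_nth set_conv_nth)
  have rn: "r (xs ! i) = i" if "i < length xs" for i
    using that inj by (simp add: r_def inv_into_f_f)
  have nr: "xs ! r z = z" "r z < length xs" if "z \<in> verts G" for z
    using that im f_inv_into_f[of z "(!) xs" "{..<length xs}"] inv_into_into[of z "(!) xs" "{..<length xs}"]
    by (auto simp: r_def)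
  have "lex_rank G r"
    unfolding lex_rank_def
  proof (intro conjI ballI impI)
    show "inj_on r (verts G)" using nr by (metis inj_onI)
    fix a b c assume V: "a \<in> verts G" "b \<in> verts G" "c \<in> verts G"
      and *: "r c < r b" "r b < r a" "adj G c a" "\<not> adj G c b"
    let ?D = "\<lambda>h. adj G (xs ! h) a \<noteq> adj G (xs ! h) b"
    \<comment> \<open>The first visited vertex that distinguishes \<open>a\<close> from
      \<open>b\<close>. It favours \<open>b\<close>, since otherwise \<open>a\<close> would have had
      the larger label when \<open>b\<close> was chosen; \<open>c\<close> favours \<open>a\<close>,
      so it comes strictly later.\<close>
    define i where "i = (LEAST h. ?D h)"
    have D: "?D (r c)" using * nr V by auto
    have i: "?D i" "\<And>h. h < i \<Longrightarrow> \<not> ?D h" "i \<le> r c"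
      unfolding i_def using LeastI[of ?D, OF D] not_less_Least[of _ ?D] Least_le[of ?D, OF D] by blast+
    have "a \<notin> set (take (r b) xs)"
      using * rn V nr by (auto simp: in_set_conv_nth) (metis nr(2) less_trans not_less_iff_gr_or_eq rn)
    then have notless: "(label G xs (r b) b, label G xs (r b) a) \<notin> lexord {(a, b). a < b}"
      using inv V nr by (metis DiffI)
    have "\<not> (adj G (xs ! i) a \<and> \<not> adj G (xs ! i) b)"
      using label_lexord[of "r b" G i xs a b] i * V nr(2)[of b] len notless by auto
    then have ib: "adj G (xs ! i) b" "\<not> adj G (xs ! i) a" using i by auto
    then have "i \<noteq> r c" using * nr V by auto
    then have "i < r c" using i by auto
    then show "\<exists>d\<in>verts G. r d < r c \<and> adj G d b \<and> \<not> adj G d a"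
      using ib rn nr(2)[OF V(3)] set by (intro bexI[of _ "xs ! i"]) auto
  qed
  moreover have "r s = 0" using rn[of 0] hd xne by (simp add: hd_conv_nth)
  moreover have "\<forall>z\<in>verts G. r z \<le> r (last xs)"
    using nr(2) rn[of "length xs - 1"] xne by (fastforce simp: last_conv_nth)
  ultimately show ?thesis using that[of r] xne hd set by auto
qed

text \<open>If the ball around the last vertex reaches the start, the earliest vertex of all, then
  so does the ball of the same radius around every earlier centre.\<close>

lemma lex_rank_last_farthest:
  assumes G: "connected_graph G" and r: "lex_rank G r" and V: "s \<in> verts G" "v \<in> verts G"
    and first: "\<forall>z\<in>verts G. r s \<le> r z" and last: "\<forall>z\<in>verts G. r z \<le> r v"
    and v: "v \<in> nball G k s"
  shows "verts G \<subseteq> nball G k s"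
proof
  have sg: "simple_graph G" using G by (simp add: connected_graph_def)
  fix x assume x: "x \<in> verts G"
  have "s \<in> nball G k v" using v by (rule nball_sym)
  then obtain w where w: "w \<in> nball G k x" "r w \<le> r s"
    using lex_rank_nball[OF sg r x V(2) bspec[OF last x]] by blast
  have "w \<in> verts G" using w nball_verts[OF sg x] by auto
  then have "w = s" using w first r V by (auto simp: lex_rank_def inj_on_def)
  then show "x \<in> nball G k s" using w nball_sym[of w G k x] by blast
qed

lemma lex_rank_diam_le:
  assumes G: "connected_graph G" and ch: "chordal G" and r: "lex_rank G r" and V: "v \<in> verts G"
    and last: "\<forall>z\<in>verts G. r z \<le> r v" and v: "verts G \<subseteq> nball G (2 * k + 1) v"
  shows "diam G \<le> 2 * k + 1"
proof -
  have "simple_graph G" using G by (simp add: connected_graph_def)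
  then have "y \<in> nball G (2 * k + 1) x" if "x \<in> verts G" "y \<in> verts G" for x y
    using lex_rank_odd_ball[OF _ ch r V that last, of k] v that by blast
  then show ?thesis unfolding diam_le_iff[OF G] by blast
qed

lemma ecc_le_diam:
  assumes G: "connected_graph G" and v: "v \<in> verts G"
  shows "ecc G v \<le> diam G"
  using diam_le_iff[OF G, of "diam G"] ecc_le_iff[OF G v, of "diam G"] v by blast

text \<open>Four points pairwise K apart span at least 3K, and 3K > K + 3 from K = 2 on. It is
  applied with K = 2k - 2 to the indices of a path with at most K + 4 vertices.\<close>

lemma four_apart:
  fixes a b c d K :: nat
  assumes "2 \<le> K" "a \<le> K + 3" "b \<le> K + 3" "c \<le> K + 3" "d \<le> K + 3"
    "a + K \<le> b \<or> b + K \<le> a" "a + K \<le> c \<or> c + K \<le> a" "a + K \<le> d \<or> d + K \<le> a"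
    "b + K \<le> c \<or> c + K \<le> b" "b + K \<le> d \<or> d + K \<le> b" "c + K \<le> d \<or> d + K \<le> c"
  shows False
  using assms by - (elim disjE, linarith+)

lemma chordal_two_sweep:
  assumes G: "connected_graph G" and ch: "chordal G" and dom: "has_dominating_shortest_path G"
    and s: "s \<in> verts G" and xs: "lexbfs G s xs" and ys: "lexbfs G (last xs) ys"
    and e3: "ecc G (last ys) \<ge> 3"
  shows "ecc G (last ys) = diam G"
proof (rule ccontr)
  assume neq: "ecc G (last ys) \<noteq> diam G"
  define u v where "u = last xs" and "v = last ys"
  have sg: "simple_graph G" and ne: "verts G \<noteq> {}" using G by (auto simp: connected_graph_def)
  obtain r1 where r1: "lex_rank G r1" "xs \<noteq> []" "set xs = verts G" "\<forall>z\<in>verts G. r1 z \<le> r1 u"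
    by (rule lexbfs_rank[OF sg xs ne], rule that) (simp_all add: u_def)
  obtain r2 where r2: "lex_rank G r2" "ys \<noteq> []" "set ys = verts G" "\<forall>z\<in>verts G. r2 u \<le> r2 z"
    "\<forall>z\<in>verts G. r2 z \<le> r2 v"
    by (rule lexbfs_rank[OF sg ys ne], rule that) (simp_all add: u_def v_def)
  have uv: "u \<in> verts G" "v \<in> verts G" using r1 r2 last_in_set by (auto simp: u_def v_def)
  have lt: "ecc G v < diam G" using neq ecc_le_diam[OF G uv(2)] v_def by simp
  have "even (ecc G v)"
  proof (rule ccontr)
    assume "odd (ecc G v)"
    then obtain k where k: "ecc G v = 2 * k + 1" by (elim oddE)
    then have "diam G \<le> 2 * k + 1"
      using lex_rank_diam_le[OF G ch r2(1) uv(2) r2(5), where k = k] ecc_le_iff[OF G uv(2), of "2 * k + 1"] by (metis order_refl)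
    then show False using lt k by simp
  qed
  then obtain k where k: "ecc G v = 2 * k" by auto
  have "3 \<le> 2 * k" using e3 unfolding k[symmetric] v_def .
  then have k2: "2 \<le> k" by presburger
  \<comment> \<open>Brings the radius 2k - 1 into the form 2l + 1 for which last vertices are
    simplicial.\<close>
  define l where "l = k - 1"
  have l: "2 * k - 1 = 2 * l + 1" "2 * k = 2 * l + 2" using k2 unfolding l_def by presburger+
  have allv: "verts G \<subseteq> nball G (2 * k) v" using ecc_le_iff[OF G uv(2), of "2 * k"] k by simp
  then have "verts G \<subseteq> nball G (2 * k + 1) v" by (rule order_trans) (rule nball_mono, simp)
  then have "diam G \<le> 2 * k + 1" by (rule lex_rank_diam_le[OF G ch r2(1) uv(2) r2(5)])
  then have D: "diam G = 2 * k + 1" using lt k by simp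
  then have "\<not> diam G \<le> 2 * k" by simp
  then obtain x y where xy: "x \<in> verts G" "y \<in> verts G" "y \<notin> nball G (2 * k) x"
    by (auto simp: diam_le_iff[OF G])
  then have yx: "x \<notin> nball G (2 * k) y" using nball_sym[of x G "2 * k" y] by blast
  have "u \<in> nball G (2 * k) v" using allv uv by auto
  then have "v \<in> nball G (2 * k) u" by (rule nball_sym)
  then have allu: "verts G \<subseteq> nball G (2 * k) u"
    by (rule lex_rank_last_farthest[OF G r2(1) uv r2(4,5)])
  \<comment> \<open>Otherwise e(u) <= 2k - 1, as \<open>v\<close> is farthest from \<open>u\<close>;
    since \<open>u\<close> is last in the first sweep, this odd bound would carry over to the
    diameter.\<close>
  have duv: "v \<notin> nball G (2 * k - 1) u"
  proof
    assume "v \<in> nball G (2 * k - 1) u"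
    then have "verts G \<subseteq> nball G (2 * l + 1) u"
      unfolding l(1) by (rule lex_rank_last_farthest[OF G r2(1) uv r2(4,5)])
    then have "diam G \<le> 2 * l + 1" by (rule lex_rank_diam_le[OF G ch r1(1) uv(1) r1(4)])
    then show False using D l by simp
  qed
  \<comment> \<open>If \<open>x\<close> is within 2k - 1 of \<open>w\<close>, so is some
    \<open>z\<close> equal or adjacent to \<open>y\<close>. By the simplicial property
    \<open>x\<close> and \<open>z\<close> are within 2k - 1 of each other, which puts
    \<open>y\<close> within 2k of \<open>x\<close>.\<close>
  have far: "x \<notin> nball G (2 * k - 1) w"
    if w: "w \<in> verts G" and r: "lex_rank G r" "\<forall>z\<in>verts G. r z \<le> r w"
      and all: "verts G \<subseteq> nball G (2 * k) w"
      and xy: "x \<in> verts G" "y \<in> verts G" "y \<notin> nball G (2 * k) x" for w r x y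
  proof
    assume x: "x \<in> nball G (2 * k - 1) w"
    have "2 * k = 2 * k - 1 + 1" using k2 by simp
    then have "y \<in> nball G (2 * k - 1 + 1) w" using all xy(2) by (metis subsetD)
    then obtain z where z: "z \<in> nball G (2 * k - 1) w" "y \<in> nball G 1 z" using nball_split[of y G "2 * k - 1" 1 w] by blast
    have "z \<in> verts G" using z nball_verts[OF sg w] by auto
    then have "z \<in> nball G (2 * k - 1) x"
      using lex_rank_odd_ball[OF sg ch r(1) w xy(1) _ r(2), of z l] x z(1) unfolding l(1) by blast
    then have "y \<in> nball G (2 * k - 1 + 1) x" using nball_trans[of z G _ x y 1] z(2) by blast
    then show False using xy(3) \<open>2 * k = 2 * k - 1 + 1\<close> by metis
  qed
  have far4: "x \<notin> nball G (2 * k - 1) u" "y \<notin> nball G (2 * k - 1) u"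
    "x \<notin> nball G (2 * k - 1) v" "y \<notin> nball G (2 * k - 1) v"
    using far[OF uv(1) r1(1,4) allu xy] far[OF uv(1) r1(1,4) allu xy(2,1) yx]
      far[OF uv(2) r2(1,5) allv xy] far[OF uv(2) r2(1,5) allv xy(2,1) yx] .
  have far_xy: "y \<notin> nball G (2 * k - 1) x" using xy(3) nball_mono[of "2 * k - 1" "2 * k" G x] by (meson diff_le_self subsetD)
  obtain P where P: "shortest_path G P" "dominating G (set P)"
    using dom by (auto simp: has_dominating_shortest_path_def)
  have wP: "walk G P" and lP: "length P = Suc (gdist G (hd P) (last P))" and neP: "P \<noteq> []"
    using P by (auto simp: shortest_path_def walk_def)
  have "hd P \<in> verts G" "last P \<in> verts G" using wP neP by (auto simp: walk_def)
  then have "gdist G (hd P) (last P) \<le> diam G"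
    using gdist_le_iff[OF G] diam_le_iff[OF G, of "diam G"] by blast
  then have lenP: "length P \<le> 2 * k + 2" using lP D by simp
  have "\<exists>i<length P. z \<in> nball G 1 (P ! i)" if "z \<in> verts G" for z
  proof -
    have "z \<in> set P \<or> (\<exists>d\<in>set P. adj G z d)" using that P(2) by (simp add: dominating_def)
    then obtain d where "d \<in> set P" "z \<in> nball G 1 d" using adj_sym[of G z] by (auto simp: nball_1)
    then show ?thesis by (auto simp only: in_set_conv_nth)
  qed
  then obtain f where f: "\<And>z. z \<in> verts G \<Longrightarrow> f z < length P"
    "\<And>z. z \<in> verts G \<Longrightarrow> z \<in> nball G 1 (P ! f z)" by metis
  \<comment> \<open>From \<open>a\<close> to its dominator, along the path, and on to
    \<open>b\<close>: two edges more than the difference of the indices, hence 2k - 3.\<close>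
  have near: "b \<in> nball G (2 * k - 1) a"
    if ab: "a \<in> verts G" "b \<in> verts G" "f a \<le> f b" "f b - f a \<le> 2 * k - 3" for a b
  proof -
    have "walk G (drop (f a) (take (Suc (f b)) P))"
      using f(1)[OF ab(2)] ab by (intro walk_drop walk_take wP) auto
    moreover have "hd (drop (f a) (take (Suc (f b)) P)) = P ! f a"
      "last (drop (f a) (take (Suc (f b)) P)) = P ! f b"
      "length (drop (f a) (take (Suc (f b)) P)) = Suc (f b - f a)"
      using f(1)[OF ab(2)] ab by (auto simp: hd_drop_conv_nth last_conv_nth)
    ultimately have "P ! f b \<in> nball G (f b - f a) (P ! f a)" using walk_nball by fastforce
    then have "P ! f b \<in> nball G (1 + (f b - f a)) a"
      by (rule nball_trans[OF nball_sym[OF f(2)[OF ab(1)]]])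
    then have "b \<in> nball G (1 + (f b - f a) + 1) a" using nball_trans[of _ G _ a] f(2)[OF ab(2)] by blast
    then show ?thesis using nball_mono[of "1 + (f b - f a) + 1" "2 * k - 1" G a] ab(4) k2
      by (elim subsetD[rotated]) linarith
  qed
  have apart: "f a + (2 * k - 2) \<le> f b \<or> f b + (2 * k - 2) \<le> f a"
    if "a \<in> verts G" "b \<in> verts G" "b \<notin> nball G (2 * k - 1) a" for a b
  proof (cases "f a \<le> f b")
    case True
    then have "\<not> f b - f a \<le> 2 * k - 3" using near[of a b] that by blast
    then show ?thesis using k2 by linarith
  next
    case False
    then have "\<not> f a - f b \<le> 2 * k - 3" using near[of b a] nball_sym[of a G "2 * k - 1" b] that by force
    then show ?thesis using k2 by linarith
  qed
  have "2 \<le> 2 * k - 2" using k2 by linarith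
  have "f z \<le> 2 * k - 2 + 3" if "z \<in> verts G" for z
    using f(1)[OF that] lenP k2 by linarith
  note le = this
  have "v \<notin> nball G (2 * k - 1) x" "v \<notin> nball G (2 * k - 1) y"
    using far4(3,4) nball_sym[of v G "2 * k - 1"] by metis+
  note far2 = this
  show False
    by (rule four_apart[OF \<open>2 \<le> 2 * k - 2\<close> le[OF uv(1)] le[OF xy(1)] le[OF xy(2)] le[OF uv(2)]
      apart[OF uv(1) xy(1) far4(1)] apart[OF uv(1) xy(2) far4(2)] apart[OF uv duv]
      apart[OF xy(1,2) far_xy] apart[OF xy(1) uv(2) far2(1)] apart[OF xy(2) uv(2) far2(2)]])
qed

section \<open>Reasoning about programs\<close>

lemma exp_fits_mono: "exp_fits W s e \<Longrightarrow> W \<le> W' \<Longrightarrow> exp_fits W' s e"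
  by (induction e) auto

lemmas exec_intros = exec.intros[unfolded One_nat_def]

lemma exec_mono: "exec W c s t s' \<Longrightarrow> W \<le> W' \<Longrightarrow> exec W' c s t s'"
  by (induction rule: exec.induct) (auto intro: exec_intros exp_fits_mono)

text \<open>Leaving the word bound existential separates correctness from word size;
  \<open>ram_tame\<close> supplies a polynomial bound afterwards.\<close>

definition ram :: "com \<Rightarrow> memory \<Rightarrow> nat \<Rightarrow> memory \<Rightarrow> bool" where
  "ram c s t s' \<longleftrightarrow> (\<exists>W. exec W c s t s')"

lemma ex_exp_fits: "\<exists>W. exp_fits W s e"
proof (induction e)
  case (Load a e)
  then obtain W where "exp_fits W s e" by blast
  then show ?case by (intro exI[of _ "max W (s a (exp_val s e))"]) (auto intro: exp_fits_mono)
next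
  case (Op f e1 e2)
  then obtain W1 W2 where "exp_fits W1 s e1" "exp_fits W2 s e2" by blast
  then show ?case
    by (intro exI[of _ "max (max W1 W2) (exp_val s (Op f e1 e2))"]) (auto intro: exp_fits_mono)
qed auto

text \<open>\<open>T\<close> counts the steps taken before \<open>c\<close>, so a time bound is just
  one more conjunct of a postcondition or an invariant. As a halting run is required, this is total
  correctness.\<close>

definition wp :: "com \<Rightarrow> (nat \<Rightarrow> memory \<Rightarrow> bool) \<Rightarrow> nat \<Rightarrow> memory \<Rightarrow> bool" where
  "wp c Q T s \<longleftrightarrow> (\<exists>t s'. ram c s t s' \<and> Q (T + t) s')"

lemma wp_mono: "wp c Q T s \<Longrightarrow> (\<And>T s. Q T s \<Longrightarrow> Q' T s) \<Longrightarrow> wp c Q' T s"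
  unfolding wp_def by blast

lemma wp_Skip: "Q (Suc T) s \<Longrightarrow> wp Skip Q T s"
  unfolding wp_def ram_def using exec.Skip[of 0 s] by fastforce

lemma wp_Store:
  assumes "Q (Suc T) (s(a := (s a)(exp_val s e1 := exp_val s e2)))"
  shows "wp (Store a e1 e2) Q T s"
proof -
  obtain W1 W2 where "exp_fits W1 s e1" "exp_fits W2 s e2" using ex_exp_fits by metis
  then have "exec (max W1 W2) (Store a e1 e2) s 1 (s(a := (s a)(exp_val s e1 := exp_val s e2)))"
    by (intro exec.Store) (auto intro: exp_fits_mono)
  then have "ram (Store a e1 e2) s 1 (s(a := (s a)(exp_val s e1 := exp_val s e2)))"
    unfolding ram_def by blast
  then show ?thesis unfolding wp_def using assms by (metis Suc_eq_plus1)
qed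

lemma wp_Seq:
  assumes "wp c1 (wp c2 Q) T s"
  shows "wp (Seq c1 c2) Q T s"
proof -
  obtain t1 s1 W1 t2 s2 W2 where *: "exec W1 c1 s t1 s1" "exec W2 c2 s1 t2 s2" "Q (T + t1 + t2) s2"
    using assms unfolding wp_def ram_def by blast
  then have "exec (max W1 W2) (Seq c1 c2) s (t1 + t2) s2"
    by (auto intro!: exec.Seq[of _ c1 s t1 s1] intro: exec_mono)
  then have "ram (Seq c1 c2) s (t1 + t2) s2" unfolding ram_def by blast
  then show ?thesis using *(3) unfolding wp_def by (metis add.assoc)
qed

lemma wp_If:
  assumes "exp_val s e \<noteq> 0 \<Longrightarrow> wp c1 Q (Suc T) s" "exp_val s e = 0 \<Longrightarrow> wp c2 Q (Suc T) s"
  shows "wp (If e c1 c2) Q T s"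
proof -
  obtain W where W: "exp_fits W s e" using ex_exp_fits by blast
  have *: "\<exists>t s'. ram (If e c1 c2) s t s' \<and> Q (T + t) s'"
    if c: "exp_val s e \<noteq> 0 \<and> c = c1 \<or> exp_val s e = 0 \<and> c = c2" and w: "wp c Q (Suc T) s" for c
  proof -
    obtain W' t s' where *: "exec W' c s t s'" "Q (Suc T + t) s'"
      using w unfolding wp_def ram_def by blast
    have "exec (max W W') (If e c1 c2) s (Suc t) s'"
      using c exec_mono[OF *(1), of "max W W'"] exp_fits_mono[OF W, of "max W W'"]
      by (auto intro: exec.IfTrue exec.IfFalse)
    then show ?thesis using *(2) unfolding ram_def by (metis add_Suc_shift)
  qed
  show ?thesis unfolding wp_def using *[of c1] *[of c2] assms by (cases "exp_val s e = 0") auto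
qed

lemma wp_WhileTrue:
  assumes "exp_val s e \<noteq> 0" "wp c (wp (While e c) Q) (Suc T) s"
  shows "wp (While e c) Q T s"
proof -
  obtain W where W: "exp_fits W s e" using ex_exp_fits by blast
  obtain t1 s1 W1 t2 s2 W2 where *: "exec W1 c s t1 s1" "exec W2 (While e c) s1 t2 s2" "Q (Suc T + t1 + t2) s2"
    using assms unfolding wp_def ram_def by blast
  let ?W = "max W (max W1 W2)"
  have "exec ?W (While e c) s (Suc (t1 + t2)) s2"
    using exec_mono[OF *(1), of ?W] exec_mono[OF *(2), of ?W] exp_fits_mono[OF W, of ?W] assms(1)
    by (intro exec.WhileTrue[of _ s e c t1 s1]) simp_all
  then have "ram (While e c) s (Suc (t1 + t2)) s2" unfolding ram_def by blast
  moreover have "Q (T + Suc (t1 + t2)) s2" using *(3) by (simp add: add.assoc)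
  ultimately show ?thesis unfolding wp_def by blast
qed

lemma wp_WhileFalse:
  assumes "exp_val s e = 0" "Q (Suc T) s"
  shows "wp (While e c) Q T s"
proof -
  obtain W where "exp_fits W s e" using ex_exp_fits by blast
  then have "exec W (While e c) s 1 s" using assms by (intro exec.WhileFalse)
  then show ?thesis using assms(2) unfolding wp_def ram_def by (metis Suc_eq_plus1)
qed

inductive_cases SkipE: "exec W Skip s t s'"
inductive_cases StoreE: "exec W (Store a e1 e2) s t s'"
inductive_cases SeqE: "exec W (Seq c1 c2) s t s'"
inductive_cases IfE: "exec W (If e c1 c2) s t s'"

text \<open>
  As rewrite rules these equations execute straight-line code symbolically: the simplifier
  normalises the memory after every single step, which the introduction rules above do not.
\<close>

lemma wp_simps:
  "wp Skip Q T s \<longleftrightarrow> Q (Suc T) s"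
  "wp (Store a e1 e2) Q T s \<longleftrightarrow> Q (Suc T) (s(a := (s a)(exp_val s e1 := exp_val s e2)))"
  "wp (Seq c1 c2) Q T s \<longleftrightarrow> wp c1 (wp c2 Q) T s"
  "wp (If e c1 c2) Q T s \<longleftrightarrow> (if exp_val s e \<noteq> 0 then wp c1 Q (Suc T) s else wp c2 Q (Suc T) s)"
proof -
  show "wp Skip Q T s \<longleftrightarrow> Q (Suc T) s"
    using wp_Skip[of Q T s] by (auto simp: wp_def ram_def elim!: SkipE)
  show "wp (Store a e1 e2) Q T s \<longleftrightarrow> Q (Suc T) (s(a := (s a)(exp_val s e1 := exp_val s e2)))"
    using wp_Store[of Q T s a e1 e2] by (auto simp: wp_def ram_def elim!: StoreE)
  show "wp (Seq c1 c2) Q T s \<longleftrightarrow> wp c1 (wp c2 Q) T s"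
  proof
    assume "wp (Seq c1 c2) Q T s"
    then obtain W t s' where "exec W (Seq c1 c2) s t s'" "Q (T + t) s'" by (auto simp: wp_def ram_def)
    then show "wp c1 (wp c2 Q) T s"
      by (elim SeqE) (auto simp: wp_def ram_def add.assoc intro!: exI)
  qed (rule wp_Seq)
  show "wp (If e c1 c2) Q T s \<longleftrightarrow> (if exp_val s e \<noteq> 0 then wp c1 Q (Suc T) s else wp c2 Q (Suc T) s)"
  proof
    assume "wp (If e c1 c2) Q T s"
    then obtain W t s' where *: "exec W (If e c1 c2) s t s'" "Q (T + t) s'" by (auto simp: wp_def ram_def)
    then show "if exp_val s e \<noteq> 0 then wp c1 Q (Suc T) s else wp c2 Q (Suc T) s"
      by (elim IfE) (auto simp: wp_def ram_def)
  qed (auto intro: wp_If split: if_splits)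
qed

abbreviation "V x \<equiv> Load x (Const 0)"

abbreviation "Set x e \<equiv> Store x (Const 0) e"

abbreviation "Inc x \<equiv> Store x (Const 0) (Op Add (V x) (Const 1))"

definition For :: "nat \<Rightarrow> exp \<Rightarrow> com \<Rightarrow> com" where
  "For i b c = Seq (Set i (Const 0)) (While (Op Less (V i) b) (Seq c (Inc i)))"

text \<open>The bound \<open>b\<close> is evaluated anew before every iteration, hence the
  requirement that the invariant fixes its value. \<open>Suc T\<close> charges the guard and
  \<open>Suc T'\<close> the increment of the counter.\<close>

lemma wp_For:
  assumes init: "I 0 (Suc T) (s(i := (s i)(0 := 0)))"
    and step: "\<And>j T s. I j T s \<Longrightarrow> s i 0 = j \<Longrightarrow> j < N \<Longrightarrow>
      wp c (\<lambda>T' s'. s' i 0 = j \<and> I (Suc j) (Suc T') (s'(i := (s' i)(0 := Suc j)))) (Suc T) s"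
    and bound: "\<And>j T s. I j T s \<Longrightarrow> s i 0 = j \<Longrightarrow> exp_val s b = N"
    and fin: "\<And>T s. I N T s \<Longrightarrow> s i 0 = N \<Longrightarrow> Q (Suc T) s"
  shows "wp (For i b c) Q T s"
proof -
  have loop: "wp (While (Op Less (V i) b) (Seq c (Inc i))) Q T s"
    if "I j T s" "s i 0 = j" "j \<le> N" for j T s
    using that
  proof (induction "N - j" arbitrary: j T s)
    case 0
    then show ?case using bound[of j T s] fin[of T s] by (intro wp_WhileFalse) auto
  next
    case (Suc m)
    show ?case
    proof (rule wp_WhileTrue)
      show "exp_val s (Op Less (V i) b) \<noteq> 0" using Suc bound[of j T s] by auto
      show "wp (Seq c (Inc i)) (wp (While (Op Less (V i) b) (Seq c (Inc i))) Q) (Suc T) s"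
      proof (rule wp_Seq, rule wp_mono[OF step[of j]])
        fix T' s' assume *: "s' i 0 = j \<and> I (Suc j) (Suc T') (s'(i := (s' i)(0 := Suc j)))"
        show "wp (Inc i) (wp (While (Op Less (V i) b) (Seq c (Inc i))) Q) T' s'"
          using Suc(1)[of "Suc j"] Suc(2-) * by (intro wp_Store) auto
      qed (use Suc in auto)
    qed
  qed
  show ?thesis unfolding For_def
    by (intro wp_Seq wp_Store loop[of 0]) (use init in auto)
qed

text \<open>
  The largest number in memory grows by at most \<open>k\<close> per step, and all intermediate values
  are polynomially bounded in it; hence such a program never exceeds a word bound that is
  polynomial in the input and the running time.
\<close>

fun slow :: "nat \<Rightarrow> exp \<Rightarrow> bool" where
  "slow k (Const n) \<longleftrightarrow> n \<le> k"
| "slow k (Load a e) \<longleftrightarrow> True"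
| "slow k (Op Add e (Const n)) \<longleftrightarrow> slow (k - n) e \<and> n \<le> k"
| "slow k (Op Add _ _) \<longleftrightarrow> False"
| "slow k (Op Mul _ _) \<longleftrightarrow> False"
| "slow k (Op Less _ _) \<longleftrightarrow> 1 \<le> k"
| "slow k (Op _ e _) \<longleftrightarrow> slow k e"

lemma slow_exp_val:
  assumes "\<And>a i. s a i \<le> M"
  shows "slow k e \<Longrightarrow> exp_val s e \<le> M + k"
proof (induction k e rule: slow.induct)
  case (2 k a e)
  then show ?case using assms by (simp add: trans_le_add1)
qed (auto simp: le_diff_conv2 intro: le_trans[OF div_le_dividend] le_trans[OF mod_less_eq_dividend])

text \<open>An exponent for the base M + 2: exponents add under multiplication, the extra factor of
  at least 2 pays for the sum of two values, and a constant n is at most 2^n.\<close>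

fun deg :: "exp \<Rightarrow> nat" where
  "deg (Const n) = n"
| "deg (Load a e) = Suc (deg e)"
| "deg (Op f e1 e2) = Suc (deg e1 + deg e2)"

lemma deg_exp_val:
  assumes "\<And>a i. s a i \<le> M"
  shows "exp_val s e \<le> (M + 2) ^ deg e"
proof (induction e)
  case (Const n)
  have "n \<le> 2 ^ n" by (simp add: less_imp_le)
  also have "... \<le> (M + 2) ^ n" by (intro power_mono) auto
  finally show ?case by simp
next
  case (Load a e)
  have "s a (exp_val s e) \<le> (M + 2) ^ 1" using assms[of a "exp_val s e"] by simp
  also have "... \<le> (M + 2) ^ Suc (deg e)" by (intro power_increasing) auto
  finally show ?case by simp
next
  case (Op f e1 e2)
  let ?x = "exp_val s e1" and ?y = "exp_val s e2" and ?p = "(M + 2) ^ (deg e1 + deg e2)"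
  have x: "?x \<le> ?p" and y: "?y \<le> ?p"
    using Op order_trans power_increasing[of "deg e1" "deg e1 + deg e2" "M + 2"]
      power_increasing[of "deg e2" "deg e1 + deg e2" "M + 2"] by fastforce+
  have "?x * ?y \<le> ?p" using Op by (simp add: power_add mult_mono)
  moreover have "?x div ?y \<le> ?x" "?x mod ?y \<le> ?x" by simp_all
  moreover have "1 \<le> ?p" by simp
  ultimately have "binop_val f ?x ?y \<le> 2 * ?p" using x y
    by (cases f; simp only: binop_val.simps split: if_split) linarith+
  also have "... \<le> (M + 2) * ?p" by (intro mult_right_mono) auto
  finally show ?case by simp
qed

lemma deg_exp_fits:
  assumes s: "\<And>a i. s a i \<le> M" and "deg e \<le> k" "(M + 2) ^ k \<le> W"
  shows "exp_fits W s e"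
  using assms(2)
proof (induction e)
  have W: "exp_val s e \<le> W" if "deg e \<le> k" for e
  proof -
    have "exp_val s e \<le> (M + 2) ^ deg e" by (rule deg_exp_val[OF s])
    also have "... \<le> (M + 2) ^ k" using that by (intro power_increasing) auto
    finally show ?thesis using assms(3) by (rule le_trans)
  qed
  {
    case (Const n)
    then show ?case using W[of "Const n"] by simp
  next
    case (Load a e)
    then show ?case using W[of "Load a e"] by simp
  next
    case (Op f e1 e2)
    then show ?case using W[of "Op f e1 e2"] by simp
  }
qed

text \<open>Only stored values have to grow slowly; addresses and guards may be as large as a fixed
  polynomial in the memory contents.\<close>

fun tame :: "nat \<Rightarrow> com \<Rightarrow> bool" where
  "tame k Skip \<longleftrightarrow> True"
| "tame k (Store a e1 e2) \<longleftrightarrow> slow k e2 \<and> deg e1 \<le> k \<and> deg e2 \<le> k"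
| "tame k (Seq c1 c2) \<longleftrightarrow> tame k c1 \<and> tame k c2"
| "tame k (If e c1 c2) \<longleftrightarrow> deg e \<le> k \<and> tame k c1 \<and> tame k c2"
| "tame k (While e c) \<longleftrightarrow> deg e \<le> k \<and> tame k c"

lemma tame_For [simp]:
  "tame k (For i b c) \<longleftrightarrow> 3 \<le> k \<and> deg b + 2 \<le> k \<and> tame k c"
  by (auto simp: For_def)

lemma exec_tame:
  assumes "exec W c s t s'" "tame k c" "\<And>a i. s a i \<le> M"
  shows "s' a i \<le> M + k * t" "(M + k * t + 2) ^ k \<le> W' \<Longrightarrow> exec W' c s t s'"
proof -
  have "(\<forall>a i. s' a i \<le> M + k * t) \<and> (\<forall>W'. (M + k * t + 2) ^ k \<le> W' \<longrightarrow> exec W' c s t s')"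
    using assms
  proof (induction arbitrary: M rule: exec.induct)
    case (Skip s)
    then show ?case by (auto intro: exec_intros trans_le_add1)
  next
    case (Store s e1 e2 a)
    have "exp_fits W' s e1 \<and> exp_fits W' s e2" if "(M + k * 1 + 2) ^ k \<le> W'" for W'
    proof -
      have "(M + 2) ^ k \<le> (M + k * 1 + 2) ^ k" by (intro power_mono) auto
      then show ?thesis using that Store deg_exp_fits[of s M _ k W'] by auto
    qed
    moreover have "exp_val s e2 \<le> M + k" using slow_exp_val[of s M k e2] Store by auto
    ultimately show ?case using Store.prems
      by (intro conjI allI impI exec.Store) (auto intro: trans_le_add1)
  next
    case (Seq c1 s t1 s1 c2 t2 s2)
    have 1: "\<forall>a i. s1 a i \<le> M + k * t1"
      "\<And>W'. (M + k * t1 + 2) ^ k \<le> W' \<Longrightarrow> exec W' c1 s t1 s1"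
      using Seq.IH(1)[of M] Seq.prems by auto
    have 2: "\<forall>a i. s2 a i \<le> M + k * t1 + k * t2"
      "\<And>W'. (M + k * t1 + k * t2 + 2) ^ k \<le> W' \<Longrightarrow> exec W' c2 s1 t2 s2"
      using Seq.IH(2)[of "M + k * t1"] Seq.prems 1 by auto
    have "(M + k * t1 + 2) ^ k \<le> (M + k * t1 + k * t2 + 2) ^ k" by (intro power_mono) auto
    then show ?case using 1(2) 2
      by (auto simp: algebra_simps intro!: exec.Seq[of _ c1 s t1 s1])
  next
    case (IfTrue s e c1 t s1 c2)
    have le: "(M + k * t + 2) ^ k \<le> (M + k * Suc t + 2) ^ k" "(M + 2) ^ k \<le> (M + k * Suc t + 2) ^ k"
      by (intro power_mono; simp)+
    have "\<forall>a i. s1 a i \<le> M + k * t" "\<And>W'. (M + k * t + 2) ^ k \<le> W' \<Longrightarrow> exec W' c1 s t s1"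
      using IfTrue.IH[of M] IfTrue.prems by auto
    moreover from this(1) have "s1 a i \<le> M + k * Suc t" for a i
      using add_le_mono[of "s1 a i" "M + k * t" 0 k] by simp
    ultimately show ?case using IfTrue.hyps IfTrue.prems le deg_exp_fits[of s M e k]
      by (auto intro!: exec.IfTrue intro: order_trans)
  next
    case (IfFalse s e c2 t s1 c1)
    have le: "(M + k * t + 2) ^ k \<le> (M + k * Suc t + 2) ^ k" "(M + 2) ^ k \<le> (M + k * Suc t + 2) ^ k"
      by (intro power_mono; simp)+
    have "\<forall>a i. s1 a i \<le> M + k * t" "\<And>W'. (M + k * t + 2) ^ k \<le> W' \<Longrightarrow> exec W' c2 s t s1"
      using IfFalse.IH[of M] IfFalse.prems by auto
    moreover from this(1) have "s1 a i \<le> M + k * Suc t" for a i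
      using add_le_mono[of "s1 a i" "M + k * t" 0 k] by simp
    ultimately show ?case using IfFalse.hyps IfFalse.prems le deg_exp_fits[of s M e k]
      by (auto intro!: exec.IfFalse intro: order_trans)
  next
    case (WhileTrue s e c t1 s1 t2 s2)
    have 1: "\<forall>a i. s1 a i \<le> M + k * t1"
      "\<And>W'. (M + k * t1 + 2) ^ k \<le> W' \<Longrightarrow> exec W' c s t1 s1"
      using WhileTrue.IH(1)[of M] WhileTrue.prems by auto
    have 2: "\<forall>a i. s2 a i \<le> M + k * t1 + k * t2"
      "\<And>W'. (M + k * t1 + k * t2 + 2) ^ k \<le> W' \<Longrightarrow> exec W' (While e c) s1 t2 s2"
      using WhileTrue.IH(2)[of "M + k * t1"] WhileTrue.prems 1 by auto
    let ?B = "(M + k * Suc (t1 + t2) + 2) ^ k"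
    have le: "(M + k * t1 + 2) ^ k \<le> ?B" "(M + k * t1 + k * t2 + 2) ^ k \<le> ?B" "(M + 2) ^ k \<le> ?B"
      by (intro power_mono; simp add: algebra_simps)+
    have "exec W' (While e c) s (Suc (t1 + t2)) s2" if "?B \<le> W'" for W'
      using WhileTrue.hyps WhileTrue.prems 1(2) 2(2) le that deg_exp_fits[of s M e k W']
      by (intro exec.WhileTrue[of _ s e c t1 s1 t2 s2]) auto
    moreover have "s2 a i \<le> M + k * Suc (t1 + t2)" for a i
      using 2(1)[rule_format, of a i] by (simp add: algebra_simps)
    ultimately show ?case by blast
  next
    case (WhileFalse s e c)
    have le: "(M + 2) ^ k \<le> (M + k * 1 + 2) ^ k" by (intro power_mono) auto
    then show ?case using WhileFalse deg_exp_fits[of s M e k]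
      by (auto intro!: exec_intros(7) intro: trans_le_add1 order_trans)
  qed
  then show "s' a i \<le> M + k * t" "(M + k * t + 2) ^ k \<le> W' \<Longrightarrow> exec W' c s t s'" by auto
qed

lemma init_memory_le: "init_memory xs a i \<le> sum_list xs"
  by (auto simp: init_memory_def member_le_sum_list)

lemma ram_tame:
  assumes tame: "tame k p" and ram: "ram p (init_memory xs) t s"
  shows "exec ((2 + length xs + sum_list xs + t) ^ ((k + 1) * k)) p (init_memory xs) t s"
    "s a i \<le> sum_list xs + k * t"
proof -
  let ?M = "sum_list xs"
  let ?B = "2 + length xs + ?M + t"
  \<comment> \<open>The base is at least 2, so the factor k + 1 costs no more than k further powers
    of it.\<close>
  have "k + 1 \<le> 2 ^ k" by (induction k) auto
  also have "(2::nat) ^ k \<le> ?B ^ k" by (intro power_mono) auto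
  finally have "(k + 1) * ?B \<le> ?B ^ k * ?B" by (intro mult_right_mono) auto
  moreover have "?M + k * t + 2 \<le> (k + 1) * ?B" by (simp add: algebra_simps)
  ultimately have "?M + k * t + 2 \<le> ?B ^ (k + 1)" by (simp add: algebra_simps)
  then have "(?M + k * t + 2) ^ k \<le> ?B ^ ((k + 1) * k)" by (metis power_mono power_mult zero_le)
  moreover obtain W where W: "exec W p (init_memory xs) t s" using ram by (auto simp: ram_def)
  ultimately show "exec (?B ^ ((k + 1) * k)) p (init_memory xs) t s"
    using exec_tame(2)[OF _ tame, of _ "init_memory xs" t s ?M] init_memory_le by blast
  show "s a i \<le> ?M + k * t" using exec_tame(1)[OF W tame] init_memory_le by blast
qed

lemma decides_in_time_tameI:
  assumes tame: "tame k p"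
    and run: "\<And>x. x \<in> I \<Longrightarrow> wp p (\<lambda>t s. real t \<le> C * T x \<and> (s 0 0 \<noteq> 0 \<longleftrightarrow> P x)) 0 (init_memory (enc x))"
  shows "decides_in_time p I enc P T"
  unfolding decides_in_time_def
proof (rule exI, rule exI, rule ballI)
  fix x assume "x \<in> I"
  then obtain t s where ts: "ram p (init_memory (enc x)) t s" "real t \<le> C * T x" "s 0 0 \<noteq> 0 \<longleftrightarrow> P x"
    using run unfolding wp_def by fastforce
  then show "\<exists>t s. exec ((2 + length (enc x) + sum_list (enc x) + t) ^ ((k + 1) * k)) p
      (init_memory (enc x)) t s \<and> real t \<le> C * T x \<and> (s 0 0 \<noteq> 0 \<longleftrightarrow> P x)"
    using ram_tame(1)[OF tame] by blast
qed

section \<open>Independence of the arrays that a program does not mention\<close>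

fun exp_arrays :: "exp \<Rightarrow> nat set" where
  "exp_arrays (Const n) = {}"
| "exp_arrays (Load a e) = insert a (exp_arrays e)"
| "exp_arrays (Op f e1 e2) = exp_arrays e1 \<union> exp_arrays e2"

fun arrays :: "com \<Rightarrow> nat set" where
  "arrays Skip = {}"
| "arrays (Store a e1 e2) = insert a (exp_arrays e1 \<union> exp_arrays e2)"
| "arrays (Seq c1 c2) = arrays c1 \<union> arrays c2"
| "arrays (If e c1 c2) = exp_arrays e \<union> arrays c1 \<union> arrays c2"
| "arrays (While e c) = exp_arrays e \<union> arrays c"

lemma finite_arrays: "finite (arrays c)"
proof -
  have "finite (exp_arrays e)" for e by (induction e) auto
  then show ?thesis by (induction c) auto
qed

lemma exp_val_cong: "\<forall>a\<in>exp_arrays e. s a = r a \<Longrightarrow> exp_val s e = exp_val r e"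
  by (induction e) auto

lemma exp_fits_cong: "\<forall>a\<in>exp_arrays e. s a = r a \<Longrightarrow> exp_fits W s e \<longleftrightarrow> exp_fits W r e"
proof (induction e)
  case (Op f e1 e2)
  then show ?case using exp_val_cong[of e1 s r] exp_val_cong[of e2 s r] by auto
qed (auto dest: exp_val_cong)

text \<open>Transfers a run on fresh memory to a memory in which an earlier program has left its
  data in other arrays.\<close>

lemma exec_cong:
  assumes "exec W c s t s'" "arrays c \<subseteq> A" "\<forall>a\<in>A. s a = r a"
  shows "\<exists>r'. exec W c r t r' \<and> (\<forall>a\<in>A. s' a = r' a)"
  using assms
proof (induction arbitrary: r rule: exec.induct)
  case (Skip s)
  then show ?case by (blast intro: exec.Skip)
next
  case (Store s e1 e2 a)
  have "\<forall>a\<in>exp_arrays e1. s a = r a" "\<forall>a\<in>exp_arrays e2. s a = r a" using Store.prems by auto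
  note eq = exp_val_cong[OF this(1)] exp_val_cong[OF this(2)] exp_fits_cong[OF this(1)] exp_fits_cong[OF this(2)]
  have "exec W (Store a e1 e2) r 1 (r(a := (r a)(exp_val r e1 := exp_val r e2)))"
    using Store.hyps eq by (intro exec.Store) auto
  then show ?case using Store.prems eq by (intro exI conjI) auto
next
  case (Seq c1 s t1 s1 c2 t2 s2)
  obtain r1 where "exec W c1 r t1 r1" "\<forall>a\<in>A. s1 a = r1 a" using Seq.IH(1)[of r] Seq.prems by auto
  moreover from this obtain r2 where "exec W c2 r1 t2 r2" "\<forall>a\<in>A. s2 a = r2 a"
    using Seq.IH(2)[of r1] Seq.prems by auto
  ultimately show ?case by (blast intro: exec.Seq)
next
  case (IfTrue s e c1 t s1 c2)
  have eq: "\<forall>a\<in>exp_arrays e. s a = r a" using IfTrue.prems by auto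
  obtain r1 where "exec W c1 r t r1" "\<forall>a\<in>A. s1 a = r1 a" using IfTrue.IH[of r] IfTrue.prems by auto
  then show ?case using IfTrue.hyps exp_val_cong[OF eq] exp_fits_cong[OF eq]
    by (auto intro!: exI[of _ r1] exec.IfTrue)
next
  case (IfFalse s e c2 t s1 c1)
  have eq: "\<forall>a\<in>exp_arrays e. s a = r a" using IfFalse.prems by auto
  obtain r1 where "exec W c2 r t r1" "\<forall>a\<in>A. s1 a = r1 a" using IfFalse.IH[of r] IfFalse.prems by auto
  then show ?case using IfFalse.hyps exp_val_cong[OF eq] exp_fits_cong[OF eq]
    by (auto intro!: exI[of _ r1] exec.IfFalse)
next
  case (WhileTrue s e c t1 s1 t2 s2)
  have eq: "\<forall>a\<in>exp_arrays e. s a = r a" using WhileTrue.prems by auto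
  obtain r1 where r1: "exec W c r t1 r1" "\<forall>a\<in>A. s1 a = r1 a"
    using WhileTrue.IH(1)[of r] WhileTrue.prems by auto
  then obtain r2 where "exec W (While e c) r1 t2 r2" "\<forall>a\<in>A. s2 a = r2 a"
    using WhileTrue.IH(2)[of r1] WhileTrue.prems by auto
  then show ?case using WhileTrue.hyps exp_val_cong[OF eq] exp_fits_cong[OF eq] r1
    by (intro exI[of _ r2] conjI exec.WhileTrue[of _ r e c t1 r1]) auto
next
  case (WhileFalse s e c)
  have eq: "\<forall>a\<in>exp_arrays e. s a = r a" using WhileFalse.prems by auto
  then show ?case using WhileFalse exp_val_cong[OF eq] exp_fits_cong[OF eq]
    by (intro exI[of _ r] conjI exec.WhileFalse) auto
qed

section \<open>LexBFS by partition refinement\<close>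

text \<open>Labels as sets of rounds. Earlier rounds append larger numbers, so if \<open>S\<close>
  and \<open>T\<close> differ, the larger label is the one that owns the least element of the
  symmetric difference.\<close>

definition lexge :: "nat set \<Rightarrow> nat set \<Rightarrow> bool" where
  "lexge S T \<longleftrightarrow> (\<forall>c\<in>T - S. \<exists>d\<in>S - T. d < c)"

lemma lexge_refl [simp]: "lexge S S"
  by (simp add: lexge_def)

lemma lexge_antisym:
  assumes "lexge S T" "lexge T S"
  shows "S = T"
proof (rule ccontr)
  assume "S \<noteq> T"
  then have ex: "\<exists>c. c \<in> (S - T) \<union> (T - S)" by auto
  define m where "m = (LEAST c. c \<in> (S - T) \<union> (T - S))"
  have m: "m \<in> (S - T) \<union> (T - S)" "\<And>c. c \<in> (S - T) \<union> (T - S) \<Longrightarrow> m \<le> c"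
    unfolding m_def using LeastI_ex[OF ex] by (blast, intro Least_le)
  then show False using assms unfolding lexge_def by (metis DiffE Un_iff linorder_not_less)
qed

lemma lexge_insert_left:
  assumes "lexge S T" "S \<subseteq> {..i}" "T \<subseteq> {..i}"
  shows "lexge (insert i S) T"
  unfolding lexge_def
proof
  fix c assume c: "c \<in> T - insert i S"
  then obtain d where "d \<in> S - T" "d < c" using assms(1) by (auto simp: lexge_def)
  then show "\<exists>d\<in>insert i S - T. d < c" by auto
qed

lemma lexge_insert_right:
  assumes ST: "lexge S T" "S \<noteq> T" "S \<subseteq> {..i}" "i \<notin> T" and T: "T \<subseteq> {..i}"
  shows "lexge S (insert i T)"
proof -
  have "\<exists>d\<in>S - insert i T. d < i" if "i \<notin> S"
  proof -
    have "\<not> S \<subseteq> T" using ST(1,2) unfolding lexge_def by blast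
    then obtain d where "d \<in> S" "d \<notin> T" by blast
    moreover from this have "d \<noteq> i" "d \<le> i" using that ST(3) by auto
    ultimately show ?thesis by (intro bexI[of _ d]) auto
  qed
  moreover have "\<exists>d\<in>S - insert i T. d < c" if c: "c \<in> T - S" for c
  proof -
    obtain d where "d \<in> S - T" "d < c" using ST(1) c unfolding lexge_def by blast
    then show ?thesis using c T by (intro bexI[of _ d]) auto
  qed
  ultimately show ?thesis unfolding lexge_def by blast
qed

lemma not_lexge_insert: "i \<notin> S \<Longrightarrow> \<not> lexge S (insert i S)"
  by (auto simp: lexge_def)

text \<open>The positions from \<open>l\<close> on hold the unvisited vertices, sorted by decreasing
  label \<open>e\<close>. \<open>K\<close> gives the class at a position and \<open>st\<close> the
  front of a class; identifiers from \<open>nc\<close> on are fresh.\<close>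

definition classes :: "nat \<Rightarrow> nat \<Rightarrow> (nat \<Rightarrow> nat set) \<Rightarrow> (nat \<Rightarrow> nat) \<Rightarrow> (nat \<Rightarrow> nat) \<Rightarrow> nat \<Rightarrow> bool" where
  "classes l n e K st nc \<longleftrightarrow>
     (\<forall>p q. l \<le> p \<longrightarrow> p < q \<longrightarrow> q < n \<longrightarrow> lexge (e p) (e q)) \<and>
     (\<forall>p q. l \<le> p \<longrightarrow> p < n \<longrightarrow> l \<le> q \<longrightarrow> q < n \<longrightarrow> (K p = K q \<longleftrightarrow> e p = e q)) \<and>
     (\<forall>p. l \<le> p \<longrightarrow> p < n \<longrightarrow> l \<le> st (K p) \<and> st (K p) \<le> p \<and> K (st (K p)) = K p \<and> K p < nc)"

text \<open>The stamp \<open>Suc i\<close> in \<open>sp\<close> says that a class has been split in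
  round \<open>i\<close>, and \<open>nw\<close> then names the part with the larger label. Stamps of
  earlier rounds are smaller, and 0 means never split, so nothing has to be cleared between
  rounds.\<close>

definition marks :: "nat \<Rightarrow> nat \<Rightarrow> nat \<Rightarrow> (nat \<Rightarrow> nat set) \<Rightarrow> (nat \<Rightarrow> nat) \<Rightarrow> (nat \<Rightarrow> nat) \<Rightarrow> (nat \<Rightarrow> nat) \<Rightarrow> nat \<Rightarrow> bool" where
  "marks l n i e K sp nw nc \<longleftrightarrow>
     (\<forall>c. sp c \<le> Suc i) \<and> (\<forall>c\<ge>nc. sp c = 0) \<and>
     (\<forall>p. l \<le> p \<longrightarrow> p < n \<longrightarrow> i \<notin> e p \<longrightarrow> sp (K p) = Suc i \<longrightarrow>
        (\<exists>q. l \<le> q \<and> q < n \<and> K q = nw (K p) \<and> e q = insert i (e p))) \<and>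
     (\<forall>p. l \<le> p \<longrightarrow> p < n \<longrightarrow> i \<notin> e p \<longrightarrow> sp (K p) \<noteq> Suc i \<longrightarrow>
        (\<forall>q. l \<le> q \<longrightarrow> q < n \<longrightarrow> e q \<noteq> insert i (e p)))"

lemma classesD:
  assumes "classes l n e K st nc"
  shows "\<And>p q. l \<le> p \<Longrightarrow> p \<le> q \<Longrightarrow> q < n \<Longrightarrow> lexge (e p) (e q)"
    "\<And>p q. l \<le> p \<Longrightarrow> p < n \<Longrightarrow> l \<le> q \<Longrightarrow> q < n \<Longrightarrow> K p = K q \<longleftrightarrow> e p = e q"
    "\<And>p. l \<le> p \<Longrightarrow> p < n \<Longrightarrow> l \<le> st (K p) \<and> st (K p) \<le> p \<and> K (st (K p)) = K p \<and> K p < nc"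
proof -
  fix p q assume "l \<le> p" "p \<le> q" "q < n"
  then show "lexge (e p) (e q)" using assms unfolding classes_def by (cases "p = q") auto
qed (use assms in \<open>auto simp: classes_def\<close>)

lemma classes_cong:
  assumes c: "classes l n e K st nc"
    and eq: "\<And>z. l \<le> z \<Longrightarrow> z < n \<Longrightarrow> e' z = e z" "\<And>z. l \<le> z \<Longrightarrow> z < n \<Longrightarrow> K' z = K z"
  shows "classes l n e' K' st nc"
proof -
  have "l \<le> st (K' z) \<and> st (K' z) \<le> z \<and> K' (st (K' z)) = K' z \<and> K' z < nc" if "l \<le> z" "z < n" for z
    using classesD(3)[OF c that] eq(2)[OF that] eq(2)[of "st (K z)"] that by auto
  moreover have "lexge (e' p) (e' q)" if "l \<le> p" "p < q" "q < n" for p q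
    using classesD(1)[OF c, of p q] eq(1)[of p] eq(1)[of q] that by auto
  moreover have "K' p = K' q \<longleftrightarrow> e' p = e' q" if "l \<le> p" "p < n" "l \<le> q" "q < n" for p q
    using classesD(2)[OF c that] eq that by auto
  ultimately show ?thesis unfolding classes_def by blast
qed

lemma marksD:
  assumes "marks l n i e K sp nw nc"
  shows "\<And>c. sp c \<le> Suc i" "\<And>c. nc \<le> c \<Longrightarrow> sp c = 0"
    "\<And>p. l \<le> p \<Longrightarrow> p < n \<Longrightarrow> i \<notin> e p \<Longrightarrow> sp (K p) = Suc i \<Longrightarrow>
       \<exists>q. l \<le> q \<and> q < n \<and> K q = nw (K p) \<and> e q = insert i (e p)"
    "\<And>p q. l \<le> p \<Longrightarrow> p < n \<Longrightarrow> i \<notin> e p \<Longrightarrow> sp (K p) \<noteq> Suc i \<Longrightarrow> l \<le> q \<Longrightarrow> q < n \<Longrightarrow>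
       e q \<noteq> insert i (e p)"
  using assms unfolding marks_def by blast+

lemma marks_cong:
  assumes m: "marks l n i e K sp nw nc"
    and eq: "\<And>z. l \<le> z \<Longrightarrow> z < n \<Longrightarrow> e' z = e z" "\<And>z. l \<le> z \<Longrightarrow> z < n \<Longrightarrow> K' z = K z"
  shows "marks l n i e' K' sp nw nc"
  unfolding marks_def
proof (intro conjI allI impI)
  fix p assume p: "l \<le> p" "p < n" "i \<notin> e' p"
  {
    assume "sp (K' p) = Suc i"
    then obtain q where "l \<le> q" "q < n" "K q = nw (K p)" "e q = insert i (e p)"
      using marksD(3)[OF m, of p] p eq by auto
    then show "\<exists>q\<ge>l. q < n \<and> K' q = nw (K' p) \<and> e' q = insert i (e' p)"
      using eq p by (intro exI[of _ q]) auto
  next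
    fix q assume "sp (K' p) \<noteq> Suc i" "l \<le> q" "q < n"
    then show "e' q \<noteq> insert i (e' p)" using marksD(4)[OF m, of p q] p eq by auto
  }
qed (use marksD(1,2)[OF m] in auto)

lemma classes_between:
  assumes "classes l n e K st nc" "l \<le> p" "p \<le> q" "q \<le> r" "r < n" "e p = e r"
  shows "e q = e p"
  using classesD(1)[OF assms(1), of p q] classesD(1)[OF assms(1), of q r] assms lexge_antisym[of "e p" "e q"] by auto

text \<open>The pivot stands at the front of its class, so its removal moves only that front by one.
  If the class becomes empty, its front is no longer constrained.\<close>

lemma classes_pivot:
  assumes c: "classes i n e K st nc" and i: "i < n"
  shows "classes (Suc i) n e K (st(K i := Suc i)) nc"
proof -
  have "Suc i \<le> (st(K i := Suc i)) (K p) \<and> (st(K i := Suc i)) (K p) \<le> p \<and>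
      K ((st(K i := Suc i)) (K p)) = K p \<and> K p < nc" if p: "Suc i \<le> p" "p < n" for p
  proof (cases "K p = K i")
    case True
    then have "e (Suc i) = e i"
      using classes_between[OF c, of i "Suc i" p] classesD(2)[OF c, of p i] p i by auto
    then have "K (Suc i) = K i" using classesD(2)[OF c, of "Suc i" i] p i by auto
    then show ?thesis using True classesD(3)[OF c, of p] p by auto
  next
    case False
    then have "st (K p) \<noteq> i" using classesD(3)[OF c, of p] p by auto
    then show ?thesis using False classesD(3)[OF c, of p] p by auto
  qed
  then show ?thesis using c unfolding classes_def by (meson Suc_leD)
qed

text \<open>The vertex at \<open>p\<close> trades places with the one at the front \<open>q\<close>
  of its class. Both carry the same label, so the exchange is invisible in \<open>e\<close> and
  \<open>K\<close>, and only the entries at \<open>q\<close> change. The moved vertices form a class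
  before \<open>q\<close>, where the larger label belongs.\<close>

lemma classes_refine:
  assumes c: "classes l n e K st nc" and m: "marks l n i e K sp nw nc"
    and e: "\<And>p. e p \<subseteq> {..i}" and p: "l \<le> p" "p < n" "i \<notin> e p"
    and q: "q = st (K p)"
    and k: "sp (K p) = Suc i \<and> k = nw (K p) \<and> st' = st(K p := Suc q) \<and> nc' = nc \<or>
      sp (K p) \<noteq> Suc i \<and> k = nc \<and> st' = st(nc := q, K p := Suc q) \<and> nc' = Suc nc"
    and sp': "sp' = sp(K p := Suc i)" and nw': "nw' = nw(K p := k)"
  shows "classes l n (e(q := insert i (e q))) (K(q := k)) st' nc'"
    "marks l n i (e(q := insert i (e q))) (K(q := k)) sp' nw' nc'"
proof -
  let ?e = "e(q := insert i (e q))" and ?K = "K(q := k)"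
  note c1 = classesD(1)[OF c] and c2 = classesD(2)[OF c] and c3 = classesD(3)[OF c]
  have q1: "l \<le> q" "q \<le> p" "K q = K p" "q < n" using c3[OF p(1,2)] p q by auto
  have eq: "e q = e p" "i \<notin> e q" using c2[of q p] q1 p by auto
  have qmin: "q \<le> z" if "l \<le> z" "z < n" "e z = e q" for z
    using c3[OF that(1,2)] c2[of z p] that q eq p by auto
  have Kn: "K z < nc" if "l \<le> z" "z < n" for z using c3[OF that] by blast
  have spn: "sp c = 0" if "c \<ge> nc" for c using m that unfolding marks_def by blast
  \<comment> \<open>Class \<open>k\<close> is either the part split off earlier in this round or a
    fresh identifier; in the second case \<open>marks\<close> says that the enlarged label does not
    occur yet.\<close>
  have kmem: "K z = k \<longleftrightarrow> e z = insert i (e q)" if z: "l \<le> z" "z < n" for z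
  proof (cases "sp (K p) = Suc i")
    case True
    then obtain q' where q': "l \<le> q'" "q' < n" "K q' = k" "e q' = insert i (e p)"
      using m p k unfolding marks_def by metis
    then show ?thesis using c2[OF z q'(1,2)] eq by auto
  next
    case False
    then have "e z \<noteq> insert i (e p)" using m p z unfolding marks_def by blast
    then show ?thesis using False k Kn[OF z] eq by auto
  qed
  have kne: "k \<noteq> K p" using kmem[of p] p eq by auto
  have knc: "k < nc'"
  proof (cases "sp (K p) = Suc i")
    case True
    then obtain q' where "l \<le> q'" "q' < n" "K q' = k" using m p k unfolding marks_def by metis
    then show ?thesis using Kn[of q'] k True by auto
  qed (use k in auto)
  have ncle: "nc \<le> nc'" using k by auto
  have e1: "lexge (?e a) (?e b)" if ab: "l \<le> a" "a < b" "b < n" for a b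
  proof (cases "b = q")
    case True
    have "e a \<noteq> e q" using qmin[of a] ab True by auto
    then show ?thesis using lexge_insert_right[of "e a" "e q" i] c1[of a b] ab True eq e by auto
  next
    case False
    then show ?thesis using lexge_insert_left[of "e a" "e b" i] c1[of a b] ab e by auto
  qed
  have e2: "?K a = ?K b \<longleftrightarrow> ?e a = ?e b" if ab: "l \<le> a" "a < n" "l \<le> b" "b < n" for a b
    using c2[OF ab] kmem[OF ab(1,2)] kmem[OF ab(3,4)] by (cases "a = q"; cases "b = q") auto
  have e3: "l \<le> st' (?K z) \<and> st' (?K z) \<le> z \<and> ?K (st' (?K z)) = ?K z \<and> ?K z < nc'"
    if z: "l \<le> z" "z < n" for z
  proof (cases "z = q")
    case zq: True
    show ?thesis
    proof (cases "sp (K p) = Suc i")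
      case True
      then obtain q' where q': "l \<le> q'" "q' < n" "K q' = k" "e q' = insert i (e q)"
        using m p k eq unfolding marks_def by metis
      have "l \<le> st k" "st k \<le> q'" "K (st k) = k" using c3[OF q'(1,2)] q' by auto
      moreover from this have "e (st k) = insert i (e q)" using kmem[of "st k"] q' by auto
      \<comment> \<open>Otherwise the label at \<open>q\<close> would stand before the same label
        with \<open>i\<close> added.\<close>
      moreover have "st k \<le> q"
        using not_lexge_insert[OF eq(2)] c1[of q "st k"] calculation q' q1 by (metis le_less_trans nat_le_linear)
      moreover have "st k \<noteq> q" using calculation q1 kne by auto
      ultimately show ?thesis using zq True k kne knc by auto
    next
      case False
      then show ?thesis using zq k kne q1 knc by auto
    qed
  next
    case zq: False
    show ?thesis
    proof (cases "K z = K p")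
      case True
      then have ez: "e z = e q" using c2[of z p] z p eq by auto
      then have "q < z" using qmin[OF z] zq by auto
      then have "e (Suc q) = e q" using classes_between[OF c, of q "Suc q" z] z q1 ez by auto
      then have "K (Suc q) = K p" using c2[of "Suc q" q] q1 z \<open>q < z\<close> by auto
      then show ?thesis using True zq k q1 \<open>q < z\<close> Kn[OF p(1,2)] ncle by auto
    next
      case False
      have "st (K z) \<noteq> q" using c3[OF z] False q1 by auto
      moreover have "K z \<noteq> nc" using Kn[OF z] by simp
      ultimately show ?thesis using False zq k c3[OF z] ncle by auto
    qed
  qed
  show "classes l n ?e ?K st' nc'" unfolding classes_def using e1 e2 e3 by blast
  have "sp (K p) \<le> Suc i" "\<And>c. sp c \<le> Suc i" using m unfolding marks_def by auto
  moreover have "sp' c = 0" if "c \<ge> nc'" for c using that spn[of c] ncle Kn[OF p(1,2)] sp' by auto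
  moreover have "\<exists>y. l \<le> y \<and> y < n \<and> ?K y = nw' (?K z) \<and> ?e y = insert i (?e z)"
    if z: "l \<le> z" "z < n" "i \<notin> ?e z" "sp' (?K z) = Suc i" for z
  proof -
    have zq: "z \<noteq> q" using z by auto
    show ?thesis
    proof (cases "K z = K p")
      case True
      then have "e z = e q" using c2[of z p] z p eq by auto
      then show ?thesis using zq True nw' q1 by (intro exI[of _ q]) auto
    next
      case False
      then obtain y where y: "l \<le> y" "y < n" "K y = nw (K z)" "e y = insert i (e z)"
        using m z zq sp' unfolding marks_def by auto
      then have "y \<noteq> q" using eq by auto
      then show ?thesis using y zq False nw' by (intro exI[of _ y]) auto
    qed
  qed
  moreover have "?e y \<noteq> insert i (?e z)"
    if z: "l \<le> z" "z < n" "i \<notin> ?e z" "sp' (?K z) \<noteq> Suc i" and y: "l \<le> y" "y < n" for z y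
  proof -
    have zq: "z \<noteq> q" using z by auto
    have ne: "K z \<noteq> K p" "sp (K z) \<noteq> Suc i" using z zq sp' by (auto split: if_splits)
    then have "e z \<noteq> e q" using c2[of z p] z p eq by auto
    moreover have "e y \<noteq> insert i (e z)" using m z ne zq y unfolding marks_def by auto
    ultimately show ?thesis using zq z eq by (auto simp: insert_ident)
  qed
  ultimately show "marks l n i ?e ?K sp' nw' nc'" unfolding marks_def using sp' by auto
qed

section \<open>The state of LexBFS between and within rounds\<close>

definition perm :: "nat \<Rightarrow> (nat \<Rightarrow> nat) \<Rightarrow> (nat \<Rightarrow> nat) \<Rightarrow> bool" where
  "perm n ord pos \<longleftrightarrow> (\<forall>p<n. ord p < n \<and> pos (ord p) = p) \<and> (\<forall>u<n. pos u < n \<and> ord (pos u) = u)"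

lemma perm_swap:
  assumes "perm n ord pos" "p < n" "q < n"
  shows "perm n (ord(p := ord q, q := ord p)) (pos(ord q := p, ord p := q))"
proof -
  have pos: "pos (ord z) = z" "ord z < n" if "z < n" for z using assms(1) that unfolding perm_def by blast+
  have ord: "ord (pos u) = u" "pos u < n" if "u < n" for u using assms(1) that unfolding perm_def by blast+
  have "ord z = ord q \<longleftrightarrow> z = q" "ord z = ord p \<longleftrightarrow> z = p" if "z < n" for z
    using pos(1)[OF that] pos(1)[OF assms(2)] pos(1)[OF assms(3)] by metis+
  then have "(ord(p := ord q, q := ord p)) z < n \<and>
      (pos(ord q := p, ord p := q)) ((ord(p := ord q, q := ord p)) z) = z" if "z < n" for z
    using pos[OF that] pos[OF assms(2)] pos[OF assms(3)] that assms(2,3) by (simp add: fun_upd_def)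
  moreover have "(pos(ord q := p, ord p := q)) u < n \<and>
      (ord(p := ord q, q := ord p)) ((pos(ord q := p, ord p := q)) u) = u" if "u < n" for u
    using ord[OF that] assms(2,3) by (auto simp: fun_upd_def)
  ultimately show ?thesis unfolding perm_def by blast
qed

text \<open>The label of \<open>w\<close> at the beginning of round \<open>i\<close>, with rounds in
  place of the numbers that they assign.\<close>

definition earlier :: "'a ugraph \<Rightarrow> (nat \<Rightarrow> 'a) \<Rightarrow> nat \<Rightarrow> 'a \<Rightarrow> nat set" where
  "earlier G ord i w = {h. h < i \<and> adj G (ord h) w}"

definition lex_upto :: "nat ugraph \<Rightarrow> nat \<Rightarrow> nat \<Rightarrow> (nat \<Rightarrow> nat) \<Rightarrow> bool" where
  "lex_upto G n i ord \<longleftrightarrow>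
     (\<forall>h p. h < i \<longrightarrow> h < p \<longrightarrow> p < n \<longrightarrow> lexge (earlier G ord h (ord h)) (earlier G ord h (ord p)))"

definition before_round where
  "before_round G n i ord pos cls st sp nc \<longleftrightarrow> perm n ord pos \<and>
     classes i n (\<lambda>p. earlier G ord i (ord p)) (\<lambda>p. cls (ord p)) st nc \<and>
     (\<forall>c. sp c \<le> i) \<and> (\<forall>c\<ge>nc. sp c = 0) \<and> lex_upto G n i ord"

text \<open>\<open>S\<close> contains the neighbours of the pivot \<open>ord i\<close> that have
  been treated so far; only their labels contain \<open>i\<close> already.\<close>

definition in_round where
  "in_round G n i S ord pos cls st sp nw nc \<longleftrightarrow> perm n ord pos \<and>
     (let e = \<lambda>p. earlier G ord i (ord p) \<union> (if ord p \<in> S then {i} else {}) in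
       classes (Suc i) n e (\<lambda>p. cls (ord p)) st nc \<and>
       marks (Suc i) n i e (\<lambda>p. cls (ord p)) sp nw nc) \<and>
     lex_upto G n (Suc i) ord"

lemma before_round_0:
  "perm n ord pos \<Longrightarrow> before_round G n 0 ord pos (\<lambda>_. 0) (\<lambda>_. 0) (\<lambda>_. 0) (Suc 0)"
  by (auto simp: before_round_def classes_def earlier_def lex_upto_def)

lemma in_round_start:
  assumes "before_round G n i ord pos cls st sp nc" "i < n"
  shows "in_round G n i {} ord pos cls (st(cls (ord i) := Suc i)) sp nw nc"
proof -
  have c: "classes i n (\<lambda>p. earlier G ord i (ord p)) (\<lambda>p. cls (ord p)) st nc"
    and sp: "\<forall>c. sp c \<le> i" "\<forall>c\<ge>nc. sp c = 0" using assms by (auto simp: before_round_def)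
  have i: "i \<notin> earlier G ord i w" for w by (simp add: earlier_def)
  have "marks (Suc i) n i (\<lambda>p. earlier G ord i (ord p)) (\<lambda>p. cls (ord p)) sp nw nc"
  proof -
    have "sp c \<noteq> Suc i" "sp c \<le> Suc i" for c using sp(1)[rule_format, of c] by auto
    moreover have "earlier G ord i (ord q) \<noteq> insert i X" for q X using i by blast
    ultimately show ?thesis unfolding marks_def using sp(2) by blast
  qed
  moreover have "lex_upto G n (Suc i) ord"
    using assms classesD(1)[OF c] by (auto simp: before_round_def lex_upto_def less_Suc_eq)
  ultimately show ?thesis
    using assms classes_pivot[OF c assms(2)] by (simp add: in_round_def before_round_def)
qed

lemma in_round_end:
  assumes "in_round G n i {w. adj G (ord i) w} ord pos cls st sp nw nc"
  shows "before_round G n (Suc i) ord pos cls st sp nc"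
proof -
  have "earlier G ord i (ord p) \<union> (if ord p \<in> {w. adj G (ord i) w} then {i} else {}) =
      earlier G ord (Suc i) (ord p)" for p
    by (auto simp: earlier_def less_Suc_eq)
  then show ?thesis using assms by (auto simp: in_round_def before_round_def marks_def)
qed

text \<open>A vertex at a position up to \<open>i\<close> is outside the partition, so counting it
  as treated changes no label there.\<close>

lemma in_round_visited:
  assumes "in_round G n i S ord pos cls st sp nw nc" "w < n" "pos w \<le> i"
  shows "in_round G n i (insert w S) ord pos cls st sp nw nc"
proof -
  let ?e = "\<lambda>S p. earlier G ord i (ord p) \<union> (if ord p \<in> S then {i} else {})"
  have r: "perm n ord pos" "classes (Suc i) n (?e S) (\<lambda>p. cls (ord p)) st nc"
    "marks (Suc i) n i (?e S) (\<lambda>p. cls (ord p)) sp nw nc" "lex_upto G n (Suc i) ord"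
    using assms(1) by (simp_all add: in_round_def Let_def)
  have eq: "?e (insert w S) p = ?e S p" if "Suc i \<le> p" "p < n" for p
  proof -
    have "ord p \<noteq> w" using r(1) assms(3) that unfolding perm_def by force
    then show ?thesis by simp
  qed
  have "classes (Suc i) n (?e (insert w S)) (\<lambda>p. cls (ord p)) st nc"
    by (rule classes_cong[OF r(2) eq refl])
  moreover have "marks (Suc i) n i (?e (insert w S)) (\<lambda>p. cls (ord p)) sp nw nc"
    by (rule marks_cong[OF r(3) eq refl])
  ultimately show ?thesis using r by (simp add: in_round_def Let_def)
qed

lemma in_round_step:
  assumes r: "in_round G n i S ord pos cls st sp nw nc" and w: "w < n" "i < pos w" "w \<notin> S"
    and q: "q = st (cls w)"
    and k: "sp (cls w) = Suc i \<and> k = nw (cls w) \<and> st' = st(cls w := Suc q) \<and> nc' = nc \<or>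
      sp (cls w) \<noteq> Suc i \<and> k = nc \<and> st' = st(nc := q, cls w := Suc q) \<and> nc' = Suc nc"
  shows "in_round G n i (insert w S) (ord(pos w := ord q, q := w)) (pos(ord q := pos w, w := q))
     (cls(w := k)) st' (sp(cls w := Suc i)) (nw(cls w := k)) nc'" "cls w < nc" "i < q" "q < n"
proof -
  define p where "p = pos w"
  define e where "e = (\<lambda>p. earlier G ord i (ord p) \<union> (if ord p \<in> S then {i} else {}))"
  define K where "K = (\<lambda>p. cls (ord p))"
  have pm: "perm n ord pos" and c: "classes (Suc i) n e K st nc" and m: "marks (Suc i) n i e K sp nw nc"
    and lex: "lex_upto G n (Suc i) ord"
    using r by (auto simp: in_round_def e_def K_def Let_def)
  have p: "Suc i \<le> p" "p < n" "ord p = w" using pm w by (auto simp: perm_def p_def)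
  have Kp: "K p = cls w" using p by (simp add: K_def)
  have ei: "\<And>p. e p \<subseteq> {..i}" by (auto simp: e_def earlier_def)
  have ip: "i \<notin> e p" using p w by (auto simp: e_def earlier_def)
  note ref = classes_refine[OF c m ei p(1,2) ip, unfolded Kp, OF q k refl refl]
  have qq: "Suc i \<le> q" "q < n" "K q = cls w" "cls w < nc" "q \<le> p"
    using classesD(3)[OF c p(1,2)] p(2) Kp q by auto
  then show "cls w < nc" "i < q" "q < n" by auto
  have epq: "e q = e p" using classesD(2)[OF c, of q p] qq p Kp by auto
  let ?ord = "ord(p := ord q, q := w)" and ?pos = "pos(ord q := p, w := q)" and ?cls = "cls(w := k)"
  let ?e = "\<lambda>z. earlier G ?ord i (?ord z) \<union> (if ?ord z \<in> insert w S then {i} else {})"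
  have ord_i: "?ord h = ord h" if "h \<le> i" for h using that p qq by auto
  then have earlier: "earlier G ?ord h z = earlier G ord h z" if "h \<le> Suc i" for h z
    using that p(1) qq(1) by (auto simp: earlier_def)
  have inj: "ord z = ord z' \<longleftrightarrow> z = z'" if "z < n" "z' < n" for z z' using pm that by (metis perm_def)
  have "?e z = (e(q := insert i (e q))) z \<and> ?cls (?ord z) = (K(q := k)) z" if z: "Suc i \<le> z" "z < n" for z
  proof -
    consider "z = q" | "z \<noteq> q" "z = p" | "z \<noteq> q" "z \<noteq> p" by blast
    then show ?thesis
    proof cases
      case 1
      then show ?thesis using earlier[of i] epq p w by (auto simp: e_def)
    next
      case 2
      then have "ord q \<noteq> w" using inj[of q p] p qq by auto
      moreover have "(earlier G ord i (ord q) \<union> (if ord q \<in> S then {i} else {})) = e p" using epq by (simp add: e_def)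
      ultimately show ?thesis using 2 earlier[of i] qq Kp by (auto simp: K_def)
    next
      case 3
      then have "ord z \<noteq> w" using inj[of z p] p z by auto
      then show ?thesis using 3 earlier[of i] by (auto simp: e_def K_def)
    qed
  qed
  then have eqs: "\<And>z. Suc i \<le> z \<Longrightarrow> z < n \<Longrightarrow> ?e z = (e(q := insert i (e q))) z"
    "\<And>z. Suc i \<le> z \<Longrightarrow> z < n \<Longrightarrow> ?cls (?ord z) = (K(q := k)) z" by blast+
  have "perm n ?ord ?pos" using perm_swap[OF pm p(2) qq(2)] p by simp
  moreover have "lex_upto G n (Suc i) ?ord"
    unfolding lex_upto_def
  proof (intro allI impI)
    fix h z assume h: "h < Suc i" "h < z" "z < n"
    \<comment> \<open>The exchange takes place beyond position \<open>i\<close>, so it permutes the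
      candidates of each past round among themselves.\<close>
    obtain z' where "?ord z = ord z'" "h < z'" "z' < n" using h p qq by (cases "z = q"; cases "z = p") auto
    then show "lexge (earlier G ?ord h (?ord h)) (earlier G ?ord h (?ord z))"
      using lex h ord_i[of h] earlier[of h] by (auto simp: lex_upto_def)
  qed
  ultimately show "in_round G n i (insert w S) (ord(pos w := ord q, q := w)) (pos(ord q := pos w, w := q))
     (cls(w := k)) st' (sp(cls w := Suc i)) (nw(cls w := k)) nc'"
    using classes_cong[OF ref(1) eqs] marks_cong[OF ref(2) eqs] unfolding in_round_def Let_def p_def by blast
qed

text \<open>The computed order has the four-point property by itself, and the diameter argument asks
  for nothing else; no execution \<open>lexbfs\<close> has to be reconstructed.\<close>

lemma before_round_lex_rank:
  assumes b: "before_round G n n ord pos cls st sp nc" and V: "verts G = {0..<n}"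
  shows "lex_rank G pos"
proof -
  have pm: "perm n ord pos" and lex: "lex_upto G n n ord" using b by (auto simp: before_round_def)
  show ?thesis
    unfolding lex_rank_def
  proof (intro conjI ballI impI)
    show "inj_on pos (verts G)" using pm V by (intro inj_on_inverseI[of _ ord]) (auto simp: perm_def)
    fix x y z assume *: "x \<in> verts G" "y \<in> verts G" "z \<in> verts G" "pos z < pos y" "pos y < pos x"
      "adj G z x" "\<not> adj G z y"
    have "lexge (earlier G ord (pos y) (ord (pos y))) (earlier G ord (pos y) (ord (pos x)))"
      using lex[unfolded lex_upto_def, rule_format, of "pos y" "pos x"] * pm V by (auto simp: perm_def)
    moreover have "pos z \<in> earlier G ord (pos y) (ord (pos x)) - earlier G ord (pos y) (ord (pos y))"
      using * pm V by (auto simp: earlier_def perm_def)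
    ultimately obtain d where d: "d \<in> earlier G ord (pos y) (ord (pos y)) - earlier G ord (pos y) (ord (pos x))"
      "d < pos z" unfolding lexge_def by blast
    then show "\<exists>d\<in>verts G. pos d < pos z \<and> adj G d y \<and> \<not> adj G d x"
      using * pm V by (intro bexI[of _ "ord d"]) (auto simp: earlier_def perm_def)
  qed
qed

section \<open>A linear-time program\<close>

definition off :: "nat list list \<Rightarrow> nat \<Rightarrow> nat" where
  "off ls u = Suc (length (concat (map (\<lambda>l. length l # l) (take u ls))))"

lemma off_0 [simp]: "off ls 0 = 1"
  by (simp add: off_def)

lemma off_Suc: "u < length ls \<Longrightarrow> off ls (Suc u) = Suc (off ls u + length (ls ! u))"
  by (simp add: off_def take_Suc_conv_app_nth)

lemma enc_lists_nth:
  assumes "u < length ls"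
  shows "off ls u < length (enc_lists ls)" "enc_lists ls ! off ls u = length (ls ! u)"
    "j < length (ls ! u) \<Longrightarrow> Suc (off ls u + j) < length (enc_lists ls)"
    "j < length (ls ! u) \<Longrightarrow> enc_lists ls ! Suc (off ls u + j) = ls ! u ! j"
proof -
  let ?f = "\<lambda>l. length l # l"
  let ?pre = "length ls # concat (map ?f (take u ls))" and ?post = "concat (map ?f (drop (Suc u) ls))"
  have "concat (map ?f ls) = concat (map ?f (take u ls @ ls ! u # drop (Suc u) ls))"
    using assms by (simp add: id_take_nth_drop[symmetric])
  then have e: "enc_lists ls = ?pre @ (length (ls ! u) # ls ! u) @ ?post" by (simp add: enc_lists_def)
  have o: "off ls u = length ?pre" by (simp add: off_def)
  show "off ls u < length (enc_lists ls)" "enc_lists ls ! off ls u = length (ls ! u)"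
    unfolding e o by (simp, subst nth_append_length_plus[of _ _ 0, simplified], simp)
  assume "j < length (ls ! u)"
  then show "Suc (off ls u + j) < length (enc_lists ls)" "enc_lists ls ! Suc (off ls u + j) = ls ! u ! j"
    unfolding e o add_Suc_right[symmetric] by (simp, subst nth_append_length_plus, simp add: nth_append)
qed

lemma enc_lists_0: "enc_lists ls ! 0 = length ls" "0 < length (enc_lists ls)"
  by (simp_all add: enc_lists_def)

abbreviation Succ :: "exp \<Rightarrow> exp" where "Succ e \<equiv> Op Add e (Const 1)"

text \<open>The pointer in array \<open>a + 9\<close> moves by unit steps because
  \<open>slow\<close> admits sums with constants only; the total stays linear. It stops one cell
  past the encoding and so also reveals where the input ends.\<close>

definition offsets_prog :: "nat \<Rightarrow> nat \<Rightarrow> com" where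
  "offsets_prog a b = Seq (Set (a + 9) (Const (Suc b)))
     (For (a + 10) (Load 0 (Const b)) (Seq (Store (a + 1) (V (a + 10)) (V (a + 9))) (Seq (Inc (a + 9))
        (For (a + 11) (Load 0 (Load (a + 1) (V (a + 10)))) (Inc (a + 9))))))"

lemma offsets_prog:
  fixes s :: memory
  assumes s: "\<And>x. x < length (enc_lists ls) \<Longrightarrow> s 0 (b + x) = enc_lists ls ! x"
    and Q: "\<And>T' s'. \<forall>u<length ls. s' (a + 1) u = b + off ls u \<Longrightarrow> s' (a + 9) 0 = b + off ls (length ls) \<Longrightarrow>
      (\<And>c. c \<notin> {a + 1, a + 9, a + 10, a + 11} \<Longrightarrow> s' c = s c) \<Longrightarrow>
      T' \<le> T + 3 + (\<Sum>u<length ls. 10 + 3 * length (ls ! u)) \<Longrightarrow> Q T' s'"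
  shows "wp (offsets_prog a b) Q T s"
proof -
  have s_deg: "s 0 (b + off ls u) = length (ls ! u)" if "u < length ls" for u
    using s enc_lists_nth[OF that] by simp
  have s_len: "s 0 b = length ls" using s[of 0] enc_lists_0[of ls] by simp
  let ?I = "\<lambda>i T' (s' :: memory). (\<forall>u<i. s' (a + 1) u = b + off ls u) \<and> s' (a + 9) 0 = b + off ls i \<and>
      (\<forall>c. c \<notin> {a + 1, a + 9, a + 10, a + 11} \<longrightarrow> s' c = s c) \<and>
      T' \<le> T + 2 + (\<Sum>u<i. 10 + 3 * length (ls ! u))"
  show ?thesis
    unfolding offsets_prog_def
  proof (intro wp_Seq wp_Store, rule wp_For[where N = "length ls" and I = ?I])
    fix i T1 s1
    assume I: "?I i T1 s1" and i: "s1 (a + 10) 0 = i" "i < length ls"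
    show "wp (Seq (Store (a + 1) (V (a + 10)) (V (a + 9))) (Seq (Inc (a + 9))
        (For (a + 11) (Load 0 (Load (a + 1) (V (a + 10)))) (Inc (a + 9)))))
      (\<lambda>T' s'. s' (a + 10) 0 = i \<and> ?I (Suc i) (Suc T') (s'(a + 10 := (s' (a + 10))(0 := Suc i)))) (Suc T1) s1"
      by (intro wp_Seq wp_Store, rule wp_For[where N = "length (ls ! i)" and
        I = "\<lambda>j T' s'. (\<forall>u\<le>i. s' (a + 1) u = b + off ls u) \<and> s' (a + 9) 0 = Suc (b + off ls i + j) \<and>
        s' (a + 10) 0 = i \<and> (\<forall>c. c \<notin> {a + 1, a + 9, a + 10, a + 11} \<longrightarrow> s' c = s c) \<and> T' \<le> T1 + 4 + 3 * j"])
        (use I i s_deg in \<open>auto simp: off_Suc less_Suc_eq_le intro!: wp_Store\<close>)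
  qed (use Q s_len in auto)
qed

text \<open>Arrays 2 to 7 hold \<open>ord\<close>, \<open>pos\<close>, \<open>cls\<close>,
  \<open>st\<close>, \<open>sp\<close>, \<open>nw\<close> of \<open>in_round\<close>. The scalars 10
  to 18 are the round, the index in the adjacency list, \<open>nc\<close>, the pivot, its neighbour
  \<open>w\<close>, the class of \<open>w\<close>, the front \<open>q\<close> of this class, the
  vertex at \<open>q\<close> and the position of \<open>w\<close>.\<close>

definition visit_prog :: com where
  "visit_prog = Seq (Set 14 (Load 0 (Op Add (Load 1 (V 13)) (Succ (V 11)))))
     (If (Op Less (V 10) (Load 3 (V 14)))
       (Seq (Set 15 (Load 4 (V 14)))
       (Seq (If (Op Less (Load 6 (V 15)) (Succ (V 10)))
              (Seq (Store 6 (V 15) (Succ (V 10)))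
              (Seq (Store 7 (V 15) (V 12))
              (Seq (Store 5 (V 12) (Load 5 (V 15)))
                   (Inc 12)))) Skip)
       (Seq (Set 16 (Load 5 (V 15)))
       (Seq (Set 17 (Load 2 (V 16)))
       (Seq (Set 18 (Load 3 (V 14)))
       (Seq (Store 2 (V 18) (V 17))
       (Seq (Store 3 (V 17) (V 18))
       (Seq (Store 2 (V 16) (V 14))
       (Seq (Store 3 (V 14) (V 16))
       (Seq (Store 5 (V 15) (Succ (V 16)))
            (Store 4 (V 14) (Load 7 (V 15))))))))))))) Skip)"

definition round_prog :: com where
  "round_prog = Seq (Set 13 (Load 2 (V 10)))
    (Seq (Store 5 (Load 4 (V 13)) (Succ (V 10)))
         (For 11 (Load 0 (Load 1 (V 13))) visit_prog))"

definition lexbfs_prog :: com where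
  "lexbfs_prog =
     Seq (For 10 (V 0) (Seq (Store 2 (V 10) (V 10)) (Store 3 (V 10) (V 10))))
    (Seq (Set 12 (Const 1)) (For 10 (V 0) round_prog))"

text \<open>Array 8 stores the distance plus one, and 0 for unmarked vertices. Scan \<open>r\<close>
  writes r + 2 and expands only marks below r + 2, so a vertex found during a scan is not expanded
  in the same scan.\<close>

definition mark_prog :: com where
  "mark_prog = Seq (Set 14 (Load 0 (Op Add (Load 1 (V 10)) (Succ (V 11)))))
     (If (Op Less (Load 8 (V 14)) (Const 1))
       (Store 8 (V 14) (Op Add (V 19) (Const 2))) Skip)"

definition ball_prog :: com where
  "ball_prog =
     For 10 (V 0)
       (If (Op Less (Const 0) (Load 8 (V 10)))
         (If (Op Less (Load 8 (V 10)) (Op Add (V 19) (Const 2)))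
           (For 11 (Load 0 (Load 1 (V 10))) mark_prog) Skip) Skip)"

definition answer_prog :: com where
  "answer_prog = Seq (Set 20 (Const 0))
    (Seq (For 10 (V 0) (If (Op Less (Load 8 (V 10)) (Const 1)) (Set 20 (Const 1)) Skip))
         (Store 0 (Const 0) (V 20)))"

text \<open>One LexBFS is enough because 3 = 2 * 1 + 1 is an odd radius. As the radius is fixed,
  three scans over all adjacency lists can replace a queue.\<close>

definition diam_prog :: com where
  "diam_prog =
     Seq (offsets_prog 0 0)
    (Seq lexbfs_prog
    (Seq (Store 8 (Load 2 (Op Sub (V 0) (Const 1))) (Const 1))
    (Seq (For 19 (Const 3) ball_prog) answer_prog)))"

lemma tame_diam_prog: "tame 10 diam_prog"
  by (simp add: diam_prog_def answer_prog_def ball_prog_def mark_prog_def lexbfs_prog_def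
      round_prog_def visit_prog_def offsets_prog_def)

section \<open>Correctness and running time of the linear-time program\<close>

locale graph_input =
  fixes G :: "nat ugraph" and L :: "nat list list"
  assumes conn: "connected_graph G" and adjL: "adj_lists G L"
begin

definition n :: nat where "n = length L"

definition inp :: "nat \<Rightarrow> nat" where "inp = init_memory (enc_lists L) 0"

definition dg :: "nat \<Rightarrow> nat" where "dg u = length (L ! u)"

lemma V: "verts G = {0..<n}" and simple: "simple_graph G" and n_pos: "0 < n"
  using adjL conn by (auto simp: adj_lists_def n_def connected_graph_def)

lemma nbrs: "u < n \<Longrightarrow> set (L ! u) = {w. adj G u w}" "u < n \<Longrightarrow> distinct (L ! u)"
  using adjL by (auto simp: adj_lists_def n_def)

lemma nbr_less: "u < n \<Longrightarrow> j < dg u \<Longrightarrow> L ! u ! j < n"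
  using nbrs[of u] nth_mem[of j "L ! u"] adj_verts[OF simple, of u "L ! u ! j"] V by (auto simp: dg_def)

lemma inp: "inp 0 = n" "u < n \<Longrightarrow> inp (off L u) = dg u"
  "u < n \<Longrightarrow> j < dg u \<Longrightarrow> inp (Suc (off L u + j)) = L ! u ! j"
  using enc_lists_nth[of u L] enc_lists_0[of L] by (auto simp: inp_def init_memory_def dg_def n_def)

text \<open>Ordered adjacent pairs map to edges with fibres of at most two elements.\<close>

lemma sum_dg: "(\<Sum>u<n. dg u) \<le> 2 * card (edges G)"
proof -
  let ?A = "SIGMA u:{..<n}. {w. adj G u w}"
  have sub: "edges G \<subseteq> Pow (verts G)" using simple by (auto simp: simple_graph_def)
  have fin: "finite (edges G)" using finite_subset[OF sub] V by simp
  have "(\<Sum>u<n. dg u) = (\<Sum>u<n. card {w. adj G u w})"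
    using nbrs distinct_card by (intro sum.cong) (force simp: dg_def)+
  also have "... = card ?A"
  proof (subst card_SigmaI)
    show "\<forall>u\<in>{..<n}. finite {w. adj G u w}" using nbrs by (metis List.finite_set lessThan_iff)
  qed auto
  also have "... \<le> card (\<Union>e\<in>edges G. {(u, w). {u, w} = e})"
  proof (rule card_mono)
    have "(\<Union>e\<in>edges G. {(u, w). {u, w} = e}) \<subseteq> verts G \<times> verts G" using sub by blast
    then show "finite (\<Union>e\<in>edges G. {(u, w). {u, w} = e})"
      by (rule finite_subset) (simp add: V)
  qed (auto simp: adj_def)
  also have "... \<le> (\<Sum>e\<in>edges G. card {(u, w). {u, w} = e})" by (rule card_UN_le[OF fin])
  also have "... \<le> (\<Sum>e\<in>edges G. 2)"
  proof (rule sum_mono)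
    fix e assume "e \<in> edges G"
    then obtain a b where "e = {a, b}" using simple by (auto simp: simple_graph_def)
    then have "{(u, w). {u, w} = e} \<subseteq> {(a, b), (b, a)}" by (auto simp: doubleton_eq_iff)
    from card_mono[OF _ this] have "card {(u, w). {u, w} = e} \<le> card {(a, b), (b, a)}" by simp
    then show "card {(u, w). {u, w} = e} \<le> 2" by (simp add: card_insert_if split: if_splits)
  qed
  finally show ?thesis by simp
qed

abbreviation loaded :: "memory \<Rightarrow> bool" where
  "loaded s \<equiv> s 0 = inp \<and> (\<forall>u<n. s 1 u = off L u)"

text \<open>\<open>ord0\<close> is the order at the start of the round. Its entries up to the pivot
  are final, which keeps the time charged to the visited vertices unchanged when later positions are
  exchanged.\<close>

definition in_visit :: "(nat \<Rightarrow> nat) \<Rightarrow> nat \<Rightarrow> nat set \<Rightarrow> memory \<Rightarrow> bool" where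
  "in_visit ord0 i S s \<longleftrightarrow> loaded s \<and> s 8 = (\<lambda>_. 0) \<and> s 10 0 = i \<and> s 13 0 = s 2 i \<and> (\<forall>h\<le>i. s 2 h = ord0 h) \<and>
     in_round G n i S (s 2) (s 3) (s 4) (s 5) (s 6) (s 7) (s 12 0)"

lemma visit_prog:
  assumes I: "in_visit ord0 i (set (take j (L ! v))) s" and i: "i < n" "s 13 0 = v" "v < n"
    and j: "s 11 0 = j" "j < dg v"
  shows "wp visit_prog (\<lambda>T' s'. s' 11 0 = j \<and> s' 13 0 = v \<and> in_visit ord0 i (set (take (Suc j) (L ! v))) s' \<and> T' \<le> T + 20) T s"
proof -
  define w where "w = L ! v ! j"
  have w: "w < n" using nbr_less[OF i(3) j(2)] by (simp add: w_def)
  have S: "set (take (Suc j) (L ! v)) = insert w (set (take j (L ! v)))"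
    using j by (simp add: take_Suc_conv_app_nth dg_def w_def)
  have wS: "w \<notin> set (take j (L ! v))"
  proof
    assume "w \<in> set (take j (L ! v))"
    then obtain j' where "j' < j" "L ! v ! j' = w" using j by (auto simp: in_set_conv_nth dg_def)
    then show False using nbrs(2)[OF i(3)] j by (auto simp: w_def dg_def nth_eq_iff_index_eq)
  qed
  have r: "in_round G n i (set (take j (L ! v))) (s 2) (s 3) (s 4) (s 5) (s 6) (s 7) (s 12 0)"
    and s: "s 0 = inp" "\<And>u. u < n \<Longrightarrow> s 1 u = off L u" "s 8 = (\<lambda>_. 0)" "s 10 0 = i" "s 2 i = v"
      "\<And>h. h \<le> i \<Longrightarrow> s 2 h = ord0 h"
    using I i by (auto simp: in_visit_def)
  have sw: "s 0 (s 1 (s 13 0) + Suc (s 11 0)) = w" using s i j by (simp add: inp w_def)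
  have sp: "s 6 c \<le> Suc i" for c using r by (auto simp: in_round_def marks_def Let_def)
  show ?thesis
  proof (cases "i < s 3 w")
    case False
    have "in_visit ord0 i (insert w (set (take j (L ! v)))) (s(14 := (s 14)(0 := w)))"
      using I in_round_visited[OF r w] False by (simp add: in_visit_def)
    then show ?thesis
      unfolding visit_prog_def S using False i j s(1,2,4) sw by (simp add: wp_simps)
  next
    case iw: True
    define q where "q = s 5 (s 4 w)"
    note step = in_round_step[OF r w iw wS q_def]
    have perm: "s 2 (s 3 w) = w" "s 3 w < n" using r w by (auto simp: in_round_def perm_def)
    show ?thesis
    proof (cases "s 6 (s 4 w) = Suc i")
      case True
      have "in_round G n i (insert w (set (take j (L ! v)))) ((s 2)(s 3 w := s 2 q, q := w))
        ((s 3)(s 2 q := s 3 w, w := q)) ((s 4)(w := s 7 (s 4 w))) ((s 5)(s 4 w := Suc q))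
        ((s 6)(s 4 w := Suc i)) ((s 7)(s 4 w := s 7 (s 4 w))) (s 12 0)" and q: "i < q"
        using step[of "s 7 (s 4 w)" "(s 5)(s 4 w := Suc q)" "s 12 0"] True by auto
      \<comment> \<open>\<open>in_round_step\<close> updates \<open>sp\<close> and \<open>nw\<close>
        in either case; for a class already split these updates change nothing, in accordance with
        the skipped branch.\<close>
      moreover have "(s 6)(s 4 w := Suc i) = s 6" "(s 7)(s 4 w := s 7 (s 4 w)) = s 7" using True by auto
      ultimately have r': "in_round G n i (insert w (set (take j (L ! v)))) ((s 2)(s 3 w := s 2 q, q := w))
        ((s 3)(s 2 q := s 3 w, w := q)) ((s 4)(w := s 7 (s 4 w))) ((s 5)(s 4 w := Suc q))
        (s 6) (s 7) (s 12 0)" by simp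
      show ?thesis
        unfolding visit_prog_def S using True iw i j s sw r' q by (simp add: wp_simps in_visit_def q_def[symmetric])
    next
      case False
      have c: "s 4 w < s 12 0" "i < q"
        and r': "in_round G n i (insert w (set (take j (L ! v)))) ((s 2)(s 3 w := s 2 q, q := w))
        ((s 3)(s 2 q := s 3 w, w := q)) ((s 4)(w := s 12 0)) ((s 5)(s 12 0 := q, s 4 w := Suc q))
        ((s 6)(s 4 w := Suc i)) ((s 7)(s 4 w := s 12 0)) (Suc (s 12 0))"
        using step[of "s 12 0" "(s 5)(s 12 0 := q, s 4 w := Suc q)" "Suc (s 12 0)"] False by auto
      have lt: "s 6 (s 4 w) < Suc i" using sp[of "s 4 w"] False by simp
      show ?thesis
        unfolding visit_prog_def S using lt iw i j s sw r' c by (simp add: wp_simps in_visit_def q_def[symmetric])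
    qed
  qed
qed

definition at_round :: "nat \<Rightarrow> memory \<Rightarrow> bool" where
  "at_round i s \<longleftrightarrow> loaded s \<and> s 8 = (\<lambda>_. 0) \<and>
     before_round G n i (s 2) (s 3) (s 4) (s 5) (s 6) (s 12 0)"

lemma lexbfs_prog:
  assumes s: "loaded s" "\<And>a. a \<in> {4, 5, 6, 8} \<Longrightarrow> s a = (\<lambda>_. 0)"
    and Q: "\<And>T' s'. at_round n s' \<Longrightarrow> T' \<le> T + 10 + (\<Sum>u<n. 20 + 30 * dg u) \<Longrightarrow> Q T' s'"
  shows "wp lexbfs_prog Q T s"
  unfolding lexbfs_prog_def
proof (rule wp_Seq, rule wp_For[where N = n and I = "\<lambda>i T' s'. loaded s' \<and> (\<forall>u<i. s' 2 u = u \<and> s' 3 u = u) \<and>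
     s' 4 = (\<lambda>_. 0) \<and> s' 5 = (\<lambda>_. 0) \<and> s' 6 = (\<lambda>_. 0) \<and> s' 8 = (\<lambda>_. 0) \<and> T' \<le> T + 1 + 4 * i"])
  fix T1 s1
  assume I: "loaded s1 \<and> (\<forall>u<n. s1 2 u = u \<and> s1 3 u = u) \<and>
     s1 4 = (\<lambda>_. 0) \<and> s1 5 = (\<lambda>_. 0) \<and> s1 6 = (\<lambda>_. 0) \<and> s1 8 = (\<lambda>_. 0) \<and> T1 \<le> T + 1 + 4 * n"
  then have z: "loaded s1" "s1 4 = (\<lambda>_. 0)" "s1 5 = (\<lambda>_. 0)" "s1 6 = (\<lambda>_. 0)" "s1 8 = (\<lambda>_. 0)"
    by blast+
  have "perm n (s1 2) (s1 3)" using I by (simp add: perm_def)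
  then have "before_round G n 0 (s1 2) (s1 3) (s1 4) (s1 5) (s1 6) (Suc 0)"
    unfolding z by (rule before_round_0)
  then have start: "at_round 0 (s1(12 := (s1 12)(0 := Suc 0), 10 := (s1 10)(0 := 0)))"
    unfolding at_round_def using z(1,5) by simp
  show "wp (Seq (Set 12 (Const 1)) (For 10 (V 0) round_prog)) Q (Suc T1) s1"
  proof (intro wp_Seq wp_Store, rule wp_For[where N = n and
      I = "\<lambda>i T' s'. at_round i s' \<and> T' \<le> T1 + 5 + (\<Sum>h<i. 10 + 30 * dg (s' 2 h))"])
    fix i T2 s2
    assume I2: "at_round i s2 \<and> T2 \<le> T1 + 5 + (\<Sum>h<i. 10 + 30 * dg (s2 2 h))"
      and i: "s2 10 0 = i" "i < n"
    define v where "v = s2 2 i"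
    have b: "before_round G n i (s2 2) (s2 3) (s2 4) (s2 5) (s2 6) (s2 12 0)"
      and l: "loaded s2" "s2 8 = (\<lambda>_. 0)" using I2 unfolding at_round_def by blast+
    have v: "v < n" using b i(2) unfolding before_round_def perm_def v_def by blast
    show "wp round_prog
      (\<lambda>T' s'. s' 10 0 = i \<and> at_round (Suc i) (s'(10 := (s' 10)(0 := Suc i))) \<and>
        Suc T' \<le> T1 + 5 + (\<Sum>h<Suc i. 10 + 30 * dg ((s'(10 := (s' 10)(0 := Suc i))) 2 h))) (Suc T2) s2"
      unfolding round_prog_def
    proof (intro wp_Seq wp_Store, rule wp_For[where N = "dg v" and
        I = "\<lambda>j T' s'. in_visit (s2 2) i (set (take j (L ! v))) s' \<and> s' 13 0 = v \<and> T' \<le> T2 + 4 + 22 * j"])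
      fix j T3 s3
      assume "in_visit (s2 2) i (set (take j (L ! v))) s3 \<and> s3 13 0 = v \<and> T3 \<le> T2 + 4 + 22 * j"
        "s3 11 0 = j" "j < dg v"
      then show "wp visit_prog (\<lambda>T' s'. s' 11 0 = j \<and>
         in_visit (s2 2) i (set (take (Suc j) (L ! v))) (s'(11 := (s' 11)(0 := Suc j))) \<and>
         (s'(11 := (s' 11)(0 := Suc j))) 13 0 = v \<and> Suc T' \<le> T2 + 4 + 22 * Suc j) (Suc T3) s3"
        by (intro wp_mono[OF visit_prog[of "s2 2" i j v s3 "Suc T3"]]) (use i v v_def in \<open>simp_all add: in_visit_def\<close>)
    next
      fix T3 s3
      assume I3: "in_visit (s2 2) i (set (take (dg v) (L ! v))) s3 \<and> s3 13 0 = v \<and> T3 \<le> T2 + 4 + 22 * dg v"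
      then have v3: "s3 2 i = v" unfolding in_visit_def by metis
      have "in_round G n i (set (take (dg v) (L ! v))) (s3 2) (s3 3) (s3 4) (s3 5) (s3 6) (s3 7) (s3 12 0)"
        using I3 unfolding in_visit_def by blast
      then have "in_round G n i {w. adj G (s3 2 i) w} (s3 2) (s3 3) (s3 4) (s3 5) (s3 6) (s3 7) (s3 12 0)"
        using nbrs(1)[OF v] unfolding v3 dg_def by simp
      from in_round_end[OF this]
      have "at_round (Suc i) s3" using I3 unfolding in_visit_def at_round_def by blast
      moreover have "(\<Sum>h<Suc i. 10 + 30 * dg (s3 2 h)) = (\<Sum>h<Suc i. 10 + 30 * dg (s2 2 h))"
        by (rule sum.cong[OF refl]) (use I3 in \<open>simp add: in_visit_def\<close>)
      ultimately show "s3 10 0 = i \<and> at_round (Suc i) (s3(10 := (s3 10)(0 := Suc i))) \<and>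
        Suc (Suc T3) \<le> T1 + 5 + (\<Sum>h<Suc i. 10 + 30 * dg ((s3(10 := (s3 10)(0 := Suc i))) 2 h))"
        using I2 I3 by (simp add: in_visit_def at_round_def v_def)
    qed (use in_round_start[OF b i(2)] l i v in \<open>simp_all add: in_visit_def v_def inp\<close>)
  next
    fix T2 s2
    assume I2: "at_round n s2 \<and> T2 \<le> T1 + 5 + (\<Sum>h<n. 10 + 30 * dg (s2 2 h))"
    then have pm: "perm n (s2 2) (s2 3)" by (simp add: at_round_def before_round_def)
    \<comment> \<open>The time was charged to the vertices in visiting order, and each is visited
      exactly once.\<close>
    have "(\<Sum>h<n. 10 + 30 * dg (s2 2 h)) = (\<Sum>u<n. 10 + 30 * dg u)"
      by (rule sum.reindex_bij_witness[of _ "s2 3" "s2 2"]) (use pm in \<open>auto simp: perm_def\<close>)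
    then show "Q (Suc T2) s2" using I I2 by (intro Q) (simp_all add: sum.distrib)
  qed (use start inp(1) in \<open>simp_all add: at_round_def\<close>)
qed (use s inp(1) in \<open>simp_all add: less_Suc_eq wp_simps\<close>)


definition balls :: "nat \<Rightarrow> nat \<Rightarrow> memory \<Rightarrow> bool" where
  "balls v r s \<longleftrightarrow> loaded s \<and> (\<forall>u<n. (s 8 u \<noteq> 0 \<longleftrightarrow> u \<in> nball G r v) \<and> s 8 u \<le> Suc r)"

lemma ball_prog:
  assumes s: "balls v r s" "s 19 0 = r" and v: "v < n"
  shows "wp ball_prog (\<lambda>T' s'. s' 19 0 = r \<and> balls v (Suc r) s' \<and> T' \<le> T + 2 + (\<Sum>u<n. 10 + 10 * dg u)) T s"
proof -
  \<comment> \<open>The marked vertices when the lists of all vertices below \<open>i\<close> and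
    the first \<open>j\<close> entries of the list of \<open>i\<close> have been scanned. In
    \<open>J\<close> the threshold \<open>Suc r\<close> separates the old marks, which may be
    expanded, from the new ones.\<close>
  define U where "U i j = nball G r v \<union> {w. \<exists>u<i. u \<in> nball G r v \<and> adj G u w} \<union>
    (if i \<in> nball G r v then set (take j (L ! i)) else {})" for i j
  define J where "J i j s' \<longleftrightarrow> loaded s' \<and> s' 19 0 = r \<and>
    (\<forall>u<n. (s' 8 u \<noteq> 0 \<longleftrightarrow> u \<in> U i j) \<and> (s' 8 u \<noteq> 0 \<and> s' 8 u \<le> Suc r \<longleftrightarrow> u \<in> nball G r v) \<and> s' 8 u \<le> r + 2)"
    for i j and s' :: memory
  have J_upd: "J i j (s'(a := f)) \<longleftrightarrow> J i j s'" if "a \<notin> {0, 1, 8, 19}" for i j s' a f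
    using that unfolding J_def by simp
  have J_eq: "U i j = U i' j' \<Longrightarrow> J i j s' \<longleftrightarrow> J i' j' s'" for i j i' j' s'
    by (simp only: J_def)
  have U0: "U 0 0 = nball G r v" by (simp add: U_def)
  have US: "U (Suc i) 0 = (if i \<in> nball G r v then U i (dg i) else U i 0)" if "i < n" for i
    using nbrs(1)[OF that] by (auto simp: U_def dg_def less_Suc_eq)
  have Un: "U n 0 = nball G (Suc r) v"
  proof -
    have "nball G r v \<subseteq> {..<n}" using nball_verts[OF simple, of v r] V v by auto
    then show ?thesis by (auto simp: U_def nball.simps(2))
  qed
  have Uj: "U i (Suc j) = insert (L ! i ! j) (U i j)" if "i < n" "i \<in> nball G r v" "j < dg i" for i j
    using that by (auto simp: U_def take_Suc_conv_app_nth dg_def)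
  let ?I = "\<lambda>i T' s'. J i 0 s' \<and> T' \<le> T + 1 + (\<Sum>u<i. 10 + 10 * dg u)"
  show ?thesis
    unfolding ball_prog_def
  proof (rule wp_For[where N = n and I = ?I])
    show "?I 0 (Suc T) (s(10 := (s 10)(0 := 0)))"
      using s unfolding J_def U0 balls_def by (auto simp: le_Suc_eq)
    fix i T1 s1
    assume I: "?I i T1 s1" and i: "s1 10 0 = i" "i < n"
    have l: "s1 0 = inp" "s1 1 i = off L i" "s1 19 0 = r" using I i by (auto simp: J_def)
    have mem: "0 < s1 8 i \<and> s1 8 i < r + 2 \<longleftrightarrow> i \<in> nball G r v" using I i(2) by (auto simp: J_def)
    let ?Q = "\<lambda>T' s'. s' 10 0 = i \<and> ?I (Suc i) (Suc T') (s'(10 := (s' 10)(0 := Suc i)))"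
    let ?loop = "For 11 (Load 0 (Load 1 (V 10))) mark_prog"
    show "wp (If (Op Less (Const 0) (Load 8 (V 10)))
         (If (Op Less (Load 8 (V 10)) (Op Add (V 19) (Const 2))) ?loop Skip) Skip) ?Q (Suc T1) s1"
    proof (cases "i \<in> nball G r v")
      case False
      then have eq: "U (Suc i) 0 = U i 0" using US[OF i(2)] by simp
      have "J (Suc i) 0 s1" using I unfolding J_def eq by blast
      then show ?thesis using False I i l mem by (auto simp: wp_simps J_def)
    next
      case True
      have "wp ?loop ?Q (Suc (Suc (Suc T1))) s1"
      proof (rule wp_For[where N = "dg i" and
          I = "\<lambda>j T' s'. J i j s' \<and> s' 10 0 = i \<and> T' \<le> T1 + 4 + 7 * j"])
        fix j T2 s2
        assume J: "J i j s2 \<and> s2 10 0 = i \<and> T2 \<le> T1 + 4 + 7 * j" and j: "s2 11 0 = j" "j < dg i"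
        define w where "w = L ! i ! j"
        have w: "w < n" using nbr_less[OF i(2) j(2)] by (simp add: w_def)
        have l2: "s2 0 (s2 1 (s2 10 0) + Suc (s2 11 0)) = w"
          using J j i by (simp add: J_def inp w_def)
        have Jw: "s2 8 w \<noteq> 0 \<longleftrightarrow> w \<in> U i j" "\<And>u. u < n \<Longrightarrow> s2 8 u \<noteq> 0 \<longleftrightarrow> u \<in> U i j"
          "\<And>u. u < n \<Longrightarrow> s2 8 u \<noteq> 0 \<and> s2 8 u \<le> Suc r \<longleftrightarrow> u \<in> nball G r v"
          "\<And>u. u < n \<Longrightarrow> s2 8 u \<le> r + 2" "loaded s2" "s2 19 0 = r"
          using J w unfolding J_def by blast+
        have new: "J i (Suc j) (s2(14 := (s2 14)(0 := w), 8 := (s2 8)(w := r + 2), 11 := (s2 11)(0 := Suc j)))"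
          if "s2 8 w = 0"
          unfolding J_def Uj[OF i(2) True j(2)] w_def[symmetric]
          using Jw(2,4,5,6) Jw(3)[of w] Jw(3) that w by (auto simp del: not_gr_zero)
        have old: "J i (Suc j) (s2(14 := (s2 14)(0 := w), 11 := (s2 11)(0 := Suc j)))" if "s2 8 w \<noteq> 0"
        proof -
          have "insert w (U i j) = U i j" using Jw(1) that by blast
          then have eq: "U i (Suc j) = U i j" using Uj[OF i(2) True j(2)] by (simp add: w_def)
          have "J i (Suc j) s2" using J J_eq[OF eq] by simp
          then show ?thesis by (simp add: J_upd)
        qed
        show "wp mark_prog (\<lambda>T' s'. s' 11 0 = j \<and> J i (Suc j) (s'(11 := (s' 11)(0 := Suc j))) \<and>
              (s'(11 := (s' 11)(0 := Suc j))) 10 0 = i \<and> Suc T' \<le> T1 + 4 + 7 * Suc j) (Suc T2) s2"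
          using J j l2 new old Jw(6) by (simp add: mark_prog_def wp_simps)
      next
        fix T2 s2
        assume "J i (dg i) s2 \<and> s2 10 0 = i \<and> T2 \<le> T1 + 4 + 7 * dg i"
        moreover from this have "J (Suc i) 0 s2" using J_eq[of "Suc i" 0 i "dg i"] US[OF i(2)] True by simp
        ultimately show "?Q (Suc T2) s2" using I by (simp add: J_upd)
      qed (use I i True in \<open>simp_all add: J_upd\<close>, simp_all add: J_def inp)
      then show ?thesis using True mem i l by (simp add: wp_simps)
    qed
  next
    fix T1 s1
    assume "?I n T1 s1"
    then show "s1 19 0 = r \<and> balls v (Suc r) s1 \<and> Suc T1 \<le> T + 2 + (\<Sum>u<n. 10 + 10 * dg u)"
      unfolding J_def Un balls_def by simp
  qed (simp add: J_def inp)
qed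

lemma diam_prog:
  assumes ch: "chordal G"
  shows "wp diam_prog (\<lambda>T s. T \<le> 200 * (n + card (edges G)) \<and> (s 0 0 \<noteq> 0 \<longleftrightarrow> diam G \<ge> 4)) 0
    (init_memory (enc_lists L))" (is "wp _ ?Q 0 _")
proof -
  let ?s = "init_memory (enc_lists L)"
  have s0: "?s 0 = inp" "\<And>a. a \<noteq> 0 \<Longrightarrow> ?s a = (\<lambda>_. 0)" by (simp_all add: inp_def init_memory_def fun_eq_iff)
  have time: "(\<Sum>u<n. a + b * dg u) \<le> a * n + 2 * b * card (edges G)" for a b
  proof -
    have "(\<Sum>u<n. a + b * dg u) = a * n + b * (\<Sum>u<n. dg u)" by (simp add: sum.distrib sum_distrib_left)
    then show ?thesis using mult_le_mono2[OF sum_dg, of b] by simp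
  qed
  show ?thesis
    unfolding diam_prog_def
  proof (rule wp_Seq, rule offsets_prog[where ls = L], goal_cases)
    case (1 x)
    then show ?case by (simp add: init_memory_def)
  next
    case (2 T1 s1)
    then have A1: "loaded s1" "\<And>a. a \<notin> {1, 9, 10, 11} \<Longrightarrow> s1 a = ?s a"
      "T1 \<le> 0 + 3 + (\<Sum>u<n. 10 + 3 * dg u)"
      using s0(1) by (simp_all add: n_def dg_def)
    show ?case
  proof (rule wp_Seq, rule lexbfs_prog)
    show "loaded s1" by (rule A1(1))
    show "s1 a = (\<lambda>_. 0)" if "a \<in> {4, 5, 6, 8}" for a using A1(2)[of a] s0(2)[of a] that by auto
    fix T2 s2 assume A2: "at_round n s2" "T2 \<le> T1 + 10 + (\<Sum>u<n. 20 + 30 * dg u)"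
    define v where "v = s2 2 (n - 1)"
    have b: "before_round G n n (s2 2) (s2 3) (s2 4) (s2 5) (s2 6) (s2 12 0)"
      and l2: "loaded s2" "s2 8 = (\<lambda>_. 0)" using A2 unfolding at_round_def by blast+
    have r: "lex_rank G (s2 3)" by (rule before_round_lex_rank[OF b V])
    have pm: "perm n (s2 2) (s2 3)" using b by (simp add: before_round_def)
    then have v: "v < n" "s2 3 v = n - 1" using n_pos by (simp_all add: perm_def v_def)
    have last: "\<forall>z\<in>verts G. s2 3 z \<le> s2 3 v" using pm V v by (auto simp: perm_def)
    let ?s3 = "s2(8 := (s2 8)(v := 1))"
    have b3: "balls v 0 ?s3" using l2 by (simp add: balls_def)
    have diam: "diam G \<ge> 4 \<longleftrightarrow> \<not> verts G \<subseteq> nball G 3 v"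
    proof
      assume "diam G \<ge> 4"
      then show "\<not> verts G \<subseteq> nball G 3 v"
        using lex_rank_diam_le[OF conn ch r _ last, of 1] v V by auto
    next
      assume "\<not> verts G \<subseteq> nball G 3 v"
      then show "diam G \<ge> 4" using diam_le_iff[OF conn, of 3] v V by fastforce
    qed
    show "wp (Seq (Store 8 (Load 2 (Op Sub (V 0) (Const 1))) (Const 1))
      (Seq (For 19 (Const 3) ball_prog) answer_prog)) ?Q T2 s2"
    proof (rule wp_Seq, rule wp_Store, rule wp_Seq, rule wp_For[where N = 3 and
        I = "\<lambda>r T' s'. balls v r s' \<and> T' \<le> T2 + 2 + r * (5 + (\<Sum>u<n. 10 + 10 * dg u))"])
      fix r T3 s3
      assume "balls v r s3 \<and> T3 \<le> T2 + 2 + r * (5 + (\<Sum>u<n. 10 + 10 * dg u))" "s3 19 0 = r"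
      then show "wp ball_prog (\<lambda>T' s'. s' 19 0 = r \<and> balls v (Suc r) (s'(19 := (s' 19)(0 := Suc r))) \<and>
          Suc T' \<le> T2 + 2 + Suc r * (5 + (\<Sum>u<n. 10 + 10 * dg u))) (Suc T3) s3"
        by (intro wp_mono[OF ball_prog[OF _ _ v(1), of r s3 "Suc T3"]]) (auto simp: balls_def)
    next
      fix T3 s3
      assume A3: "balls v 3 s3 \<and> T3 \<le> T2 + 2 + 3 * (5 + (\<Sum>u<n. 10 + 10 * dg u))"
      show "wp answer_prog ?Q (Suc T3) s3"
        unfolding answer_prog_def
      proof (rule wp_Seq, rule wp_Store, rule wp_Seq, rule wp_For[where N = n and
          I = "\<lambda>i T' s'. balls v 3 s' \<and> (s' 20 0 \<noteq> 0 \<longleftrightarrow> (\<exists>u<i. s' 8 u = 0)) \<and> T' \<le> T3 + 3 + 5 * i"])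
        fix T4 s4
        assume A4: "balls v 3 s4 \<and> (s4 20 0 \<noteq> 0 \<longleftrightarrow> (\<exists>u<n. s4 8 u = 0)) \<and> T4 \<le> T3 + 3 + 5 * n"
        then have "s4 20 0 \<noteq> 0 \<longleftrightarrow> diam G \<ge> 4"
          unfolding diam V balls_def by (auto simp: subset_iff)
        \<comment> \<open>Positivity of \<open>n\<close> lets its multiple absorb the additive
          constants; edges count twice in the sums of degrees.\<close>
        moreover have "T4 + 2 \<le> 200 * (n + card (edges G))"
        proof -
          obtain A B C where ABC: "A = (\<Sum>u<n. 10 + 3 * dg u)" "B = (\<Sum>u<n. 20 + 30 * dg u)"
            "C = (\<Sum>u<n. 10 + 10 * dg u)" by blast
          show ?thesis
            using A1(3) A2(2) A3[THEN conjunct2] A4[THEN conjunct2, THEN conjunct2]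
              time[of 10 3] time[of 20 30] time[of 10 10] n_pos
            unfolding ABC[symmetric] by simp
        qed
        ultimately show "wp (Store 0 (Const 0) (V 20)) ?Q (Suc T4) s4"
          by (simp add: wp_simps)
      qed (use A3 inp(1) in \<open>auto simp: balls_def wp_simps less_Suc_eq\<close>)
    qed (use b3 l2 inp(1) n_pos in \<open>auto simp: balls_def v_def\<close>)
  qed
  qed
qed

end

lemma diam_at_least_four_linear:
  "decides_in_time diam_prog
     (graph_instances (\<lambda>G. chordal G \<and> has_dominating_shortest_path G)) enc_graph
     (\<lambda>(G, L). diam G \<ge> 4) (\<lambda>(G, L). real (card (verts G) + card (edges G)))"
proof (rule decides_in_time_tameI[OF tame_diam_prog, where C = 200])
  fix x assume x: "x \<in> graph_instances (\<lambda>G. chordal G \<and> has_dominating_shortest_path G)"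
  obtain G L where GL: "x = (G, L)" by (cases x)
  interpret graph_input G L using x by unfold_locales (simp_all add: graph_instances_def GL)
  have "card (verts G) = n" by (simp add: V)
  moreover have "real t \<le> 200 * real (n + m)" if "t \<le> 200 * (n + m)" for t m
    using of_nat_mono[OF that, where 'a = real] by simp
  moreover have "chordal G" using x by (simp add: graph_instances_def GL)
  ultimately show "wp diam_prog (\<lambda>t s. real t \<le> 200 * (case x of (G, L) \<Rightarrow> real (card (verts G) + card (edges G))) \<and>
     (s 0 0 \<noteq> 0 \<longleftrightarrow> (case x of (G, L) \<Rightarrow> diam G \<ge> 4))) 0 (init_memory (enc_graph x))"
    unfolding GL enc_graph_def prod.case by (intro wp_mono[OF diam_prog]) simp_all
qed

section \<open>The split graph of a CNF formula\<close>

lemma ex_bits: "\<exists>a<2 ^ m. \<forall>i<m. a div 2 ^ i mod 2 = (of_bool (f i) :: nat)"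
proof (induction m arbitrary: f)
  case (Suc m)
  obtain a where a: "a < 2 ^ m" "\<forall>i<m. a div 2 ^ i mod 2 = (of_bool (f (Suc i)) :: nat)"
    using Suc.IH[of "\<lambda>i. f (Suc i)"] by blast
  have "(2 * a + of_bool (f 0)) div 2 ^ i mod 2 = (of_bool (f i) :: nat)" if "i < Suc m" for i
  proof (cases i)
    case (Suc i')
    have "(2 * a + of_bool (f 0)) div 2 ^ i = a div 2 ^ i'" by (simp add: Suc div_mult2_eq)
    then show ?thesis using a(2) Suc that by simp
  qed simp
  moreover have "2 * a + of_bool (f 0) < 2 ^ Suc m" using a(1) by (cases "f 0") auto
  ultimately show ?case by blast
qed simp

text \<open>
  A number \<open>r < 2 * 2 ^ g\<close> stands for a partial assignment: \<open>r div 2 ^ g\<close> tells whether it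
  assigns the variables below \<open>g\<close> or those from \<open>g\<close> on, and its low \<open>g\<close> bits are the values.
\<close>

definition lit_true :: "nat \<Rightarrow> nat \<Rightarrow> nat \<times> bool \<Rightarrow> bool" where
  "lit_true g r = (\<lambda>(x, b). x div g = r div 2 ^ g \<and> r mod 2 ^ g div 2 ^ (x mod g) mod 2 = of_bool b)"

definition clause_true :: "nat \<Rightarrow> nat \<Rightarrow> clause \<Rightarrow> bool" where
  "clause_true g r c \<longleftrightarrow> (\<exists>l\<in>set c. lit_true g r l)"

locale cnf_input =
  fixes k n :: nat and F :: "clause list"
  assumes cnf: "k_cnf k n F"
begin

text \<open>Rounded up, so that two blocks of \<open>g\<close> variables cover all of them; a
  surplus variable occurs in no clause.\<close>

definition g :: nat where "g = (n + 1) div 2"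

definition p :: nat where "p = 2 ^ g"

definition M :: nat where "M = length F"

definition h :: nat where "h = M + 2"

definition N :: nat where "N = h + 2 * p"

text \<open>
  The vertices below \<open>M\<close> are the clauses; \<open>M\<close> and \<open>M + 1\<close> are the dominating edge; the vertex
  \<open>h + r\<close> is the partial assignment \<open>r\<close>, adjacent to the clauses that it does not satisfy.
\<close>

definition sedge :: "nat \<Rightarrow> nat \<Rightarrow> bool" where
  "sedge q r \<longleftrightarrow> q < h \<and> (r < h \<or>
     (if q < M then \<not> clause_true g (r - h) (F ! q) else (r - h) div p = q - M))"

definition link :: "nat \<Rightarrow> nat \<Rightarrow> bool" where
  "link i j \<longleftrightarrow> i \<noteq> j \<and> sedge (min i j) (max i j)"

definition SG :: "nat ugraph" where
  "SG = \<lparr>verts = {0..<N}, edges = {{i, j} | i j. i < N \<and> j < N \<and> link i j}\<rparr>"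

text \<open>The number of columns to inspect in row \<open>i\<close>. Inspecting all of them for
  each assignment would cost about 4^g steps, that is 2^n; since assignments are independent, their
  neighbours all lie below \<open>h\<close>.\<close>

definition lim :: "nat \<Rightarrow> nat" where
  "lim i = (if i < h then N else h)"

definition LL :: "nat list list" where
  "LL = map (\<lambda>i. filter (link i) [0..<lim i]) [0..<N]"

lemma link_sym: "link i j \<longleftrightarrow> link j i"
  by (auto simp: link_def min.commute max.commute)

lemma verts_SG [simp]: "verts SG = {0..<N}"
  by (simp add: SG_def)

lemma adj_SG: "adj SG i j \<longleftrightarrow> i < N \<and> j < N \<and> link i j"
  using link_sym by (auto simp: adj_def SG_def doubleton_eq_iff)

lemma p_pos: "0 < p" and h_less: "h < N" and M_less: "Suc M < h"
  by (auto simp: p_def N_def h_def)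

lemma simple_SG: "simple_graph SG"
  by (auto simp: simple_graph_def SG_def link_def)

lemma adj_lists_SG: "adj_lists SG LL"
proof -
  have "link i j \<Longrightarrow> i < N \<Longrightarrow> j < N \<Longrightarrow> j < lim i" for i j
    by (auto simp: link_def sedge_def lim_def)
  moreover have "lim i \<le> N" for i using h_less by (simp add: lim_def)
  ultimately show ?thesis
    by (auto simp: adj_lists_def LL_def adj_SG intro: less_le_trans)
qed

lemma adj_clique: "i < h \<Longrightarrow> j < h \<Longrightarrow> i \<noteq> j \<Longrightarrow> adj SG i j"
  using h_less by (auto simp: adj_SG link_def sedge_def)

lemma adj_hub: "r < 2 * p \<Longrightarrow> adj SG (h + r) (M + r div p)"
proof -
  assume "r < 2 * p"
  then have "r div p < 2" by (simp add: less_mult_imp_div_less)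
  then show ?thesis using \<open>r < 2 * p\<close> M_less h_less by (auto simp: adj_SG link_def sedge_def h_def N_def)
qed

lemma not_adj_assignments: "h \<le> i \<Longrightarrow> h \<le> j \<Longrightarrow> \<not> adj SG i j"
  by (auto simp: adj_SG link_def sedge_def)

lemma adj_assignment:
  "q < h \<Longrightarrow> r < 2 * p \<Longrightarrow> adj SG (h + r) q \<longleftrightarrow>
    (if q < M then \<not> clause_true g r (F ! q) else r div p = q - M)"
  by (auto simp: adj_SG link_def sedge_def N_def)

lemma assignment_vertex: "h \<le> i \<Longrightarrow> i < N \<Longrightarrow> \<exists>r<2 * p. i = h + r"
  by (intro exI[of _ "i - h"]) (auto simp: N_def)

lemma near_hub: "i < N \<Longrightarrow> \<exists>y\<in>{M, Suc M}. i \<in> nball SG 1 y"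
proof (cases "i < h")
  case True
  then show ?thesis using adj_clique[of M i] M_less by (auto simp: nball_1)
next
  case False
  assume "i < N"
  then obtain r where r: "i = h + r" "r < 2 * p" using False assignment_vertex[of i] by auto
  then have "r div p < 2" by (simp add: less_mult_imp_div_less)
  then have "M + r div p \<in> {M, Suc M}" by auto
  then show ?thesis using adj_hub[OF r(2)] adj_sym[of SG] r(1) by (auto simp: nball_1)
qed

lemma nball_3: "i < N \<Longrightarrow> j < N \<Longrightarrow> j \<in> nball SG 3 i"
proof -
  assume ij: "i < N" "j < N"
  obtain y y' where y: "y \<in> {M, Suc M}" "i \<in> nball SG 1 y" "y' \<in> {M, Suc M}" "j \<in> nball SG 1 y'"
    using near_hub[OF ij(1)] near_hub[OF ij(2)] by blast
  have "y' \<in> nball SG 1 y" using y(1,3) adj_clique[of y y'] M_less by (auto simp: nball_1)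
  then have "y' \<in> nball SG (1 + 1) i" using nball_trans[OF nball_sym[OF y(2)]] by blast
  then have "j \<in> nball SG (1 + 1 + 1) i" using nball_trans y(4) by fastforce
  then show ?thesis by (simp add: numeral_3_eq_3)
qed

lemma connected_SG: "connected_graph SG"
  unfolding connected_graph_def
proof (intro conjI ballI simple_SG)
  show "verts SG \<noteq> {}" using h_less by simp
  fix u v assume "u \<in> verts SG" "v \<in> verts SG"
  then show "\<exists>xs. walk SG xs \<and> hd xs = u \<and> last xs = v"
    using nball_walk[OF simple_SG _ nball_3] by force
qed

lemma split_SG: "split_graph SG"
  unfolding split_graph_def
proof (intro exI conjI)
  show "{0..<h} \<union> {h..<N} = verts SG" using h_less by auto
  show "clique SG {0..<h}" using adj_clique h_less by (auto simp: clique_def)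
  show "independent SG {h..<N}" using not_adj_assignments by (auto simp: independent_def)
qed auto

lemma dominating_edge_SG: "has_dominating_edge SG"
  unfolding has_dominating_edge_def
proof (rule bexI)
  have M: "Suc M < N" using M_less h_less by simp
  have "adj SG v M \<or> adj SG v (Suc M) \<or> v = M \<or> v = Suc M" if "v < N" for v
    using near_hub[OF that] adj_sym[of SG v] by (auto simp: nball_1)
  then show "dominating SG {M, Suc M}" using M unfolding dominating_def verts_SG by auto blast
  show "{M, Suc M} \<in> edges SG" using adj_clique[of M "Suc M"] M_less by (simp add: adj_def)
qed

lemma nball_2_iff:
  assumes "i < N" "j < N"
  shows "j \<in> nball SG 2 i \<longleftrightarrow> j \<in> nball SG 1 i \<or> (\<exists>z<N. adj SG i z \<and> adj SG z j)"
  by (auto simp: numeral_2_eq_2 nball.simps(2) adj_SG)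

text \<open>Assignments to the same half share a hub, while those to different halves can share only
  clauses; there, distance 2 means a clause that neither satisfies.\<close>

lemma diam_2_iff:
  "diam SG \<le> 2 \<longleftrightarrow> (\<forall>a<p. \<forall>b<p. \<exists>q<M. \<not> clause_true g a (F ! q) \<and> \<not> clause_true g (p + b) (F ! q))"
proof
  assume d: "diam SG \<le> 2"
  show "\<forall>a<p. \<forall>b<p. \<exists>q<M. \<not> clause_true g a (F ! q) \<and> \<not> clause_true g (p + b) (F ! q)"
  proof (intro allI impI)
    fix a b assume ab: "a < p" "b < p"
    have V: "h + a < N" "h + (p + b) < N" using ab by (auto simp: N_def)
    then have "h + (p + b) \<in> nball SG 2 (h + a)" using d diam_le_iff[OF connected_SG, of 2] by (auto simp: subset_iff)
    moreover have "h + (p + b) \<notin> nball SG 1 (h + a)"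
      using ab not_adj_assignments[of "h + a" "h + (p + b)"] by (auto simp: nball_1)
    ultimately obtain z where z: "adj SG (h + a) z" "adj SG z (h + (p + b))"
      using nball_2_iff[OF V] by blast
    have zh: "z < h" using z not_adj_assignments[of "h + a" z] by (meson le_add1 linorder_not_less)
    have "a div p = 0" "(p + b) div p = 1" using ab p_pos by simp_all
    then have "\<not> clause_true g a (F ! z) \<and> \<not> clause_true g (p + b) (F ! z) \<and> z < M"
      using adj_assignment[OF zh, of a] adj_assignment[OF zh, of "p + b"] z adj_sym[of SG z] ab
      by (auto split: if_splits)
    then show "\<exists>q<M. \<not> clause_true g a (F ! q) \<and> \<not> clause_true g (p + b) (F ! q)" by blast
  qed
next
  assume R: "\<forall>a<p. \<forall>b<p. \<exists>q<M. \<not> clause_true g a (F ! q) \<and> \<not> clause_true g (p + b) (F ! q)"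
  have cross: "\<exists>z<N. adj SG (h + r) z \<and> adj SG z (h + r')"
    if rr: "r < p" "p \<le> r'" "r' < 2 * p" for r r'
  proof -
    obtain q where q: "q < M" "\<not> clause_true g r (F ! q)" "\<not> clause_true g r' (F ! q)"
      using R[rule_format, OF rr(1), of "r' - p"] rr(2,3) by (auto simp: less_diff_conv2)
    then have "adj SG (h + r) q" "adj SG (h + r') q"
      using adj_assignment[of q r] adj_assignment[of q r'] rr M_less by auto
    then show ?thesis using adj_sym[of SG] adj_SG by blast
  qed
  have "j \<in> nball SG 2 i" if ij: "i < N" "j < N" for i j
  proof -
    have mixed: "j \<in> nball SG 2 i" if hj: "i < h" "h \<le> j" "j < N" for i j
    proof -
      obtain r where r: "j = h + r" "r < 2 * p" using hj assignment_vertex[of j] by auto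
      then have "M + r div p < h" by (simp add: h_def less_mult_imp_div_less)
      then have "M + r div p \<in> nball SG 1 i" using adj_clique[of i "M + r div p"] hj by (auto simp: nball_1)
      moreover have "j \<in> nball SG 1 (M + r div p)"
        using adj_hub[OF r(2)] adj_sym[of SG] r(1) by (auto simp: nball_1)
      ultimately have "j \<in> nball SG (1 + 1) i" by (rule nball_trans)
      then show ?thesis by (simp add: numeral_2_eq_2)
    qed
    consider "i < h" "j < h" | "i < h" "h \<le> j" | "h \<le> i" "j < h" | "h \<le> i" "h \<le> j" by linarith
    then show ?thesis
    proof cases
      case 1
      then have "j \<in> nball SG 1 i" using adj_clique[of i j] by (auto simp: nball_1)
      then show ?thesis using nball_mono[of 1 2 SG i] by auto
    next
      case 2
      then show ?thesis using mixed ij by blast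
    next
      case 3
      then have "i \<in> nball SG 2 j" by (intro mixed ij)
      then show ?thesis by (rule nball_sym)
    next
      case 4
      obtain r r' where r: "i = h + r" "r < 2 * p" "j = h + r'" "r' < 2 * p"
        using 4 ij assignment_vertex[of i] assignment_vertex[of j] by auto
      show ?thesis
      proof (cases "r div p = r' div p")
        case True
        then have "adj SG i (M + r div p)" "adj SG (M + r div p) j"
          using adj_hub[OF r(2)] adj_hub[OF r(4)] adj_sym[of SG "M + r div p"] r by auto
        then show ?thesis using nball_2_iff[OF ij] adj_SG by blast
      next
        case False
        then have "r < p \<and> p \<le> r' \<or> r' < p \<and> p \<le> r"
        proof (cases "r < p"; cases "r' < p")
          assume "\<not> r < p" "\<not> r' < p"
          then have "r div p = 1" "r' div p = 1" using r by (auto simp: div_nat_eqI)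
          then show ?thesis using False by simp
        qed (use False in auto)
        then have "\<exists>z<N. adj SG i z \<and> adj SG z j"
        proof
          assume "r < p \<and> p \<le> r'"
          then show ?thesis using cross[of r r'] r by simp
        next
          assume "r' < p \<and> p \<le> r"
          then obtain z where "z < N" "adj SG j z" "adj SG z i" using cross[of r' r] r by auto
          then show ?thesis using adj_sym[of SG z] by auto
        qed
        then show ?thesis using nball_2_iff[OF ij] by simp
      qed
    qed
  qed
  then show "diam SG \<le> 2" using diam_le_iff[OF connected_SG, of 2] by auto
qed

lemma satisfiable_iff:
  "satisfiable F \<longleftrightarrow> (\<exists>a<p. \<exists>b<p. \<forall>q<M. clause_true g a (F ! q) \<or> clause_true g (p + b) (F ! q))"
proof -
  have vars: "x div g < 2 \<and> x mod g < g \<and> x = g * (x div g) + x mod g" if "c \<in> set F" "(x, b) \<in> set c" for c x b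
  proof -
    have "x < n" using cnf that by (force simp: k_cnf_def)
    then have "x < 2 * g" by (simp add: g_def)
    then show ?thesis by (simp add: less_mult_imp_div_less)
  qed
  show ?thesis
  proof
    assume "satisfiable F"
    then obtain A where A: "\<And>c. c \<in> set F \<Longrightarrow> \<exists>(x, b)\<in>set c. A x = b" by (auto simp: satisfiable_def)
    obtain a where a: "a < p" "\<forall>i<g. a div 2 ^ i mod 2 = (of_bool (A i) :: nat)"
      using ex_bits[of g A] by (auto simp: p_def)
    obtain b where b: "b < p" "\<forall>i<g. b div 2 ^ i mod 2 = (of_bool (A (g + i)) :: nat)"
      using ex_bits[of g "\<lambda>i. A (g + i)"] by (auto simp: p_def)
    have "clause_true g a c \<or> clause_true g (p + b) c" if c: "c \<in> set F" for c
    proof -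
      obtain x s where x: "(x, s) \<in> set c" "A x = s" using A[OF c] by auto
      consider "x div g = 0" | "x div g = 1" using vars[OF c x(1)] by linarith
      then have "lit_true g a (x, s) \<or> lit_true g (p + b) (x, s)"
      proof cases
        case 1
        then show ?thesis using vars[OF c x(1)] a x(2) by (auto simp: lit_true_def p_def)
      next
        case 2
        then have "x = g + x mod g" using vars[OF c x(1)] by simp
        then show ?thesis using 2 vars[OF c x(1)] b x(2) by (auto simp: lit_true_def p_def)
      qed
      then show ?thesis using x(1) by (auto simp: clause_true_def)
    qed
    then show "\<exists>a<p. \<exists>b<p. \<forall>q<M. clause_true g a (F ! q) \<or> clause_true g (p + b) (F ! q)"
      using a(1) b(1) unfolding M_def by (meson nth_mem)
  next
    assume "\<exists>a<p. \<exists>b<p. \<forall>q<M. clause_true g a (F ! q) \<or> clause_true g (p + b) (F ! q)"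
    then obtain a b where ab: "a < p" "b < p"
      "\<And>q. q < M \<Longrightarrow> clause_true g a (F ! q) \<or> clause_true g (p + b) (F ! q)" by blast
    \<comment> \<open>Glues the halves together: \<open>a\<close> supplies the variables below
      \<open>g\<close> and \<open>b\<close>, shifted by \<open>g\<close>, the others.\<close>
    define A where "A x \<longleftrightarrow> (if x < g then a div 2 ^ x mod 2 else b div 2 ^ (x - g) mod 2) = 1" for x
    have "\<exists>(x, s)\<in>set c. A x = s" if c: "c \<in> set F" for c
    proof -
      obtain q where "q < M" "c = F ! q" using c by (auto simp: in_set_conv_nth M_def)
      then obtain x s where x: "(x, s) \<in> set c" "lit_true g a (x, s) \<or> lit_true g (p + b) (x, s)"
        using ab(3)[of q] by (auto simp: clause_true_def)
      from x(2) have "A x = s"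
      proof
        assume "lit_true g a (x, s)"
        then have "x div g = 0" "a div 2 ^ (x mod g) mod 2 = of_bool s" using ab by (auto simp: lit_true_def p_def)
        then show ?thesis using vars[OF c x(1)] by (cases s) (auto simp: A_def)
      next
        assume "lit_true g (p + b) (x, s)"
        then have 1: "x div g = 1" "b div 2 ^ (x mod g) mod 2 = of_bool s" using ab by (auto simp: lit_true_def p_def)
        then have "x = g + x mod g" using vars[OF c x(1)] by simp
        then have "\<not> x < g" "x - g = x mod g" by auto
        then show ?thesis using 1(2) by (cases s) (auto simp: A_def)
      qed
      then show ?thesis using x(1) by blast
    qed
    then show "satisfiable F" unfolding satisfiable_def by blast
  qed
qed

lemma diam_SG: "diam SG \<in> {2, 3}" "diam SG = 3 \<longleftrightarrow> satisfiable F"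
proof -
  have "diam SG \<le> 3" using diam_le_iff[OF connected_SG, of 3] nball_3 by auto
  moreover have "\<not> diam SG \<le> 1"
  proof
    assume "diam SG \<le> 1"
    then have "h + p \<in> nball SG 1 h" using diam_le_iff[OF connected_SG, of 1] p_pos
      by (auto simp: N_def subset_iff)
    then show False using not_adj_assignments[of h "h + p"] p_pos by (auto simp: nball_1)
  qed
  ultimately show *: "diam SG \<in> {2, 3}" by auto
  have "diam SG = 3 \<longleftrightarrow> \<not> diam SG \<le> 2" using * by auto
  then show "diam SG = 3 \<longleftrightarrow> satisfiable F" unfolding satisfiable_iff diam_2_iff by blast
qed

text \<open>The lower bound makes powers of the number of edges monotone in the exponent. For the
  upper bound, every edge has an end below \<open>h\<close>.\<close>

lemma card_edges_SG: "1 \<le> card (edges SG)" "card (edges SG) \<le> h * N"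
proof -
  have fin: "finite (edges SG)"
    by (rule finite_subset[of _ "Pow {0..<N}"]) (auto simp: SG_def)
  have "{M, Suc M} \<in> edges SG" using adj_clique[of M "Suc M"] M_less by (simp add: adj_def)
  then show "1 \<le> card (edges SG)" using fin card_0_eq[OF fin] by (metis One_nat_def Suc_leI empty_iff gr0I)
  have "edges SG \<subseteq> (\<lambda>(i, j). {i, j}) ` ({0..<h} \<times> {0..<N})"
  proof
    fix e assume "e \<in> edges SG"
    then obtain i j where ij: "e = {i, j}" "i < N" "j < N" "link i j" by (auto simp: SG_def)
    then have "e = {min i j, max i j}" "min i j < h" "max i j < N"
      by (auto simp: link_def sedge_def min_def max_def)
    then show "e \<in> (\<lambda>(i, j). {i, j}) ` ({0..<h} \<times> {0..<N})" by auto
  qed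
  then have "card (edges SG) \<le> card ({0..<h} \<times> {0..<N})" by (rule surj_card_le[rotated]) simp
  then show "card (edges SG) \<le> h * N" by simp
qed

lemma instance_SG:
  "(SG, LL) \<in> graph_instances (\<lambda>G. split_graph G \<and> has_dominating_edge G \<and> diam G \<in> {2, 3})"
  using connected_SG adj_lists_SG split_SG dominating_edge_SG diam_SG(1)
  by (simp add: graph_instances_def)

end

section \<open>Constructing the split graph\<close>

lemma init_memory_snoc: "(init_memory xs 0)(length xs := v) = init_memory (xs @ [v]) 0"
  by (auto simp: init_memory_def fun_eq_iff nth_append)

lemma init_memory_update: "j < length xs \<Longrightarrow> (init_memory xs 0)(j := v) = init_memory (xs[j := v]) 0"
  by (auto simp: init_memory_def fun_eq_iff)

text \<open>The length cell of a new row needs no initialisation, since the memory beyond the output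
  is zero.\<close>

lemma init_memory_snoc_0: "init_memory (xs @ [0]) 0 = init_memory xs 0"
  by (auto simp: init_memory_def fun_eq_iff nth_append less_Suc_eq)

lemma init_memory_nth: "j < length xs \<Longrightarrow> init_memory xs 0 j = xs ! j"
  by (simp add: init_memory_def)

text \<open>Truncated subtraction makes this 1 if the two values are equal, and 0 otherwise.\<close>

abbreviation Eq :: "exp \<Rightarrow> exp \<Rightarrow> exp" where
  "Eq x y \<equiv> Op Sub (Const 1) (Op Add (Op Sub x y) (Op Sub y x))"

text \<open>Layout of the construction: \<open>K\<close> is the copied formula, \<open>K + 1\<close>
  the clause offsets, \<open>K + 2\<close> the powers of two; \<open>K + 4\<close> to
  \<open>K + 7\<close> are \<open>M\<close>, \<open>g\<close>, \<open>h\<close>, \<open>p\<close>;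
  \<open>K + 8\<close> is the edge flag, \<open>K + 9\<close> the output pointer,
  \<open>K + 10\<close> the row, \<open>K + 11\<close> the column, \<open>K + 12\<close> the index
  of a literal, \<open>K + 13\<close> the address of the length of the row, \<open>K + 14\<close>
  and \<open>K + 15\<close> the smaller and larger end (the latter finally reduced to its
  assignment), \<open>K + 16\<close> a literal.\<close>

definition lit_exp :: "nat \<Rightarrow> exp" where
  "lit_exp K = (let x = Op Div (V (K + 16)) (Const 2); g = V (K + 5); r = V (K + 15); p = V (K + 7) in
     Op Mul (Eq (Op Div x g) (Op Div r p))
       (Eq (Op Mod (Op Div (Op Mod r p) (Load (K + 2) (Op Mod x g))) (Const 2))
           (Op Mod (V (K + 16)) (Const 2))))"

definition edge_prog :: "nat \<Rightarrow> com" where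
  "edge_prog K =
     If (Op Less (V (K + 15)) (V (K + 6)))
       (Set (K + 8) (Op Less (V (K + 14)) (V (K + 15))))
       (If (Op Less (V (K + 14)) (V (K + 4)))
         (Seq (Set (K + 8) (Const 1))
         (Seq (Set (K + 15) (Op Sub (V (K + 15)) (V (K + 6))))
              (For (K + 12) (Load K (Load (K + 1) (V (K + 14))))
                (Seq (Set (K + 16) (Load K (Op Add (Load (K + 1) (V (K + 14))) (Succ (V (K + 12))))))
                     (If (lit_exp K) (Set (K + 8) (Const 0)) Skip)))))
         (Set (K + 8) (Eq (Op Div (Op Sub (V (K + 15)) (V (K + 6))) (V (K + 7)))
                          (Op Sub (V (K + 14)) (V (K + 4))))))"

text \<open>The length of a row is unknown when the row begins, so the cell in front of it counts
  the entries as they are appended.\<close>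

definition record_prog :: "nat \<Rightarrow> com" where
  "record_prog K = If (V (K + 8))
     (Seq (Store 0 (V (K + 9)) (V (K + 11)))
     (Seq (Inc (K + 9))
          (Store 0 (V (K + 13)) (Succ (Load 0 (V (K + 13))))))) Skip"

definition pair_prog :: "nat \<Rightarrow> com" where
  "pair_prog K =
     Seq (If (Op Less (V (K + 10)) (V (K + 11)))
           (Seq (Set (K + 14) (V (K + 10))) (Set (K + 15) (V (K + 11))))
           (Seq (Set (K + 14) (V (K + 11))) (Set (K + 15) (V (K + 10)))))
    (Seq (edge_prog K) (record_prog K))"

text \<open>The column bound evaluates to \<open>lim\<close>. Cell 0 of the output counts the
  finished rows and thereby ends up as the header of the encoding.\<close>

definition row_prog :: "nat \<Rightarrow> com" where
  "row_prog K =
     Seq (Set (K + 13) (V (K + 9)))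
    (Seq (Inc (K + 9))
    (Seq (For (K + 11) (Op Add (V (K + 6)) (Op Mul (Op Less (V (K + 10)) (V (K + 6))) (Op Add (V (K + 7)) (V (K + 7)))))
           (pair_prog K))
         (Inc 0)))"

text \<open>Doubling is done by increments, because \<open>slow\<close> admits no sum of two cells;
  the geometric sum keeps the time proportional to 2^g.\<close>

definition powers_prog :: "nat \<Rightarrow> com" where
  "powers_prog K =
     Seq (Set (K + 2) (Const 1))
         (For (K + 10) (V (K + 5))
           (Seq (Store (K + 2) (Succ (V (K + 10))) (Load (K + 2) (V (K + 10))))
                (For (K + 11) (Load (K + 2) (V (K + 10)))
                  (Store (K + 2) (Succ (V (K + 10))) (Succ (Load (K + 2) (Succ (V (K + 10)))))))))"

text \<open>The program that runs next expects its input in array 0, so the formula gives way and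
  array 0 is cleared for the output.\<close>

definition move_prog :: "nat \<Rightarrow> com" where
  "move_prog K = For (K + 10) (V (K + 9))
     (Seq (Store K (V (K + 10)) (Load 0 (V (K + 10)))) (Store 0 (V (K + 10)) (Const 0)))"

text \<open>The offsets start at cell 1 because the number of variables precedes the list of
  clauses. They leave the input length in \<open>K + 9\<close>, where \<open>move_prog\<close> reads
  it.\<close>

definition build_prog :: "nat \<Rightarrow> com" where
  "build_prog K =
     Seq (offsets_prog K 1)
    (Seq (Set (K + 4) (Load 0 (Const 1)))
    (Seq (Set (K + 5) (Op Div (Succ (V 0)) (Const 2)))
    (Seq (Set (K + 6) (Op Add (V (K + 4)) (Const 2)))
    (Seq (move_prog K)
    (Seq (powers_prog K)
    (Seq (Set (K + 7) (Load (K + 2) (V (K + 5))))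
    (Seq (Set (K + 9) (Const 1))
         (For (K + 10) (Op Add (V (K + 6)) (Op Add (V (K + 7)) (V (K + 7)))) (row_prog K)))))))))"

lemma tame_build_prog: "tame 100 (build_prog K)"
  by (simp add: build_prog_def move_prog_def powers_prog_def row_prog_def pair_prog_def record_prog_def edge_prog_def
      lit_exp_def offsets_prog_def Let_def)

lemma wp_move_prog:
  fixes s :: memory
  assumes s: "s 0 = init_memory xs 0" "s (K + 9) 0 = length xs" "s K = (\<lambda>_. 0)" and K: "0 < K"
    and Q: "\<And>T' s'. s' 0 = (\<lambda>_. 0) \<Longrightarrow> s' K = init_memory xs 0 \<Longrightarrow>
      (\<And>a. a \<notin> {0, K, K + 10} \<Longrightarrow> s' a = s a) \<Longrightarrow> T' \<le> T + 2 + 4 * length xs \<Longrightarrow> Q T' s'"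
  shows "wp (move_prog K) Q T s"
  unfolding move_prog_def
proof (rule wp_For[where N = "length xs" and I = "\<lambda>i T' (s' :: memory).
    s' 0 = (\<lambda>x. if x < i then 0 else init_memory xs 0 x) \<and> s' K = (\<lambda>x. if x < i then init_memory xs 0 x else 0) \<and>
    (\<forall>a. a \<notin> {0, K, K + 10} \<longrightarrow> s' a = s a) \<and> T' \<le> T + 1 + 4 * i"])
  fix T' s'
  assume I: "s' 0 = (\<lambda>x. if x < length xs then 0 else init_memory xs 0 x) \<and>
    s' K = (\<lambda>x. if x < length xs then init_memory xs 0 x else 0) \<and>
    (\<forall>a. a \<notin> {0, K, K + 10} \<longrightarrow> s' a = s a) \<and> T' \<le> T + 1 + 4 * length xs"
  have "(\<lambda>x. if x < length xs then init_memory xs 0 x else 0) = init_memory xs 0"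
    "(\<lambda>x. if x < length xs then 0 else init_memory xs 0 x) = (\<lambda>_. 0)"
    by (auto simp: init_memory_def)
  then show "Q (Suc T') s'" using I by (intro Q) simp_all
qed (use s K in \<open>auto simp: wp_simps fun_eq_iff less_Suc_eq\<close>)

lemma wp_powers_prog:
  fixes s :: memory
  assumes s: "s (K + 5) 0 = g" "s (K + 2) = (\<lambda>_. 0)"
    and Q: "\<And>T' s'. (\<forall>i\<le>g. s' (K + 2) i = 2 ^ i) \<Longrightarrow>
      (\<And>a. a \<notin> {K + 2, K + 10, K + 11} \<Longrightarrow> s' a = s a) \<Longrightarrow> T' \<le> T + 12 * 2 ^ g \<Longrightarrow> Q T' s'"
  shows "wp (powers_prog K) Q T s"
proof -
  let ?I = "\<lambda>i T' (s' :: memory). (\<forall>j\<le>i. s' (K + 2) j = 2 ^ j) \<and>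
    (\<forall>a. a \<notin> {K + 2, K + 10, K + 11} \<longrightarrow> s' a = s a) \<and> T' + 4 \<le> T + 6 * 2 ^ i + 5 * i"
  show ?thesis
    unfolding powers_prog_def
  proof (intro wp_Seq wp_Store, rule wp_For[where N = g and I = ?I])
    fix i T1 s1
    assume I: "?I i T1 s1" and i: "s1 (K + 10) 0 = i" "i < g"
    show "wp (Seq (Store (K + 2) (Succ (V (K + 10))) (Load (K + 2) (V (K + 10))))
       (For (K + 11) (Load (K + 2) (V (K + 10)))
          (Store (K + 2) (Succ (V (K + 10))) (Succ (Load (K + 2) (Succ (V (K + 10))))))))
      (\<lambda>T' s'. s' (K + 10) 0 = i \<and> ?I (Suc i) (Suc T') (s'(K + 10 := (s' (K + 10))(0 := Suc i)))) (Suc T1) s1"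
      by (intro wp_Seq wp_Store, rule wp_For[where N = "2 ^ i" and
        I = "\<lambda>j T' (s' :: memory). (\<forall>j\<le>i. s' (K + 2) j = 2 ^ j) \<and> s' (K + 2) (Suc i) = 2 ^ i + j \<and> s' (K + 10) 0 = i \<and>
          (\<forall>a. a \<notin> {K + 2, K + 10, K + 11} \<longrightarrow> s' a = s a) \<and> T' \<le> T1 + 3 + 3 * j"])
        (use I i in \<open>auto simp: le_Suc_eq intro!: wp_Store\<close>)
  next
    fix T1 s1
    assume I: "?I g T1 s1"
    have "g + 1 \<le> 2 ^ g" by (induction g) auto
    then show "Q (Suc T1) s1" using I by (intro Q) auto
  qed (use s in auto)
qed

section \<open>Correctness and running time of the construction\<close>

context cnf_input
begin

definition inp :: "nat list" where "inp = enc_cnf (n, F)"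

definition lits :: "nat list list" where
  "lits = map (map (\<lambda>(x, b). 2 * x + of_bool b)) F"

definition offs :: "nat \<Rightarrow> nat" where
  "offs q = Suc (off lits q)"

lemma inp_Suc: "x < length (enc_lists lits) \<Longrightarrow> inp ! Suc x = enc_lists lits ! x"
  "length inp = Suc (length (enc_lists lits))"
  by (simp_all add: inp_def enc_cnf_def lits_def)

lemma inp_nth:
  "inp ! 0 = n" "inp ! 1 = M"
  "q < M \<Longrightarrow> init_memory inp 0 (offs q) = length (F ! q)"
  "q < M \<Longrightarrow> l < length (F ! q) \<Longrightarrow> init_memory inp 0 (Suc (offs q + l)) = 2 * fst (F ! q ! l) + of_bool (snd (F ! q ! l))"
proof -
  show "inp ! 0 = n" by (simp add: inp_def enc_cnf_def)
  show "inp ! 1 = M" by (simp add: inp_def enc_cnf_def enc_lists_def M_def)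
  assume q: "q < M"
  then have ql: "q < length lits" "lits ! q = map (\<lambda>(x, b). 2 * x + of_bool b) (F ! q)"
    by (simp_all add: M_def lits_def)
  show "init_memory inp 0 (offs q) = length (F ! q)"
    using enc_lists_nth(1,2)[OF ql(1)] inp_Suc ql by (simp add: init_memory_def offs_def)
  assume "l < length (F ! q)"
  then show "init_memory inp 0 (Suc (offs q + l)) = 2 * fst (F ! q ! l) + of_bool (snd (F ! q ! l))"
    using enc_lists_nth(3,4)[OF ql(1), of l] inp_Suc ql
    by (simp add: init_memory_def offs_def case_prod_beta)
qed

lemma clause_length: "q < M \<Longrightarrow> length (F ! q) \<le> k"
  using cnf by (simp add: k_cnf_def M_def)

lemma clause_vars: "q < M \<Longrightarrow> (x, b) \<in> set (F ! q) \<Longrightarrow> x < n"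
  using cnf by (fastforce simp: k_cnf_def M_def)

definition env :: "nat \<Rightarrow> memory \<Rightarrow> bool" where
  "env K s \<longleftrightarrow> s K = init_memory inp 0 \<and> (\<forall>q<M. s (K + 1) q = offs q) \<and> (\<forall>i\<le>g. s (K + 2) i = 2 ^ i) \<and>
     s (K + 4) 0 = M \<and> s (K + 5) 0 = g \<and> s (K + 6) 0 = h \<and> s (K + 7) 0 = p \<and>
     (\<forall>a. 0 < a \<and> a < K \<longrightarrow> s a = (\<lambda>_. 0))"

lemma lit_exp:
  assumes e: "env K s" and s: "s (K + 15) 0 = r" "s (K + 16) 0 = 2 * x + of_bool b" and x: "x < n"
  shows "exp_val s (lit_exp K) \<noteq> 0 \<longleftrightarrow> lit_true g r (x, b)"
proof -
  have "0 < g" using x by (simp add: g_def)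
  then have "s (K + 2) (x mod g) = 2 ^ (x mod g)" using e by (simp add: env_def less_imp_le)
  moreover have "(2 * x + of_bool b) div 2 = x" "(2 * x + of_bool b :: nat) mod 2 = of_bool b" by (cases b; simp)+
  moreover have "s (K + 5) 0 = g" "s (K + 7) 0 = p" using e by (auto simp: env_def)
  ultimately show ?thesis using s by (auto simp: lit_exp_def Let_def lit_true_def p_def)
qed

lemma edge_prog:
  assumes e: "env K s" and s: "s (K + 14) 0 = q" "s (K + 15) 0 = r" and K: "0 < K"
    and qr: "q \<le> r" "q < h" "q = r \<longrightarrow> r < h"
  shows "wp (edge_prog K) (\<lambda>T' s'. (s' (K + 8) 0 \<noteq> 0 \<longleftrightarrow> q \<noteq> r \<and> sedge q r) \<and>
      (\<forall>a. a \<notin> {K + 8, K + 12, K + 15, K + 16} \<longrightarrow> s' a = s a) \<and> T' \<le> T + 10 + 10 * k) T s"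
proof -
  have c: "s (K + 4) 0 = M" "s (K + 6) 0 = h" "s (K + 7) 0 = p" using e by (auto simp: env_def)
  consider "r < h" | "h \<le> r" "q < M" | "h \<le> r" "M \<le> q" by linarith
  then show ?thesis
  proof cases
    case 1
    \<comment> \<open>The stored comparison of the two ends also rejects the diagonal, which occurs
      only below \<open>h\<close>.\<close>
    then show ?thesis using c s qr by (auto simp: edge_prog_def wp_simps sedge_def)
  next
    case 3
    then have "q \<noteq> r" using qr by auto
    then show ?thesis using 3 c s qr by (auto simp: edge_prog_def wp_simps sedge_def)
  next
    case 2
    then have ne: "q \<noteq> r" using qr by auto
    have sq: "s (K + 1) q = offs q" "s K = init_memory inp 0" using e 2 by (auto simp: env_def)
    let ?s = "s(K + 8 := (s (K + 8))(0 := 1), K + 15 := (s (K + 15))(0 := r - h))"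
    let ?body = "Seq (Set (K + 16) (Load K (Op Add (Load (K + 1) (V (K + 14))) (Succ (V (K + 12))))))
                     (If (lit_exp K) (Set (K + 8) (Const 0)) Skip)"
    let ?I = "\<lambda>l T' (s' :: memory). (s' (K + 8) 0 \<noteq> 0 \<longleftrightarrow> \<not> (\<exists>l'<l. lit_true g (r - h) (F ! q ! l'))) \<and>
        s' (K + 15) 0 = r - h \<and>
        (\<forall>a. a \<notin> {K + 8, K + 12, K + 15, K + 16} \<longrightarrow> s' a = s a) \<and> T' \<le> T + 6 + 6 * l"
    let ?Q = "\<lambda>T' s'. (s' (K + 8) 0 \<noteq> 0 \<longleftrightarrow> q \<noteq> r \<and> sedge q r) \<and>
      (\<forall>a. a \<notin> {K + 8, K + 12, K + 15, K + 16} \<longrightarrow> s' a = s a) \<and> T' \<le> T + 10 + 10 * k"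
    have "wp (For (K + 12) (Load K (Load (K + 1) (V (K + 14)))) ?body) ?Q (Suc (Suc (Suc (Suc T)))) ?s"
    proof (rule wp_For[where N = "length (F ! q)" and I = ?I])
      fix l T1 s1
      assume I: "?I l T1 s1" and l: "s1 (K + 12) 0 = l" "l < length (F ! q)"
      obtain x b where xb: "F ! q ! l = (x, b)" by (cases "F ! q ! l")
      let ?s1 = "s1(K + 16 := (s1 (K + 16))(0 := 2 * x + of_bool b))"
      have same: "s1 a = s a" if "a \<notin> {K + 8, K + 12, K + 15, K + 16}" for a using I that by blast
      have "x < n" using clause_vars[OF 2(2), of x b] l(2) xb nth_mem[of l "F ! q"] by auto
      moreover have "env K ?s1" using e K unfolding env_def by (auto simp: same)
      ultimately have le: "exp_val ?s1 (lit_exp K) \<noteq> 0 \<longleftrightarrow> lit_true g (r - h) (F ! q ! l)"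
        using lit_exp[of K ?s1 "r - h" x b] I xb by simp
      have ld: "s1 K (s1 (K + 1) (s1 (K + 14) 0) + Suc (s1 (K + 12) 0)) = 2 * x + of_bool b"
        using inp_nth(4)[OF 2(2) l(2)] xb sq s l(1) same K by simp
      show "wp ?body (\<lambda>T' s'. s' (K + 12) 0 = l \<and> ?I (Suc l) (Suc T') (s'(K + 12 := (s' (K + 12))(0 := Suc l)))) (Suc T1) s1"
        using le I l ld by (simp add: wp_simps) (auto simp: less_Suc_eq)
    next
      fix T1 s1
      assume I: "?I (length (F ! q)) T1 s1"
      have "(\<exists>l<length (F ! q). lit_true g (r - h) (F ! q ! l)) \<longleftrightarrow> clause_true g (r - h) (F ! q)"
        unfolding clause_true_def by (metis in_set_conv_nth)
      then show "?Q (Suc T1) s1" using I clause_length[OF 2(2)] 2 qr ne by (auto simp: sedge_def)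
    qed (use s sq 2 inp_nth(3) K in auto)
    then show ?thesis using 2 c s by (simp add: edge_prog_def wp_simps)
  qed
qed


definition out :: "nat \<Rightarrow> nat list" where
  "out i = concat (map (\<lambda>l. length l # l) (take i LL))"

lemma out_Suc: "i < N \<Longrightarrow> out (Suc i) = out i @ length (filter (link i) [0..<lim i]) # filter (link i) [0..<lim i]"
  by (simp add: out_def LL_def take_Suc_conv_app_nth)

lemma out_N: "enc_lists LL = N # out N"
  by (simp add: enc_lists_def out_def LL_def)

definition in_row :: "nat \<Rightarrow> nat \<Rightarrow> nat \<Rightarrow> memory \<Rightarrow> bool" where
  "in_row K i j s \<longleftrightarrow> env K s \<and> s (K + 10) 0 = i \<and> s (K + 13) 0 = Suc (length (out i)) \<and>
     s (K + 9) 0 = Suc (Suc (length (out i) + length (filter (link i) [0..<j]))) \<and>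
     s 0 = init_memory (i # out i @ length (filter (link i) [0..<j]) # filter (link i) [0..<j]) 0"

lemma env_cong:
  assumes "env K s" "\<And>a. 0 < a \<Longrightarrow> a \<le> K + 7 \<Longrightarrow> s' a = s a" "0 < K"
  shows "env K s'"
  using assms unfolding env_def by auto

lemma pair_prog:
  assumes r: "in_row K i j s" and j: "s (K + 11) 0 = j" "j < lim i" and i: "i < N" and K: "0 < K"
  shows "wp (pair_prog K) (\<lambda>T' s'. s' (K + 11) 0 = j \<and> in_row K i (Suc j) s' \<and> T' \<le> T + 20 + 10 * k) T s"
proof -
  have r': "env K s" "s (K + 10) 0 = i" "s (K + 13) 0 = Suc (length (out i))"
    "s (K + 9) 0 = Suc (Suc (length (out i) + length (filter (link i) [0..<j])))"
    "s 0 = init_memory (i # out i @ length (filter (link i) [0..<j]) # filter (link i) [0..<j]) 0"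
    using r unfolding in_row_def by blast+
  define q r where "q = min i j" and "r = max i j"
  let ?s = "s(K + 14 := (s (K + 14))(0 := q), K + 15 := (s (K + 15))(0 := r))"
  let ?Q = "\<lambda>T' s'. s' (K + 11) 0 = j \<and> in_row K i (Suc j) s' \<and> T' \<le> T + 20 + 10 * k"
  have "wp (edge_prog K) (wp (record_prog K) ?Q) (Suc (Suc (Suc T))) ?s"
  proof (rule wp_mono[OF edge_prog[where q = q and r = r]])
    show "env K ?s" by (rule env_cong[OF r'(1) _ K]) auto
    show "q \<le> r" by (simp add: q_def r_def)
    \<comment> \<open>The row of an assignment stops at column \<open>h\<close>, so some end lies
      below \<open>h\<close>, and on the diagonal both do.\<close>
    show "q < h" "q = r \<longrightarrow> r < h" using j(2) i h_less
      by (cases "i < h"; simp add: q_def r_def lim_def; linarith)+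
    fix T1 s1
    assume 1: "(s1 (K + 8) 0 \<noteq> 0 \<longleftrightarrow> q \<noteq> r \<and> sedge q r) \<and>
      (\<forall>a. a \<notin> {K + 8, K + 12, K + 15, K + 16} \<longrightarrow> s1 a = ?s a) \<and> T1 \<le> Suc (Suc (Suc T)) + 10 + 10 * k"
    have "q \<noteq> r \<longleftrightarrow> i \<noteq> j" by (auto simp: q_def r_def min_def max_def)
    then have flag: "s1 (K + 8) 0 \<noteq> 0 \<longleftrightarrow> link i j"
      using conjunct1[OF 1] by (simp only: link_def q_def r_def)
    have same: "s1 a = s a" if "a \<notin> {K + 8, K + 12, K + 14, K + 15, K + 16}" for a using 1 that by simp
    have env: "env K s1" by (rule env_cong[of K s]) (use r' same K in auto)
    let ?f = "filter (link i) [0..<j]"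
    let ?xs = "i # out i @ length ?f # ?f"
    have s1: "s1 (K + 9) 0 = length ?xs" "s1 (K + 13) 0 = Suc (length (out i))" "s1 0 = init_memory ?xs 0"
      "s1 (K + 10) 0 = i" "s1 (K + 11) 0 = j"
      using r' j same K by simp_all
    show "wp (record_prog K) ?Q T1 s1"
    proof (cases "link i j")
      case False
      then have "in_row K i (Suc j) s1" using env s1 by (simp add: in_row_def)
      then show ?thesis using False flag 1 s1 by (simp add: record_prog_def wp_simps)
    next
      case True
      let ?hd = "Suc (length (out i))"
      have nth: "init_memory (?xs @ [j]) 0 ?hd = length ?f"
        by (subst init_memory_nth) (auto simp: nth_append)
      have "(init_memory ?xs 0)(length ?xs := j, ?hd := Suc (length ?f)) =
          init_memory ((?xs @ [j])[?hd := Suc (length ?f)]) 0"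
        unfolding init_memory_snoc by (rule init_memory_update) simp
      also have "(?xs @ [j])[?hd := Suc (length ?f)] = i # out i @ Suc (length ?f) # ?f @ [j]"
        by (simp add: list_update_append)
      finally have mem: "(init_memory ?xs 0)(length ?xs := j, ?hd := Suc (length ?f)) =
        init_memory (i # out i @ Suc (length ?f) # ?f @ [j]) 0" .
      let ?s' = "s1(0 := init_memory (i # out i @ Suc (length ?f) # ?f @ [j]) 0, K + 9 := (s1 (K + 9))(0 := Suc (length ?xs)))"
      have "env K ?s'" by (rule env_cong[OF env]) (use K in auto)
      then have "in_row K i (Suc j) ?s'" using s1 True K by (simp add: in_row_def)
      moreover have "wp (Seq (Store 0 (V (K + 9)) (V (K + 11)))
           (Seq (Inc (K + 9)) (Store 0 (V (K + 13)) (Succ (Load 0 (V (K + 13))))))) Q T1' s1 \<longleftrightarrow>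
           Q (T1' + 3) ?s'" for Q T1'
      proof -
        have "s1(0 := (init_memory ?xs 0)(length ?xs := j), K + 9 := (s1 (K + 9))(0 := Suc (length ?xs)),
            0 := (init_memory ?xs 0)(length ?xs := j, ?hd := Suc (length ?f))) = ?s'"
          unfolding mem using K by (simp add: fun_eq_iff)
        then show ?thesis using s1 nth K
          unfolding wp_simps init_memory_snoc[symmetric] by (simp add: numeral_3_eq_3)
      qed
      ultimately show ?thesis using flag True 1 s1 K by (simp add: record_prog_def wp_simps(4))
    qed
  qed (use j K in simp_all)
  moreover note r'(2)
  ultimately show ?thesis
    using j(1) by (cases "i < j") (simp_all add: pair_prog_def wp_simps q_def r_def numeral_3_eq_3)
qed

definition before_row :: "nat \<Rightarrow> nat \<Rightarrow> memory \<Rightarrow> bool" where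
  "before_row K i s \<longleftrightarrow> env K s \<and> s (K + 9) 0 = Suc (length (out i)) \<and> s 0 = init_memory (i # out i) 0"

lemma row_prog:
  assumes b: "before_row K i s" "s (K + 10) 0 = i" and i: "i < N" and K: "0 < K"
  shows "wp (row_prog K) (\<lambda>T' s'. s' (K + 10) 0 = i \<and> before_row K (Suc i) s' \<and>
    T' \<le> T + 5 + lim i * (22 + 10 * k)) T s"
  unfolding row_prog_def
proof (intro wp_Seq wp_Store, rule wp_For[where N = "lim i" and
    I = "\<lambda>j T' s'. in_row K i j s' \<and> T' \<le> T + 3 + j * (22 + 10 * k)"])
  fix j T1 s1
  assume "in_row K i j s1 \<and> T1 \<le> T + 3 + j * (22 + 10 * k)" "s1 (K + 11) 0 = j" "j < lim i"
  then show "wp (pair_prog K) (\<lambda>T' s'. s' (K + 11) 0 = j \<and> in_row K i (Suc j) (s'(K + 11 := (s' (K + 11))(0 := Suc j))) \<and>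
     Suc T' \<le> T + 3 + Suc j * (22 + 10 * k)) (Suc T1) s1"
    by (intro wp_mono[OF pair_prog[OF _ _ _ i K, of j s1 "Suc T1"]])
      (auto simp: in_row_def K intro: env_cong)
next
  fix T1 s1
  assume 1: "in_row K i (lim i) s1 \<and> T1 \<le> T + 3 + lim i * (22 + 10 * k)"
  let ?f = "filter (link i) [0..<lim i]"
  have "(init_memory (i # out i @ length ?f # ?f) 0)(0 := Suc i) = init_memory (Suc i # out (Suc i)) 0"
    by (subst init_memory_update) (simp_all add: out_Suc[OF i])
  moreover have "init_memory (i # out i @ length ?f # ?f) 0 0 = i" by (simp add: init_memory_nth)
  moreover have "env K (s1(0 := init_memory (Suc i # out (Suc i)) 0))"
    by (rule env_cong[of K s1]) (use 1 K in \<open>auto simp: in_row_def\<close>)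
  ultimately show "wp (Inc 0) (\<lambda>T' s'. s' (K + 10) 0 = i \<and> before_row K (Suc i) s' \<and>
    T' \<le> T + 5 + lim i * (22 + 10 * k)) (Suc T1) s1"
    using 1 K by (simp add: wp_simps in_row_def before_row_def out_Suc[OF i])
next
  fix j T1 s1
  assume "in_row K i j s1 \<and> T1 \<le> T + 3 + j * (22 + 10 * k)"
  then show "exp_val s1 (Op Add (V (K + 6)) (Op Mul (Op Less (V (K + 10)) (V (K + 6))) (Op Add (V (K + 7)) (V (K + 7))))) = lim i"
    by (auto simp: in_row_def env_def lim_def N_def)
qed (use b K init_memory_snoc_0[of "i # out i"] in
    \<open>auto simp: in_row_def before_row_def intro: env_cong[of K s]\<close>)

lemma size_bounds:
  "N \<le> (k + 1) * h * N" "h * N \<le> (k + 1) * h * N" "(h * N) * k \<le> (k + 1) * h * N"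
  "h \<le> (k + 1) * h * N" "h * k \<le> (k + 1) * h * N" "2 ^ g \<le> N"
proof -
  have 1: "1 \<le> h" "1 \<le> N" using h_less by (simp_all add: h_def)
  have "1 \<le> (k + 1) * h" using mult_le_mono[of 1 "k + 1" 1 h] 1 by simp
  then show "N \<le> (k + 1) * h * N" using mult_le_mono[of 1 "(k + 1) * h" N N] by simp
  show hN: "h * N \<le> (k + 1) * h * N" and hNk: "(h * N) * k \<le> (k + 1) * h * N"
    by (simp_all add: algebra_simps)
  have "h \<le> h * N" "h * k \<le> (h * N) * k" using mult_le_mono[of h h 1 N] 1 by simp_all
  then show "h \<le> (k + 1) * h * N" "h * k \<le> (k + 1) * h * N" using hN hNk by linarith+
  show "2 ^ g \<le> N" by (simp add: N_def p_def)
qed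

text \<open>The products enter as independent variables, which turns the estimate into a linear
  one.\<close>

lemma build_time:
  fixes T1 T3 T4 T5 :: nat
  assumes "T5 \<le> T4 + 3 + 10 * N + 44 * hN + 20 * hNk" "T4 \<le> T3 + 12 * pg"
    "T3 \<le> T1 + 13 + 4 * M + 4 * Mk" "T1 \<le> 3 + 10 * M + 3 * Mk" "Mk \<le> hk" "M + 2 = h"
    "N \<le> B" "hN \<le> B" "hNk \<le> B" "h \<le> B" "hk \<le> B" "pg \<le> N"
  shows "Suc T5 \<le> 200 * B"
  using assms by linarith

lemma build_prog:
  assumes K: "0 < K"
  shows "wp (build_prog K) (\<lambda>T s. T \<le> 200 * ((k + 1) * h * N) \<and> s 0 = init_memory (enc_graph (SG, LL)) 0 \<and>
    (\<forall>a. 0 < a \<and> a < K \<longrightarrow> s a = (\<lambda>_. 0))) 0 (init_memory (enc_cnf (n, F)))" (is "wp _ ?Q 0 _")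
proof -
  let ?s = "init_memory inp"
  have s0: "?s a = (\<lambda>_. 0)" if "a \<noteq> 0" for a using that by (simp add: init_memory_def fun_eq_iff)
  have len_ls: "length lits = M" by (simp add: M_def lits_def)
  have off_len: "Suc (off lits M) = length inp" "length inp \<le> 2 + M * (k + 1)"
  proof -
    have "length (concat (map (\<lambda>l. length l # l) lits)) \<le> M * (k + 1)"
      using clause_length unfolding M_def lits_def by (induction F) (force simp: nth_Cons')+
    then show "Suc (off lits M) = length inp" "length inp \<le> 2 + M * (k + 1)"
      by (simp_all add: off_def inp_def enc_cnf_def enc_lists_def M_def lits_def)
  qed
  show ?thesis
    unfolding build_prog_def inp_def[symmetric]
  proof (rule wp_Seq, rule offsets_prog[where ls = lits], goal_cases)
    case (1 x)
    then show ?case using inp_Suc by (simp add: init_memory_def)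
  next
    case (2 T1 s1)
    then have off: "\<forall>q<M. s1 (K + 1) q = offs q" "s1 (K + 9) 0 = length inp"
      and same1: "\<And>a. a \<notin> {K + 1, K + 9, K + 10, K + 11} \<Longrightarrow> s1 a = ?s a"
      and t1: "T1 \<le> 3 + (\<Sum>u<M. 10 + 3 * length (lits ! u))"
      using len_ls off_len by (simp_all add: offs_def)
    have "(\<Sum>u<M. 10 + 3 * length (lits ! u)) \<le> (\<Sum>u<M. 10 + 3 * k)"
      using clause_length by (intro sum_mono) (simp add: M_def lits_def)
    then have t1: "T1 \<le> 3 + M * (10 + 3 * k)" using t1 by simp
    have s10: "s1 0 = init_memory inp 0" using same1[of 0] K by simp
    have inp01: "init_memory inp 0 0 = n" "init_memory inp 0 1 = M"
      using inp_nth(1,2) off_len by (simp_all add: init_memory_def inp_def enc_cnf_def enc_lists_def)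
    let ?s2 = "s1(K + 4 := (s1 (K + 4))(0 := M), K + 5 := (s1 (K + 5))(0 := g), K + 6 := (s1 (K + 6))(0 := h))"
    have "wp (Seq (move_prog K) (Seq (powers_prog K) (Seq (Set (K + 7) (Load (K + 2) (V (K + 5))))
       (Seq (Set (K + 9) (Const 1)) (For (K + 10) (Op Add (V (K + 6)) (Op Add (V (K + 7)) (V (K + 7)))) (row_prog K))))))
      ?Q (Suc (Suc (Suc T1))) ?s2"
    proof (rule wp_Seq, rule wp_move_prog[where xs = inp], goal_cases)
      case 1 show ?case using s10 K by simp
    next
      case 2 show ?case using off by simp
    next
      case 3 show ?case using same1[of K] s0 K by simp
    next
      case 4 show ?case by (rule K)
    next
      case (5 T3 s3)
      show ?case
      proof (rule wp_Seq, rule wp_powers_prog[where g = g], goal_cases)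
        case 1 show ?case using 5(3)[of "K + 5"] by simp
      next
        case 2 show ?case using 5(3)[of "K + 2"] same1[of "K + 2"] s0 by simp
      next
        case (3 T4 s4)
        note same3 = 5(3) and same4 = 3(2)
        have same: "s4 a = ?s2 a" if "a \<notin> {0, K, K + 2, K + 10, K + 11}" for a
          using same4[of a] same3[of a] that by simp
        let ?s4 = "s4(K + 7 := (s4 (K + 7))(0 := p))"
        have z: "s4 a = (\<lambda>_. 0)" if "0 < a" "a < K" for a
          using same[of a] same1[of a] s0[of a] that by simp
        have pw: "\<forall>i\<le>g. s4 (K + 2) i = 2 ^ i" by (rule 3(1))
        have s4: "s4 0 = (\<lambda>_. 0)" "s4 K = init_memory inp 0" "s4 (K + 4) 0 = M" "s4 (K + 5) 0 = g" "s4 (K + 6) 0 = h"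
          "\<forall>q<M. s4 (K + 1) q = offs q"
          using same4[of 0] same4[of K] 5(1,2) same[of "K + 4"] same[of "K + 5"] same[of "K + 6"] same[of "K + 1"] off K
          by simp_all
        have env4: "env K ?s4" unfolding env_def using s4 pw z K by (simp add: p_def)
        have mem1: "(\<lambda>_. 0) = init_memory (0 # out 0) 0"
          by (simp add: out_def init_memory_def fun_eq_iff)
        show ?case
        proof (intro wp_Seq wp_Store, rule wp_For[where N = N and
            I = "\<lambda>i T' s'. before_row K i s' \<and> T' \<le> T4 + 3 + (\<Sum>u<i. 10 + lim u * (22 + 10 * k))"])
          fix i T5 s5
          assume I: "before_row K i s5 \<and> T5 \<le> T4 + 3 + (\<Sum>u<i. 10 + lim u * (22 + 10 * k))"
            and i: "s5 (K + 10) 0 = i" "i < N"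
          show "wp (row_prog K) (\<lambda>T' s'. s' (K + 10) 0 = i \<and> before_row K (Suc i) (s'(K + 10 := (s' (K + 10))(0 := Suc i))) \<and>
            Suc T' \<le> T4 + 3 + (\<Sum>u<Suc i. 10 + lim u * (22 + 10 * k))) (Suc T5) s5"
            by (rule wp_mono[OF row_prog[where s = s5 and i = i and T = "Suc T5", OF _ i K]])
              (use I K in \<open>auto simp: before_row_def intro: env_cong\<close>)
        next
          fix T5 s5
          assume I: "before_row K N s5 \<and> T5 \<le> T4 + 3 + (\<Sum>u<N. 10 + lim u * (22 + 10 * k))"
          \<comment> \<open>The \<open>h\<close> clique rows have \<open>N\<close> columns each and
            the \<open>2 * p\<close> assignment rows only \<open>h\<close>; both parts are at most h
            * N.\<close>
          have "(\<Sum>u<N. lim u) = (\<Sum>u<h. lim u) + (\<Sum>u=h..<N. lim u)"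
            using h_less by (simp add: lessThan_atLeast0 sum.atLeastLessThan_concat)
          also have "(\<Sum>u<h. lim u) = h * N" by (simp add: lim_def)
          also have "(\<Sum>u=h..<N. lim u) = 2 * p * h" by (simp add: lim_def N_def)
          finally have "(\<Sum>u<N. lim u) \<le> 2 * (h * N)" by (simp add: N_def algebra_simps)
          then have sum: "(\<Sum>u<N. 10 + lim u * (22 + 10 * k)) \<le> 10 * N + 2 * (h * N) * (22 + 10 * k)"
            by (simp add: sum.distrib sum_distrib_right[symmetric])
          let ?B = "(k + 1) * h * N"
          have "T5 \<le> T4 + 3 + 10 * N + 44 * (h * N) + 20 * ((h * N) * k)"
            using I sum by (simp add: algebra_simps)
          moreover have "T4 \<le> T3 + 12 * 2 ^ g" by (rule 3(3))
          moreover have "T3 \<le> T1 + 13 + 4 * M + 4 * (M * k)"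
            using 5(4) off_len(2) by (simp add: algebra_simps)
          moreover have "T1 \<le> 3 + 10 * M + 3 * (M * k)" using t1 by (simp add: algebra_simps)
          moreover have "M * k \<le> h * k" "M + 2 = h" by (simp_all add: h_def)
          ultimately have "Suc T5 \<le> 200 * ?B" using size_bounds by (rule build_time)
          then show "?Q (Suc T5) s5"
            using I by (simp add: before_row_def env_def enc_graph_def out_N)
        next
          fix i T5 s5
          assume "before_row K i s5 \<and> T5 \<le> T4 + 3 + (\<Sum>u<i. 10 + lim u * (22 + 10 * k))"
          then show "exp_val s5 (Op Add (V (K + 6)) (Op Add (V (K + 7)) (V (K + 7)))) = N"
            by (simp add: before_row_def env_def N_def)
        qed (use env4 pw s4 K mem1 in \<open>auto simp: before_row_def p_def out_def intro: env_cong[of K ?s4]\<close>)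
      qed
    qed
    then show ?case using inp01 s10 K by (simp add: wp_simps g_def h_def)
  qed
qed

end

section \<open>Consequences of SETH\<close>

context cnf_input
begin

text \<open>Crude polynomial bounds suffice, as the encoding size affects only the word bound of the
  second program.\<close>

lemma enc_graph_size:
  "length (enc_graph (SG, LL)) \<le> (N + 1) ^ 2" "sum_list (enc_graph (SG, LL)) \<le> (N + 1) ^ 3"
proof -
  have lim: "lim i \<le> N" for i using h_less by (simp add: lim_def)
  have row: "length l \<le> N" "set l \<subseteq> {..N}" if row: "l \<in> set LL" for l
  proof -
    obtain i where l: "l = filter (link i) [0..<lim i]" using row by (auto simp: LL_def)
    show "length l \<le> N" unfolding l using le_trans[OF length_filter_le, of "[0..<lim i]" N] lim[of i] by simp
    show "set l \<subseteq> {..N}" unfolding l using lim[of i] by auto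
  qed
  have "length (concat (map (\<lambda>l. length l # l) ls)) \<le> length ls * (N + 1)" if "set ls \<subseteq> set LL" for ls
    using that
  proof (induction ls)
    case (Cons l ls)
    then show ?case using row(1)[of l] by simp
  qed simp
  from this[of LL]
  have "length (concat (map (\<lambda>l. length l # l) LL)) \<le> length LL * (N + 1)" by simp
  then show len: "length (enc_graph (SG, LL)) \<le> (N + 1) ^ 2"
    by (simp add: enc_graph_def enc_lists_def LL_def power2_eq_square)
  have "x \<le> N" if "x \<in> set (enc_graph (SG, LL))" for x
  proof -
    have "x = length LL \<or> (\<exists>l\<in>set LL. x = length l \<or> x \<in> set l)"
      using that by (auto simp: enc_graph_def enc_lists_def)
    moreover have "length LL = N" by (simp add: LL_def)
    ultimately show ?thesis using row by force
  qed
  moreover have "(\<And>x. x \<in> set xs \<Longrightarrow> x \<le> b) \<Longrightarrow> sum_list xs \<le> length xs * b" for xs and b :: nat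
    by (induction xs) (auto simp: add_mono)
  ultimately have "sum_list (enc_graph (SG, LL)) \<le> length (enc_graph (SG, LL)) * N" by blast
  also have "... \<le> (N + 1) ^ 2 * (N + 1)" using len by (intro mult_mono) auto
  finally show "sum_list (enc_graph (SG, LL)) \<le> (N + 1) ^ 3"
    by (simp add: power3_eq_cube power2_eq_square)
qed

text \<open>The word bound of \<open>q\<close> refers to the graph and has to be bounded by a power
  of \<open>X\<close>, that is, of the formula size plus the total time. The exponent 10100 = 101 *
  100 is that of \<open>ram_tame\<close> for the construction, and X^26 bounds the base for
  \<open>q\<close>.\<close>

lemma build_then_run:
  assumes q: "exec ((2 + length (enc_graph (SG, LL)) + sum_list (enc_graph (SG, LL)) + t) ^ d) q
      (init_memory (enc_graph (SG, LL))) t s"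
    and K: "0 < K" "arrays q \<subseteq> {..<K}"
  shows "\<exists>t1 r. exec ((2 + length inp + sum_list inp + (t1 + t)) ^ (10100 + 26 * d)) (Seq (build_prog K) q)
      (init_memory inp) (t1 + t) r \<and> t1 \<le> 200 * ((k + 1) * h * N) \<and> r 0 = s 0"
proof -
  let ?eg = "enc_graph (SG, LL)"
  obtain t1 s1 where ram: "ram (build_prog K) (init_memory inp) t1 s1" and t1: "t1 \<le> 200 * ((k + 1) * h * N)"
    and s1: "s1 0 = init_memory ?eg 0" "\<And>a. 0 < a \<Longrightarrow> a < K \<Longrightarrow> s1 a = (\<lambda>_. 0)"
    using build_prog[OF K(1)] unfolding wp_def inp_def by auto
  define X where "X = 2 + length inp + sum_list inp + (t1 + t)"
  have X2: "2 \<le> X" by (simp add: X_def)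
  have pow: "X ^ a \<le> X ^ b" if "a \<le> b" for a b using X2 that by (intro power_increasing) auto
  have "\<forall>a\<in>{..<K}. init_memory ?eg a = s1 a"
  proof
    fix a assume "a \<in> {..<K}"
    then show "init_memory ?eg a = s1 a" using s1 by (cases "a = 0") (auto simp: init_memory_def)
  qed
  from exec_cong[OF q K(2) this] obtain r
    where r: "exec ((2 + length ?eg + sum_list ?eg + t) ^ d) q s1 t r" "\<forall>a\<in>{..<K}. s a = r a" by blast
  \<comment> \<open>\<open>N\<close> is exponential in \<open>n\<close>, but it is a number that a
    tame program has stored, hence linear in the input and in the time already spent.\<close>
  have "N = s1 0 0" unfolding s1 by (simp add: init_memory_def enc_graph_def enc_lists_def LL_def)
  also have "... \<le> sum_list inp + 100 * t1" by (rule ram_tame(2)[OF tame_build_prog ram])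
  \<comment> \<open>The factor 100 is below 2^7, and \<open>X\<close> is at least 2; so seven more
    powers of \<open>X\<close> cover it.\<close>
  finally have "N + 1 \<le> 2 ^ 7 * X" by (simp add: X_def)
  also have "... \<le> X ^ 7 * X" using X2 by (intro mult_right_mono power_mono) auto
  finally have N: "N + 1 \<le> X ^ 8" by (simp add: power_Suc2[symmetric] del: power_Suc)
  have "length ?eg \<le> X ^ 24" "sum_list ?eg \<le> X ^ 24"
    using enc_graph_size power_mono[OF N, of 2] power_mono[OF N, of 3] pow[of 16 24]
    by (auto simp: power_mult[symmetric])
  moreover have "2 + t \<le> X ^ 1" by (simp add: X_def)
  ultimately have "2 + length ?eg + sum_list ?eg + t \<le> 2 ^ 2 * X ^ 24" using pow[of 1 24] by simp
  also have "... \<le> X ^ 2 * X ^ 24" using X2 by (intro mult_right_mono power_mono) auto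
  finally have "2 + length ?eg + sum_list ?eg + t \<le> X ^ 26" by (simp add: power_add[symmetric])
  then have "(2 + length ?eg + sum_list ?eg + t) ^ d \<le> X ^ (26 * d)" by (metis power_mono power_mult zero_le)
  also have "... \<le> X ^ (10100 + 26 * d)" by (rule pow) simp
  finally have 2: "exec (X ^ (10100 + 26 * d)) q s1 t r" by (rule exec_mono[OF r(1)])
  have "(2 + length inp + sum_list inp + t1) ^ ((100 + 1) * 100) \<le> X ^ ((100 + 1) * 100)"
    by (intro power_mono) (auto simp: X_def)
  also have "... \<le> X ^ (10100 + 26 * d)" by (rule pow) simp
  finally have "exec (X ^ (10100 + 26 * d)) (build_prog K) (init_memory inp) t1 s1"
    by (rule exec_mono[OF ram_tame(1)[OF tame_build_prog ram]])
  then have "exec (X ^ (10100 + 26 * d)) (Seq (build_prog K) q) (init_memory inp) (t1 + t) r"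
    using 2 by (rule exec.Seq)
  moreover have "r 0 = s 0" using r(2) K(1) by auto
  ultimately show ?thesis using t1 unfolding X_def by blast
qed

end

lemma decides_cnf:
  assumes q: "decides_in_time q
      (graph_instances (\<lambda>G. split_graph G \<and> has_dominating_edge G \<and> diam G \<in> {2, 3}))
      enc_graph (\<lambda>(G, L). diam G = 3) T"
    and T: "\<And>x. 0 \<le> T x"
    and B: "\<And>n F. k_cnf k n F \<Longrightarrow> real ((k + 1) * cnf_input.h F * cnf_input.N n F) +
        T (cnf_input.SG n F, cnf_input.LL n F) \<le> B * T' (n, F)"
  shows "\<exists>p. decides_in_time p {(n, F). k_cnf k n F} enc_cnf (\<lambda>(n, F). satisfiable F) T'"
proof -
  obtain d C where dC: "\<And>x. x \<in> graph_instances (\<lambda>G. split_graph G \<and> has_dominating_edge G \<and> diam G \<in> {2, 3}) \<Longrightarrow>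
      \<exists>t s. exec ((2 + length (enc_graph x) + sum_list (enc_graph x) + t) ^ d) q (init_memory (enc_graph x)) t s \<and>
        real t \<le> C * T x \<and> (s 0 0 \<noteq> 0 \<longleftrightarrow> (case x of (G, L) \<Rightarrow> diam G = 3))"
    using q unfolding decides_in_time_def by meson
  \<comment> \<open>All arrays of the construction lie beyond those of \<open>q\<close>; inserting 0
    covers a program that mentions no array.\<close>
  define K where "K = Suc (Max (insert 0 (arrays q)))"
  have K: "0 < K" "arrays q \<subseteq> {..<K}"
    using finite_arrays[of q] by (auto simp: K_def less_Suc_eq_le)
  have "\<exists>t s. exec ((2 + length (enc_cnf x) + sum_list (enc_cnf x) + t) ^ (10100 + 26 * d)) (Seq (build_prog K) q)
        (init_memory (enc_cnf x)) t s \<and> real t \<le> (max 200 \<bar>C\<bar> * B) * T' x \<and>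
        (s 0 0 \<noteq> 0 \<longleftrightarrow> (case x of (n, F) \<Rightarrow> satisfiable F))"
    if x: "x \<in> {(n, F). k_cnf k n F}" for x
  proof -
    obtain n F where nF: "x = (n, F)" by (cases x)
    interpret cnf_input k n F using x nF by unfold_locales simp
    obtain t s where ts: "exec ((2 + length (enc_graph (SG, LL)) + sum_list (enc_graph (SG, LL)) + t) ^ d) q
        (init_memory (enc_graph (SG, LL))) t s" "real t \<le> C * T (SG, LL)" "s 0 0 \<noteq> 0 \<longleftrightarrow> diam SG = 3"
      using dC[OF instance_SG] by auto
    obtain t1 r where r: "exec ((2 + length inp + sum_list inp + (t1 + t)) ^ (10100 + 26 * d)) (Seq (build_prog K) q)
        (init_memory inp) (t1 + t) r" "t1 \<le> 200 * ((k + 1) * h * N)" "r 0 = s 0"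
      using build_then_run[OF ts(1) K] by blast
    \<comment> \<open>The constant \<open>C\<close> may be negative, hence its absolute value; 200
      is the constant of the construction.\<close>
    let ?c = "max 200 \<bar>C\<bar>"
    have "C * T (SG, LL) \<le> ?c * T (SG, LL)" using T by (intro mult_right_mono) auto
    moreover have "real t1 \<le> 200 * real ((k + 1) * h * N)" using of_nat_mono[OF r(2), where 'a = real] by simp
    moreover have "200 * real ((k + 1) * h * N) \<le> ?c * real ((k + 1) * h * N)" by (intro mult_right_mono) auto
    ultimately have "real (t1 + t) \<le> ?c * (real ((k + 1) * h * N) + T (SG, LL))"
      using ts(2) by (simp add: distrib_left)
    also have "... \<le> ?c * (B * T' (n, F))" using B[OF cnf] by (intro mult_left_mono) auto
    finally have "real (t1 + t) \<le> (?c * B) * T' (n, F)" by (simp add: mult.assoc)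
    moreover have "r 0 0 \<noteq> 0 \<longleftrightarrow> satisfiable F" using r(3) ts(3) diam_SG(2) by simp
    ultimately show ?thesis using r(1) unfolding nF inp_def prod.case by blast
  qed
  then have "decides_in_time (Seq (build_prog K) q) {(n, F). k_cnf k n F} enc_cnf (\<lambda>(n, F). satisfiable F) T'"
    unfolding decides_in_time_def by - (rule exI, rule exI, rule ballI)
  then show ?thesis ..
qed

text \<open>Bernoulli's inequality for the j-th root of \<open>c\<close> bounds n + 1 by a multiple
  of its n-th power; raising this to the power j gives the claim.\<close>

lemma poly_le_exp:
  fixes c :: real
  assumes "1 < c"
  shows "\<exists>B\<ge>0. \<forall>n. (real n + 1) ^ j \<le> B * c ^ n"
proof (cases "j = 0")
  case True
  then show ?thesis using assms by (intro exI[of _ 1]) (simp add: one_le_power)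
next
  case False
  define y where "y = root j c"
  have y: "1 < y" "y ^ j = c" using assms False by (simp_all add: y_def)
  define b where "b = 1 + 1 / (y - 1)"
  have "real n + 1 \<le> b * y ^ n" for n
  proof -
    have 1: "1 + real n * (y - 1) \<le> y ^ n" using Bernoulli_inequality[of "y - 1" n] y(1) by simp
    then have "real n \<le> y ^ n / (y - 1)" using y(1) by (simp add: field_simps)
    moreover have "1 \<le> y ^ n" using y(1) by (simp add: one_le_power)
    ultimately show ?thesis by (simp add: b_def algebra_simps)
  qed
  then have "(real n + 1) ^ j \<le> (b * y ^ n) ^ j" for n by (intro power_mono) auto
  moreover have "(b * y ^ n) ^ j = b ^ j * c ^ n" for n
    by (simp add: power_mult_distrib y(2)[symmetric] power_mult[symmetric] mult.commute)
  moreover have "0 \<le> b ^ j" using y(1) by (simp add: b_def)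
  ultimately show ?thesis by metis
qed

text \<open>A clause is a word of length at most \<open>k\<close> over the \<open>2 * n\<close>
  literals, and clauses are distinct. The base is raised to 2(n + 1) to make powers monotone in the
  exponent; the summand 4 anticipates the estimate of \<open>N\<close>.\<close>

lemma (in cnf_input) clauses_bound: "M + 4 \<le> (k + 5) * 2 ^ k * (n + 1) ^ k"
proof -
  let ?A = "{..<n} \<times> (UNIV :: bool set)"
  have "set F \<subseteq> {c. set c \<subseteq> ?A \<and> length c \<le> k}" using cnf by (fastforce simp: k_cnf_def)
  then have "card (set F) \<le> card {c. set c \<subseteq> ?A \<and> length c \<le> k}"
    by (intro card_mono finite_lists_length_le) auto
  also have "... = (\<Sum>i\<le>k. (2 * n) ^ i)" by (simp add: card_lists_length_le card_cartesian_product mult.commute)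
  also have "... \<le> (\<Sum>i\<le>k. (2 * (n + 1)) ^ k)"
  proof (rule sum_mono)
    fix i assume "i \<in> {..k}"
    then have "(2 * (n + 1)) ^ i \<le> (2 * (n + 1)) ^ k" by (intro power_increasing) auto
    moreover have "(2 * n) ^ i \<le> (2 * (n + 1)) ^ i" by (intro power_mono) auto
    ultimately show "(2 * n) ^ i \<le> (2 * (n + 1)) ^ k" by (rule order_trans[rotated])
  qed
  also have "... = (k + 1) * (2 * (n + 1)) ^ k" by simp
  finally have "M \<le> (k + 1) * (2 * (n + 1)) ^ k" using cnf by (simp add: k_cnf_def M_def distinct_card)
  moreover have "1 \<le> (2 * (n + 1)) ^ k" by simp
  ultimately have "M + 4 \<le> (k + 1) * (2 * (n + 1)) ^ k + 4 * (2 * (n + 1)) ^ k" by linarith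
  also have "... = (k + 5) * (2 * (n + 1)) ^ k" by (simp only: distrib_right[symmetric]) simp
  also have "... = (k + 5) * 2 ^ k * (n + 1) ^ k" by (simp only: power_mult_distrib mult.assoc)
  finally show ?thesis .
qed

text \<open>Let Y = (M + 4)^2 * 2^g, which bounds h * N and the number of edges. In Y^(2 - e) the
  exponential part is at most 2 * 2^(n(1 - e/2)), the factor 2 coming from rounding \<open>g\<close>
  up. The polynomial part is at most (M + 4)^4 and is paid with 2^(ne/4), so half of the saving e/2
  survives. Since e <= 1, Y <= Y^(2 - e) covers the construction as well.\<close>

lemma cnf_time_bound:
  fixes e :: real
  assumes e: "0 < e" "e \<le> 1"
  shows "\<exists>B. \<forall>n F. k_cnf k n F \<longrightarrow> real ((k + 1) * cnf_input.h F * cnf_input.N n F) +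
      real (card (edges (cnf_input.SG n F))) powr (2 - e) \<le> B * (2 powr (1 - e / 4)) ^ n"
proof -
  obtain b where b: "0 \<le> b" "\<And>n. (real n + 1) ^ (4 * k) \<le> b * (2 powr (e / 4)) ^ n"
    using poly_le_exp[of "2 powr (e / 4)" "4 * k"] e by auto
  define a where "a = real ((k + 5) * 2 ^ k)"
  have "real ((k + 1) * cnf_input.h F * cnf_input.N n F) + real (card (edges (cnf_input.SG n F))) powr (2 - e)
      \<le> (real (k + 2) * a ^ 4 * b * 2) * (2 powr (1 - e / 4)) ^ n" if F: "k_cnf k n F" for n F
  proof -
    interpret cnf_input k n F by unfold_locales (rule F)
    define Y where "Y = real ((M + 4) ^ 2 * 2 ^ g)"
    have "N \<le> (M + 4) * 2 ^ g"
    proof -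
      have "M + 2 \<le> (M + 2) * 2 ^ g" using mult_le_mono2[of 1 "2 ^ g" "M + 2"] by simp
      then show ?thesis by (simp add: N_def h_def p_def algebra_simps)
    qed
    then have "h * N \<le> (M + 4) * ((M + 4) * 2 ^ g)" by (intro mult_le_mono) (simp add: h_def)
    then have "real (h * N) \<le> real ((M + 4) * ((M + 4) * 2 ^ g))" by (rule of_nat_mono)
    then have hN: "real (h * N) \<le> Y" by (simp add: Y_def power2_eq_square mult.assoc)
    have "1 \<le> h * N" using card_edges_SG by linarith
    then have "1 \<le> real (h * N)" by linarith
    then have Y1: "1 \<le> Y" using hN by linarith
    have "real (card (edges SG)) \<le> real (h * N)" using card_edges_SG(2) by (rule of_nat_mono)
    then have "real (card (edges SG)) powr (2 - e) \<le> Y powr (2 - e)"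
      using hN e by (intro powr_mono2) auto
    moreover have "real ((k + 1) * h * N) \<le> real (k + 1) * Y powr (2 - e)"
    proof -
      have "Y powr 1 \<le> Y powr (2 - e)" using Y1 e by (intro powr_mono) auto
      then have "real (h * N) \<le> Y powr (2 - e)" using hN Y1 by simp
      then have "real (k + 1) * real (h * N) \<le> real (k + 1) * Y powr (2 - e)" by (intro mult_left_mono) auto
      then show ?thesis by (simp only: of_nat_mult mult.assoc)
    qed
    ultimately have 1: "real ((k + 1) * h * N) + real (card (edges SG)) powr (2 - e) \<le> real (k + 2) * Y powr (2 - e)"
      by (simp add: algebra_simps)
    have "Y powr (2 - e) = (real (M + 4) powr 2) powr (2 - e) * (2 powr real g) powr (2 - e)"
    proof -
      have "Y = real (M + 4) powr 2 * 2 powr real g" by (simp add: Y_def powr_realpow)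
      then show ?thesis by (metis powr_mult powr_ge_zero)
    qed
    also have "... \<le> (a ^ 4 * (b * (2 powr (e / 4)) ^ n)) * 2 powr (real n * (1 - e / 2) + 1)"
    proof (rule mult_mono)
      have "(real (M + 4) powr 2) powr (2 - e) \<le> real (M + 4) powr 4"
        unfolding powr_powr using e by (intro powr_mono) auto
      also have "... = real (M + 4) ^ 4" by (subst powr_realpow[symmetric]) auto
      also have "... \<le> (a * (real n + 1) ^ k) ^ 4"
      proof (rule power_mono)
        have "real (M + 4) \<le> real ((k + 5) * 2 ^ k * (n + 1) ^ k)" by (rule of_nat_mono[OF clauses_bound])
        also have "... = a * (real n + 1) ^ k" by (simp add: a_def add.commute)
        finally show "real (M + 4) \<le> a * (real n + 1) ^ k" .
      qed simp
      also have "... = a ^ 4 * (real n + 1) ^ (4 * k)"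
        by (simp add: power_mult_distrib power_mult[symmetric] mult.commute)
      also have "... \<le> a ^ 4 * (b * (2 powr (e / 4)) ^ n)"
        using b(2) by (intro mult_left_mono) (auto simp: a_def)
      finally show "(real (M + 4) powr 2) powr (2 - e) \<le> a ^ 4 * (b * (2 powr (e / 4)) ^ n)" .
      have "real g \<le> (real n + 1) / 2" by (simp add: g_def)
      then have "real g * (2 - e) \<le> (real n + 1) / 2 * (2 - e)" using e by (intro mult_right_mono) auto
      also have "... \<le> real n * (1 - e / 2) + 1" using e by (simp add: field_simps)
      finally show "(2 powr real g) powr (2 - e) \<le> 2 powr (real n * (1 - e / 2) + 1)"
        unfolding powr_powr by (intro powr_mono) auto
      show "0 \<le> a ^ 4 * (b * (2 powr (e / 4)) ^ n)" using b(1) by (simp add: a_def)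
    qed simp
    also have "... = a ^ 4 * b * 2 * ((2 powr (e / 4)) ^ n * 2 powr (real n * (1 - e / 2)))"
      by (simp add: powr_add)
    also have "(2 powr (e / 4)) ^ n * 2 powr (real n * (1 - e / 2)) = (2 powr (1 - e / 4)) ^ n"
    proof -
      have "(2 powr x) ^ n = 2 powr (real n * x)" for x :: real by (simp add: powr_power mult.commute)
      moreover have "real n * (e / 4) + real n * (1 - e / 2) = real n * (1 - e / 4)" by (simp add: field_simps)
      ultimately show ?thesis by (simp add: powr_add[symmetric])
    qed
    finally have "real (k + 2) * Y powr (2 - e) \<le> real (k + 2) * (a ^ 4 * b * 2 * (2 powr (1 - e / 4)) ^ n)"
      by (intro mult_left_mono) auto
    then have "real ((k + 1) * h * N) + real (card (edges SG)) powr (2 - e)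
        \<le> real (k + 2) * (a ^ 4 * b * 2 * (2 powr (1 - e / 4)) ^ n)" using 1 by (rule order_trans[rotated])
    then show ?thesis by (simp only: mult.assoc)
  qed
  then show ?thesis by blast
qed

lemma seth_no_subquadratic:
  assumes SETH: SETH and e: "e > 0"
    and q: "decides_in_time q
      (graph_instances (\<lambda>G. split_graph G \<and> has_dominating_edge G \<and> diam G \<in> {2, 3}))
      enc_graph (\<lambda>(G, L). diam G = 3) (\<lambda>(G, L). real (card (edges G)) powr (2 - e))"
  shows False
proof -
  \<comment> \<open>For e > 1 the exponent 2 - e would fall below 1 and no longer cover the
    construction time; passing to the minimum only weakens the assumed time bound.\<close>
  define d where "d = min e 1"
  have d: "0 < d" "d \<le> 1" "d \<le> e" using e by (auto simp: d_def)
  have "2 powr (1 - d / 4) < 2 powr 1" using d by (intro powr_less_mono) auto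
  \<comment> \<open>The gap between 2 and the achieved base serves as the epsilon of
    \<open>SETH\<close>.\<close>
  then have "0 < 2 - 2 powr (1 - d / 4)" by simp
  then obtain k where k: "\<not> (\<exists>p. decides_in_time p {(n, F). k_cnf k n F} enc_cnf
       (\<lambda>(n, F). satisfiable F) (\<lambda>(n, F). (2 - (2 - 2 powr (1 - d / 4))) ^ n))"
    using SETH unfolding SETH_def by blast
  obtain B where B: "\<And>n F. k_cnf k n F \<Longrightarrow> real ((k + 1) * cnf_input.h F * cnf_input.N n F) +
      real (card (edges (cnf_input.SG n F))) powr (2 - d) \<le> B * (2 powr (1 - d / 4)) ^ n"
    using cnf_time_bound[OF d(1,2)] by blast
  have "real ((k + 1) * cnf_input.h F * cnf_input.N n F) +
      real (card (edges (cnf_input.SG n F))) powr (2 - e) \<le> B * (2 powr (1 - d / 4)) ^ n"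
    if F: "k_cnf k n F" for n F
  proof -
    interpret cnf_input k n F by unfold_locales (rule F)
    have "real (card (edges SG)) powr (2 - e) \<le> real (card (edges SG)) powr (2 - d)"
      using card_edges_SG(1) d(3) by (intro powr_mono) auto
    then show ?thesis using B[OF F] by linarith
  qed
  then show False
    using k decides_cnf[OF q, of k B "\<lambda>(n, F). (2 - (2 - 2 powr (1 - d / 4))) ^ n"] by auto
qed

theorem theorem5:
  shows "(\<forall>(G :: 'a ugraph) s xs u ys v.
            connected_graph G \<and> chordal G \<and> has_dominating_shortest_path G \<and>
            s \<in> verts G \<and> lexbfs G s xs \<and> u = last xs \<and> lexbfs G u ys \<and> v = last ys \<and>
            ecc G v \<ge> 3 \<longrightarrow> ecc G v = diam G)
       \<and> (\<exists>p. decides_in_time p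
            (graph_instances (\<lambda>G. chordal G \<and> has_dominating_shortest_path G)) enc_graph
            (\<lambda>(G, L). diam G \<ge> 4)
            (\<lambda>(G, L). real (card (verts G) + card (edges G))))
       \<and> (SETH \<longrightarrow> \<not> (\<exists>p. \<exists>\<epsilon>::real. \<epsilon> > 0 \<and> decides_in_time p
            (graph_instances (\<lambda>G. split_graph G \<and> has_dominating_edge G \<and> diam G \<in> {2, 3}))
            enc_graph
            (\<lambda>(G, L). diam G = 3)
            (\<lambda>(G, L). real (card (edges G)) powr (2 - \<epsilon>))))"
proof (intro conjI allI impI notI, goal_cases)
  case (1 G s xs u ys v)
  then show ?case by (auto intro: chordal_two_sweep)
next
  case 2
  show ?case by (rule exI) (rule diam_at_least_four_linear)
next
  case 3
  then show ?case by (elim exE conjE) (rule seth_no_subquadratic)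
qed

end
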